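(* Let $\mathbb{T}$ be a non-descending generalized algebraic theory with the maximum dependency rank $n$ of its sort symbols. Then $\delta(\mathbf{Mod}(\mathbf{Cl}(\mathbb{T})))\le n+2$, where $\mathbf{Mod}(\mathbf{Cl}(\mathbb{T}))$ is the category of models of the syntactic clan of $\mathbb{T}$ and $\delta$ is the global minimum regular-decomposition number.
   Context: Regular-decomposition numbers. Small means belonging to a fixed universe $\mathcal{U}_1$; $\upsilon$ is the smallest ordinal not in $\mathcal{U}_1$. Let $\mathbf{E}$ be the class of regular epimorphisms (coequalizers of some parallel pair) of a category $\mathscr{C}$. $p\perp m$ means every commutative square $mu=vp$ has a unique $h$ with $hp=u$, $mh=v$. A regular decomposition of $f\colon A\to X$ is a functor $A_\bullet$ from the poset of ordinals $<\upsilon$ to $\mathscr{C}$ with $A_0=A$, $A_\gamma\cong\mathrm{colim}_{\beta<\gamma}A_\beta$ for non-zero limit $\gamma$ and all $A_\beta\to A_{\beta+1}$ in $\mathbf{E}$, together with a cocone $(f_\alpha\colon A_\alpha\to X)_\alpha$, $f_0=f$, such that for some $\alpha<\upsilon$ one has $e\perp f_\beta$ for all $e\in\mathbf{E}$, $\beta\in[\alpha,\upsilon)$; the least such $\alpha$ is its length. $\delta(f)$ is the smallest length of a regular decomposition of $f$, and $\delta(\mathscr{C})$ is the smallest ordinal $\alpha$ with $\delta(f)<\alpha$ for all morphisms $f$ of $\mathscr{C}$ (defined when all $\delta(f)$ are; this is so for locally presentable categories). Generalized algebraic theories (GATs). Fix a small set of variables. A signature $\Sigma$ is a pair of small sets: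 sort symbols and operator symbols. Expressions over $\Sigma$ are variables and $s(e_1,\dots,e_m)$ with $s$ a symbol and $e_i$ expressions; $\mathrm{fv}$ denotes free variables and $e[t/x]$ substitution. A precontext $\Gamma$ is a finite list $x_1:T_1,\dots,x_m:T_m$ with distinct variables $x_i$ and expressions $T_i$; $\mathrm{fv}(\Gamma)=\{x_1,\dots,x_m\}$. Prejudgments: $\vdash\Gamma\ \mathsf{ctx}$; $\Gamma\vdash T\ \mathsf{type}$; $\Gamma\vdash t:T$; $\Gamma\vdash T_1=T_2\ \mathsf{type}$; $\Gamma\vdash t_1=t_2:T$. A pretheory $\mathbb{T}$ over $\Sigma$ assigns to each sort symbol $A$ a prejudgment $\Gamma_A\vdash A(x_1,\dots,x_m)\ \mathsf{type}$ ($x_1,\dots,x_m$ the variables of $\Gamma_A$), to each operator symbol $f$ a prejudgment $\Gamma_f\vdash f(x_1,\dots,x_m):T_f$ ($x_i$ the variables of $\Gamma_f$), together with a small set of term equality prejudgments, called axioms. Derivability from $\mathbb{T}$ is generated inductively by the following rules, where $\Gamma\vdash K$ stands for any of the last four forms: (1) reflexivity, symmetry and transitivity of type equality and of term equality (reflexivity for derivable types/terms); (2) from $\Gamma\vdash T_1=T_2\ \mathsf{type}$ and $\Gamma\vdash t:T_1$ (resp. $\Gamma\vdash t=t':T_1$) infer $\Gamma\vdash t:T_2$ (resp. $\Gamma\vdash t=t':T_2$); (3) renaming of the variables of $\vdash\Gamma\ \mathsf{ctx}$ or $\Gamma\vdash K$ along a bijection $\mathrm{fv}(\Gamma)\cong\mathrm{fv}(\Gamma)$;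 (4) $\vdash()\ \mathsf{ctx}$; from $\Gamma\vdash T\ \mathsf{type}$ and $x\notin\mathrm{fv}(\Gamma)$ infer $\vdash\Gamma,x:T\ \mathsf{ctx}$ and $\Gamma,x:T\vdash x:T$; (5) weakening: from $\Gamma\vdash T\ \mathsf{type}$, $\Gamma,\Delta\vdash K$ and $x\notin\mathrm{fv}(\Gamma)\cup\mathrm{fv}(\Delta)$ infer $\Gamma,x:T,\Delta\vdash K$; (6) substitution: from $\Gamma\vdash t:T$ and $\Gamma,x:T,\Delta\vdash K$ infer $\Gamma,\Delta[t/x]\vdash K[t/x]$; (7) from $\Gamma\vdash t_1=t_2:T$ and $\Gamma,x:T,\Delta\vdash T'\ \mathsf{type}$ infer $\Gamma,\Delta[t_1/x]\vdash T'[t_1/x]=T'[t_2/x]\ \mathsf{type}$; from $\Gamma\vdash t_1=t_2:T$ and $\Gamma,x:T,\Delta\vdash t':T'$ infer $\Gamma,\Delta[t_1/x]\vdash t'[t_1/x]=t'[t_2/x]:T'[t_1/x]$; (8) for a sort symbol $A$, from $\vdash\Gamma_A\ \mathsf{ctx}$ infer $\Gamma_A\vdash A(x_1,\dots,x_m)\ \mathsf{type}$; for an operator symbol $f$, from $\Gamma_f\vdash T_f\ \mathsf{type}$ infer $\Gamma_f\vdash f(x_1,\dots,x_m):T_f$; (9) for an axiom $\Gamma\vdash t=t':T$, from $\Gamma\vdash t:T$ and $\Gamma\vdash t':T$ infer $\Gamma\vdash t=t':T$. A GAT is a pretheory all of whose prejudgments (those assigned to symbols and the axioms) are derivable from it;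 derivable prejudgments are its judgments, and $\Gamma$ is a context of $\mathbb{T}$ if $\vdash\Gamma\ \mathsf{ctx}$ is derivable. (Type equality axioms are not allowed.) Syntactic clan. $\mathbf{Cl}(\mathbb{T})$ is the category whose objects are the contexts of $\mathbb{T}$; a morphism $\Gamma\to(x_1:T_1,\dots,x_m:T_m)$ is a sequence $(t_1,\dots,t_m)$ with judgments $\Gamma\vdash t_i:T_i[t_1/x_1,\dots,t_{i-1}/x_{i-1}]$, modulo derivable componentwise equality; composition is substitution. Its display morphisms are the composites of an isomorphism $\Delta\cong(x_1:T_1,\dots,x_m:T_m)$ followed by a projection $[x_1,\dots,x_k]\colon(x_1:T_1,\dots,x_m:T_m)\to(x_1:T_1,\dots,x_k:T_k)$, $0\le k\le m$. A model of $\mathbf{Cl}(\mathbb{T})$ is a functor $\mathbf{Cl}(\mathbb{T})\to\mathbf{Set}$ (small sets) preserving terminal objects and pullbacks of arbitrary morphisms along display morphisms; $\mathbf{Mod}(\mathbf{Cl}(\mathbb{T}))$ is the category of models and natural transformations (it is locally finitely presentable). Dependency rank. For each sort symbol $A$ of $\mathbb{T}$, inductively $\mathrm{dr}(A)=\max\{\mathrm{dr}(B)\mid B\text{ a sort symbol appearing in }\Gamma_A\}+1$, with $\max\emptyset=-1$ (so a sort symbol defined in the empty context has rank $0$). For a type judgment $\Gamma\vdash T\ \mathsf{type}$, $T$ has the form $A(t_1,\dots,t_m)$ for a unique sort symbol $A$, and $\mathrm{dr}(T)=\mathrm{dr}(A)$. For a context $\Gamma$, $\mathrm{dr}(\Gamma)$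 is the maximum dependency rank of the sort symbols appearing in $\Gamma$. $\mathbb{T}$ is non-descending if $\mathrm{dr}(\Gamma_f)\le\mathrm{dr}(T_f)$ for each operator symbol $f$, and $\mathrm{dr}(\Gamma)\le\mathrm{dr}(T)$ for each axiom $\Gamma\vdash t_1=t_2:T$. *)

theory Defs
  imports "HOL-Library.FuncSet" "HOL-Combinatorics.Permutations"
begin

section \<open>The universe of small sets\<close>

text \<open>
  The type \<open>'u\<close> plays the role of the universe of small sets, with \<open>elts x\<close> the set of members
  of \<open>x\<close>. The conditions say that \<open>elts\<close> is an extensional, well-founded membership structure
  satisfying second-order ZFC; by Mostowski collapse, such a structure is the same as an
  uncountable Grothendieck universe.
\<close>

definition universe :: "('u \<Rightarrow> 'u set) \<Rightarrow> bool" where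
  "universe elts \<longleftrightarrow>
     inj elts \<and>
     wf {(x, y). x \<in> elts y} \<and>
     (\<forall>x Y. Y \<subseteq> elts x \<longrightarrow> Y \<in> range elts) \<and>
     (\<forall>x. \<Union> (elts ` elts x) \<in> range elts) \<and>
     (\<forall>x. {y. elts y \<subseteq> elts x} \<in> range elts) \<and>
     (\<forall>x f. f ` elts x \<in> range elts) \<and>
     (\<exists>x. infinite (elts x))"

text \<open>Sets living in other types are called small when they are in bijection with a member of
  the universe.\<close>

definition small :: "('u \<Rightarrow> 'u set) \<Rightarrow> 'a set \<Rightarrow> bool" where
  "small elts X \<longleftrightarrow> (\<exists>u g. bij_betw g X (elts u))"

text \<open>The ordinals below \<open>\<upsilon>\<close> are the von Neumann ordinals of the universe.\<close>

definition is_ord :: "('u \<Rightarrow> 'u set) \<Rightarrow> 'u \<Rightarrow> bool" where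
  "is_ord elts x \<longleftrightarrow>
     (\<forall>y \<in> elts x. elts y \<subseteq> elts x) \<and> (\<forall>y \<in> elts x. \<forall>z \<in> elts y. elts z \<subseteq> elts y)"

definition ole :: "('u \<Rightarrow> 'u set) \<Rightarrow> 'u \<Rightarrow> 'u \<Rightarrow> bool" where
  "ole elts a b \<longleftrightarrow> a \<in> elts b \<or> a = b"

definition ozero :: "('u \<Rightarrow> 'u set) \<Rightarrow> 'u" where
  "ozero elts = inv elts {}"

definition osucc :: "('u \<Rightarrow> 'u set) \<Rightarrow> 'u \<Rightarrow> 'u" where
  "osucc elts b = inv elts (insert b (elts b))"

primrec ord_of_nat :: "('u \<Rightarrow> 'u set) \<Rightarrow> nat \<Rightarrow> 'u" where
  "ord_of_nat elts 0 = ozero elts"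
| "ord_of_nat elts (Suc n) = osucc elts (ord_of_nat elts n)"

definition olimit :: "('u \<Rightarrow> 'u set) \<Rightarrow> 'u \<Rightarrow> bool" where
  "olimit elts c \<longleftrightarrow>
     is_ord elts c \<and> c \<noteq> ozero elts \<and> (\<forall>b. is_ord elts b \<longrightarrow> c \<noteq> osucc elts b)"

definition is_least_ord :: "('u \<Rightarrow> 'u set) \<Rightarrow> ('u \<Rightarrow> bool) \<Rightarrow> 'u \<Rightarrow> bool" where
  "is_least_ord elts P a \<longleftrightarrow>
     is_ord elts a \<and> P a \<and> (\<forall>b. is_ord elts b \<longrightarrow> P b \<longrightarrow> ole elts a b)"


section \<open>Categories\<close>

text \<open>\<open>Comp C g f\<close> is the composite of \<open>f\<close> followed by \<open>g\<close>.\<close>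

record ('o, 'm) category =
  Ob :: "'o set"
  Ar :: "'m set"
  Dom :: "'m \<Rightarrow> 'o"
  Cod :: "'m \<Rightarrow> 'o"
  Ident :: "'o \<Rightarrow> 'm"
  Comp :: "'m \<Rightarrow> 'm \<Rightarrow> 'm"

definition Hom :: "('o, 'm) category \<Rightarrow> 'o \<Rightarrow> 'o \<Rightarrow> 'm set" where
  "Hom C a b = {f \<in> Ar C. a \<in> Ob C \<and> b \<in> Ob C \<and> Dom C f = a \<and> Cod C f = b}"

definition is_category :: "('o, 'm) category \<Rightarrow> bool" where
  "is_category C \<longleftrightarrow>
     (\<forall>f \<in> Ar C. Dom C f \<in> Ob C \<and> Cod C f \<in> Ob C) \<and>
     (\<forall>a \<in> Ob C. Ident C a \<in> Hom C a a) \<and>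
     (\<forall>a b c. \<forall>f \<in> Hom C a b. \<forall>g \<in> Hom C b c. Comp C g f \<in> Hom C a c) \<and>
     (\<forall>a b. \<forall>f \<in> Hom C a b. Comp C f (Ident C a) = f \<and> Comp C (Ident C b) f = f) \<and>
     (\<forall>a b c d. \<forall>f \<in> Hom C a b. \<forall>g \<in> Hom C b c. \<forall>h \<in> Hom C c d.
        Comp C h (Comp C g f) = Comp C (Comp C h g) f)"

definition is_iso :: "('o, 'm) category \<Rightarrow> 'm \<Rightarrow> bool" where
  "is_iso C f \<longleftrightarrow> f \<in> Ar C \<and>
     (\<exists>g \<in> Hom C (Cod C f) (Dom C f).
        Comp C g f = Ident C (Dom C f) \<and> Comp C f g = Ident C (Cod C f))"

definition is_terminal :: "('o, 'm) category \<Rightarrow> 'o \<Rightarrow> bool" where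
  "is_terminal C t \<longleftrightarrow> t \<in> Ob C \<and> (\<forall>a \<in> Ob C. \<exists>!f. f \<in> Hom C a t)"

text \<open>\<open>is_pullback C p q f g\<close>: the commutative square \<open>f \<circ> p = g \<circ> q\<close> is a pullback.\<close>

definition is_pullback :: "('o, 'm) category \<Rightarrow> 'm \<Rightarrow> 'm \<Rightarrow> 'm \<Rightarrow> 'm \<Rightarrow> bool" where
  "is_pullback C p q f g \<longleftrightarrow>
     (\<exists>P A B X. p \<in> Hom C P A \<and> q \<in> Hom C P B \<and> f \<in> Hom C A X \<and> g \<in> Hom C B X \<and>
        Comp C f p = Comp C g q \<and>
        (\<forall>Q \<in> Ob C. \<forall>u \<in> Hom C Q A. \<forall>v \<in> Hom C Q B. Comp C f u = Comp C g v \<longrightarrow>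
           (\<exists>!h. h \<in> Hom C Q P \<and> Comp C p h = u \<and> Comp C q h = v)))"

definition is_coequalizer :: "('o, 'm) category \<Rightarrow> 'm \<Rightarrow> 'm \<Rightarrow> 'm \<Rightarrow> bool" where
  "is_coequalizer C f g e \<longleftrightarrow>
     (\<exists>A B Q. f \<in> Hom C A B \<and> g \<in> Hom C A B \<and> e \<in> Hom C B Q \<and>
        Comp C e f = Comp C e g \<and>
        (\<forall>Z \<in> Ob C. \<forall>k \<in> Hom C B Z. Comp C k f = Comp C k g \<longrightarrow>
           (\<exists>!h. h \<in> Hom C Q Z \<and> Comp C h e = k)))"

definition regular_epi :: "('o, 'm) category \<Rightarrow> 'm \<Rightarrow> bool" where
  "regular_epi C e \<longleftrightarrow> (\<exists>f g. is_coequalizer C f g e)"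

definition orthogonal :: "('o, 'm) category \<Rightarrow> 'm \<Rightarrow> 'm \<Rightarrow> bool" where
  "orthogonal C p m \<longleftrightarrow>
     (\<forall>u \<in> Hom C (Dom C p) (Dom C m). \<forall>v \<in> Hom C (Cod C p) (Cod C m).
        Comp C m u = Comp C v p \<longrightarrow>
        (\<exists>!h. h \<in> Hom C (Cod C p) (Dom C m) \<and> Comp C h p = u \<and> Comp C m h = v))"

record ('o, 'm, 'p, 'n) ftor =
  fob :: "'o \<Rightarrow> 'p"
  far :: "'m \<Rightarrow> 'n"

text \<open>Functors and natural transformations are \<open>undefined\<close> outside their domain, so that equality
  in HOL is the intended one.\<close>

definition is_functor ::
  "('o, 'm) category \<Rightarrow> ('p, 'n) category \<Rightarrow> ('o, 'm, 'p, 'n) ftor \<Rightarrow> bool" where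
  "is_functor C D F \<longleftrightarrow>
     fob F \<in> Ob C \<rightarrow>\<^sub>E Ob D \<and> far F \<in> extensional (Ar C) \<and>
     (\<forall>a b. \<forall>f \<in> Hom C a b. far F f \<in> Hom D (fob F a) (fob F b)) \<and>
     (\<forall>a \<in> Ob C. far F (Ident C a) = Ident D (fob F a)) \<and>
     (\<forall>a b c. \<forall>f \<in> Hom C a b. \<forall>g \<in> Hom C b c.
        far F (Comp C g f) = Comp D (far F g) (far F f))"

definition is_nat_trans ::
  "('o, 'm) category \<Rightarrow> ('p, 'n) category \<Rightarrow> ('o, 'm, 'p, 'n) ftor \<Rightarrow> ('o, 'm, 'p, 'n) ftor
     \<Rightarrow> ('o \<Rightarrow> 'n) \<Rightarrow> bool" where
  "is_nat_trans C D F G \<tau> \<longleftrightarrow>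
     \<tau> \<in> extensional (Ob C) \<and>
     (\<forall>a \<in> Ob C. \<tau> a \<in> Hom D (fob F a) (fob G a)) \<and>
     (\<forall>a b. \<forall>f \<in> Hom C a b. Comp D (\<tau> b) (far F f) = Comp D (far G f) (\<tau> a))"

definition functor_cat ::
  "('o, 'm) category \<Rightarrow> ('p, 'n) category \<Rightarrow>
     (('o, 'm, 'p, 'n) ftor,
      ('o, 'm, 'p, 'n) ftor \<times> ('o \<Rightarrow> 'n) \<times> ('o, 'm, 'p, 'n) ftor) category" where
  "functor_cat C D =
     \<lparr> Ob = {F. is_functor C D F},
       Ar = {(F, \<tau>, G). is_functor C D F \<and> is_functor C D G \<and> is_nat_trans C D F G \<tau>},
       Dom = (\<lambda>(F, \<tau>, G). F),
       Cod = (\<lambda>(F, \<tau>, G). G),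
       Ident = (\<lambda>F. (F, \<lambda>a \<in> Ob C. Ident D (fob F a), F)),
       Comp = (\<lambda>(G, \<sigma>, H) (F, \<tau>, G'). (F, \<lambda>a \<in> Ob C. Comp D (\<sigma> a) (\<tau> a), H)) \<rparr>"

definition full_subcat :: "('o, 'm) category \<Rightarrow> ('o \<Rightarrow> bool) \<Rightarrow> ('o, 'm) category" where
  "full_subcat C P =
     C \<lparr> Ob := {a \<in> Ob C. P a}, Ar := {f \<in> Ar C. P (Dom C f) \<and> P (Cod C f)} \<rparr>"

definition set_cat :: "('u \<Rightarrow> 'u set) \<Rightarrow> ('u, 'u \<times> ('u \<Rightarrow> 'u) \<times> 'u) category" where
  "set_cat elts =
     \<lparr> Ob = UNIV,
       Ar = {(A, f, B). f \<in> elts A \<rightarrow>\<^sub>E elts B},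
       Dom = (\<lambda>(A, f, B). A),
       Cod = (\<lambda>(A, f, B). B),
       Ident = (\<lambda>A. (A, \<lambda>x \<in> elts A. x, A)),
       Comp = (\<lambda>(B, g, X) (A, f, B'). (A, \<lambda>x \<in> elts A. g (f x), X)) \<rparr>"

definition poset_cat :: "'i set \<Rightarrow> ('i \<Rightarrow> 'i \<Rightarrow> bool) \<Rightarrow> ('i, 'i \<times> 'i) category" where
  "poset_cat I le =
     \<lparr> Ob = I,
       Ar = {(i, j). i \<in> I \<and> j \<in> I \<and> le i j},
       Dom = fst,
       Cod = snd,
       Ident = (\<lambda>i. (i, i)),
       Comp = (\<lambda>(j, k) (i, j'). (i, k)) \<rparr>"

definition is_cocone ::
  "('i, 'j) category \<Rightarrow> ('o, 'm) category \<Rightarrow> ('i, 'j, 'o, 'm) ftor \<Rightarrow> 'o \<Rightarrow> ('i \<Rightarrow> 'm) \<Rightarrow> bool"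
where
  "is_cocone J C F X \<phi> \<longleftrightarrow>
     X \<in> Ob C \<and> (\<forall>i \<in> Ob J. \<phi> i \<in> Hom C (fob F i) X) \<and>
     (\<forall>i k. \<forall>j \<in> Hom J i k. Comp C (\<phi> k) (far F j) = \<phi> i)"

definition is_colimit ::
  "('i, 'j) category \<Rightarrow> ('o, 'm) category \<Rightarrow> ('i, 'j, 'o, 'm) ftor \<Rightarrow> 'o \<Rightarrow> ('i \<Rightarrow> 'm) \<Rightarrow> bool"
where
  "is_colimit J C F X \<phi> \<longleftrightarrow>
     is_cocone J C F X \<phi> \<and>
     (\<forall>Y \<psi>. is_cocone J C F Y \<psi> \<longrightarrow>
        (\<exists>!h. h \<in> Hom C X Y \<and> (\<forall>i \<in> Ob J. Comp C h (\<phi> i) = \<psi> i)))"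


section \<open>Regular-decomposition numbers\<close>

definition ord_cat :: "('u \<Rightarrow> 'u set) \<Rightarrow> ('u, 'u \<times> 'u) category" where
  "ord_cat elts = poset_cat {a. is_ord elts a} (ole elts)"

definition stable_from ::
  "('u \<Rightarrow> 'u set) \<Rightarrow> ('o, 'm) category \<Rightarrow> ('u \<Rightarrow> 'm) \<Rightarrow> 'u \<Rightarrow> bool" where
  "stable_from elts C \<phi> a \<longleftrightarrow>
     (\<forall>b e. is_ord elts b \<longrightarrow> ole elts a b \<longrightarrow> regular_epi C e \<longrightarrow> orthogonal C e (\<phi> b))"

text \<open>At a limit ordinal \<open>c\<close> the transition maps \<open>A\<^sub>b \<rightarrow> A\<^sub>c\<close> are required to exhibit \<open>A\<^sub>c\<close> as
  the colimit, that is, the canonical map from the colimit is the isomorphism. (\<open>is_colimit\<close>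
  only looks at \<open>A\<close> below \<open>c\<close>.)\<close>

definition regular_decomposition ::
  "('u \<Rightarrow> 'u set) \<Rightarrow> ('o, 'm) category \<Rightarrow> 'm \<Rightarrow> ('u, 'u \<times> 'u, 'o, 'm) ftor \<Rightarrow> ('u \<Rightarrow> 'm) \<Rightarrow> bool"
where
  "regular_decomposition elts C f A \<phi> \<longleftrightarrow>
     is_functor (ord_cat elts) C A \<and>
     fob A (ozero elts) = Dom C f \<and>
     (\<forall>c. olimit elts c \<longrightarrow>
        is_colimit (poset_cat (elts c) (ole elts)) C A (fob A c) (\<lambda>b. far A (b, c))) \<and>
     (\<forall>b. is_ord elts b \<longrightarrow> regular_epi C (far A (b, osucc elts b))) \<and>
     is_cocone (ord_cat elts) C A (Cod C f) \<phi> \<and>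
     \<phi> (ozero elts) = f \<and>
     (\<exists>a. is_ord elts a \<and> stable_from elts C \<phi> a)"

definition is_decomposition_length ::
  "('u \<Rightarrow> 'u set) \<Rightarrow> ('o, 'm) category \<Rightarrow> 'm \<Rightarrow> 'u \<Rightarrow> bool" where
  "is_decomposition_length elts C f a \<longleftrightarrow>
     (\<exists>A \<phi>. regular_decomposition elts C f A \<phi> \<and> is_least_ord elts (stable_from elts C \<phi>) a)"

text \<open>The regular-decomposition numbers \<open>\<delta>(f)\<close> and \<open>\<delta>(C)\<close> are partial; we use their graphs.
  \<open>is_delta elts C a\<close> says that every \<open>\<delta>(f)\<close> is defined and that \<open>\<delta>(C)\<close> is the ordinal \<open>a < \<upsilon>\<close>.\<close>

definition is_delta_mor :: "('u \<Rightarrow> 'u set) \<Rightarrow> ('o, 'm) category \<Rightarrow> 'm \<Rightarrow> 'u \<Rightarrow> bool" where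
  "is_delta_mor elts C f a \<longleftrightarrow> is_least_ord elts (is_decomposition_length elts C f) a"

definition is_delta :: "('u \<Rightarrow> 'u set) \<Rightarrow> ('o, 'm) category \<Rightarrow> 'u \<Rightarrow> bool" where
  "is_delta elts C a \<longleftrightarrow>
     is_least_ord elts (\<lambda>a. \<forall>f \<in> Ar C. \<exists>b \<in> elts a. is_delta_mor elts C f b) a"


section \<open>Generalized algebraic theories\<close>

text \<open>The variables are the elements of the type \<open>'v\<close>; sort symbols are taken from \<open>'a\<close> and
  operator symbols from \<open>'f\<close>.\<close>

datatype (fv: 'v, sorts_of: 'a, ops_of: 'f) expr =
  Var 'v
| App "'a + 'f" "('v, 'a, 'f) expr list"

type_synonym ('v, 'a, 'f) precontext = "('v \<times> ('v, 'a, 'f) expr) list"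

datatype 'e stmt =
  IsType 'e
| HasType 'e 'e         \<comment> \<open>\<open>HasType t T\<close> is \<open>t : T\<close>\<close>
| TypeEq 'e 'e
| TermEq 'e 'e 'e       \<comment> \<open>\<open>TermEq t t' T\<close> is \<open>t = t' : T\<close>\<close>

datatype ('v, 'a, 'f) prejudgment =
  Ctx "('v, 'a, 'f) precontext"
| Entails "('v, 'a, 'f) precontext" "('v, 'a, 'f) expr stmt"   (infix \<open>\<turnstile>\<close> 55)

primrec subst :: "('v \<Rightarrow> ('v, 'a, 'f) expr) \<Rightarrow> ('v, 'a, 'f) expr \<Rightarrow> ('v, 'a, 'f) expr" where
  "subst \<sigma> (Var x) = \<sigma> x"
| "subst \<sigma> (App s es) = App s (map (subst \<sigma>) es)"

definition subst1 :: "('v, 'a, 'f) expr \<Rightarrow> 'v \<Rightarrow> ('v, 'a, 'f) expr \<Rightarrow> ('v, 'a, 'f) expr" where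
  "subst1 t x = subst (Var(x := t))"

text \<open>Simultaneous substitution of the terms \<open>ts\<close> for the variables \<open>xs\<close>.\<close>

definition subst_list ::
  "'v list \<Rightarrow> ('v, 'a, 'f) expr list \<Rightarrow> ('v, 'a, 'f) expr \<Rightarrow> ('v, 'a, 'f) expr" where
  "subst_list xs ts =
     subst (\<lambda>y. case map_of (zip xs ts) y of None \<Rightarrow> Var y | Some t \<Rightarrow> t)"

abbreviation rename :: "('v \<Rightarrow> 'v) \<Rightarrow> ('v, 'a, 'f) expr \<Rightarrow> ('v, 'a, 'f) expr" where
  "rename \<pi> \<equiv> map_expr \<pi> id id"

definition subst1_ctx ::
  "('v, 'a, 'f) expr \<Rightarrow> 'v \<Rightarrow> ('v, 'a, 'f) precontext \<Rightarrow> ('v, 'a, 'f) precontext" where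
  "subst1_ctx t x = map (map_prod id (subst1 t x))"

definition rename_ctx ::
  "('v \<Rightarrow> 'v) \<Rightarrow> ('v, 'a, 'f) precontext \<Rightarrow> ('v, 'a, 'f) precontext" where
  "rename_ctx \<pi> = map (map_prod \<pi> (rename \<pi>))"

abbreviation vars :: "('v, 'a, 'f) precontext \<Rightarrow> 'v list" where
  "vars \<Gamma> \<equiv> map fst \<Gamma>"

abbreviation var_terms :: "('v, 'a, 'f) precontext \<Rightarrow> ('v, 'a, 'f) expr list" where
  "var_terms \<Gamma> \<equiv> map Var (vars \<Gamma>)"

abbreviation fv_ctx :: "('v, 'a, 'f) precontext \<Rightarrow> 'v set" where
  "fv_ctx \<Gamma> \<equiv> set (vars \<Gamma>)"

text \<open>
  A pretheory over the signature \<open>(sorts, ops)\<close> assigns \<open>sort_ctx A \<turnstile> A(x\<^sub>1, \<dots>, x\<^sub>m) type\<close> to \<open>A\<close>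
  and \<open>op_ctx f \<turnstile> f(x\<^sub>1, \<dots>, x\<^sub>m) : op_type f\<close> to \<open>f\<close>; only the values on \<open>sorts\<close> and \<open>ops\<close> matter.
  An element \<open>(\<Gamma>, t, t', T)\<close> of \<open>axioms\<close> stands for \<open>\<Gamma> \<turnstile> t = t' : T\<close>.
\<close>

record ('v, 'a, 'f) theory_data =
  sorts :: "'a set"
  ops :: "'f set"
  sort_ctx :: "'a \<Rightarrow> ('v, 'a, 'f) precontext"
  op_ctx :: "'f \<Rightarrow> ('v, 'a, 'f) precontext"
  op_type :: "'f \<Rightarrow> ('v, 'a, 'f) expr"
  axioms :: "(('v, 'a, 'f) precontext \<times> ('v, 'a, 'f) expr \<times> ('v, 'a, 'f) expr \<times>
               ('v, 'a, 'f) expr) set"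

definition expr_over :: "('v, 'a, 'f) theory_data \<Rightarrow> ('v, 'a, 'f) expr \<Rightarrow> bool" where
  "expr_over TT e \<longleftrightarrow> sorts_of e \<subseteq> sorts TT \<and> ops_of e \<subseteq> ops TT"

definition precontext_over :: "('v, 'a, 'f) theory_data \<Rightarrow> ('v, 'a, 'f) precontext \<Rightarrow> bool" where
  "precontext_over TT \<Gamma> \<longleftrightarrow> distinct (vars \<Gamma>) \<and> (\<forall>(x, T) \<in> set \<Gamma>. expr_over TT T)"

definition pretheory :: "('u \<Rightarrow> 'u set) \<Rightarrow> ('v, 'a, 'f) theory_data \<Rightarrow> bool" where
  "pretheory elts TT \<longleftrightarrow>
     small elts (sorts TT) \<and> small elts (ops TT) \<and> small elts (axioms TT) \<and>
     (\<forall>A \<in> sorts TT. precontext_over TT (sort_ctx TT A)) \<and>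
     (\<forall>f \<in> ops TT. precontext_over TT (op_ctx TT f) \<and> expr_over TT (op_type TT f)) \<and>
     (\<forall>(\<Gamma>, t, t', T) \<in> axioms TT.
        precontext_over TT \<Gamma> \<and> expr_over TT t \<and> expr_over TT t' \<and> expr_over TT T)"

definition sort_judgment :: "('v, 'a, 'f) theory_data \<Rightarrow> 'a \<Rightarrow> ('v, 'a, 'f) prejudgment" where
  "sort_judgment TT A =
     (sort_ctx TT A \<turnstile> IsType (App (Inl A) (var_terms (sort_ctx TT A))))"

definition op_judgment :: "('v, 'a, 'f) theory_data \<Rightarrow> 'f \<Rightarrow> ('v, 'a, 'f) prejudgment" where
  "op_judgment TT f =
     (op_ctx TT f \<turnstile> HasType (App (Inr f) (var_terms (op_ctx TT f))) (op_type TT f))"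

inductive derivable :: "('v, 'a, 'f) theory_data \<Rightarrow> ('v, 'a, 'f) prejudgment \<Rightarrow> bool"
  for TT :: "('v, 'a, 'f) theory_data"
where
  type_refl: "derivable TT (\<Gamma> \<turnstile> IsType T) \<Longrightarrow> derivable TT (\<Gamma> \<turnstile> TypeEq T T)"
| type_sym: "derivable TT (\<Gamma> \<turnstile> TypeEq T T') \<Longrightarrow> derivable TT (\<Gamma> \<turnstile> TypeEq T' T)"
| type_trans:
    "derivable TT (\<Gamma> \<turnstile> TypeEq T T') \<Longrightarrow> derivable TT (\<Gamma> \<turnstile> TypeEq T' T'') \<Longrightarrow>
     derivable TT (\<Gamma> \<turnstile> TypeEq T T'')"
| term_refl: "derivable TT (\<Gamma> \<turnstile> HasType t T) \<Longrightarrow> derivable TT (\<Gamma> \<turnstile> TermEq t t T)"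
| term_sym: "derivable TT (\<Gamma> \<turnstile> TermEq t t' T) \<Longrightarrow> derivable TT (\<Gamma> \<turnstile> TermEq t' t T)"
| term_trans:
    "derivable TT (\<Gamma> \<turnstile> TermEq t t' T) \<Longrightarrow> derivable TT (\<Gamma> \<turnstile> TermEq t' t'' T) \<Longrightarrow>
     derivable TT (\<Gamma> \<turnstile> TermEq t t'' T)"
| conv_term:
    "derivable TT (\<Gamma> \<turnstile> TypeEq T T') \<Longrightarrow> derivable TT (\<Gamma> \<turnstile> HasType t T) \<Longrightarrow>
     derivable TT (\<Gamma> \<turnstile> HasType t T')"
| conv_term_eq:
    "derivable TT (\<Gamma> \<turnstile> TypeEq T T') \<Longrightarrow> derivable TT (\<Gamma> \<turnstile> TermEq t t' T) \<Longrightarrow>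
     derivable TT (\<Gamma> \<turnstile> TermEq t t' T')"
| ctx_rename:
    "derivable TT (Ctx \<Gamma>) \<Longrightarrow> \<pi> permutes fv_ctx \<Gamma> \<Longrightarrow> derivable TT (Ctx (rename_ctx \<pi> \<Gamma>))"
| stmt_rename:
    "derivable TT (\<Gamma> \<turnstile> K) \<Longrightarrow> \<pi> permutes fv_ctx \<Gamma> \<Longrightarrow>
     derivable TT (rename_ctx \<pi> \<Gamma> \<turnstile> map_stmt (rename \<pi>) K)"
| ctx_empty: "derivable TT (Ctx [])"
| ctx_extend:
    "derivable TT (\<Gamma> \<turnstile> IsType T) \<Longrightarrow> x \<notin> fv_ctx \<Gamma> \<Longrightarrow> derivable TT (Ctx (\<Gamma> @ [(x, T)]))"
| var_intro:
    "derivable TT (\<Gamma> \<turnstile> IsType T) \<Longrightarrow> x \<notin> fv_ctx \<Gamma> \<Longrightarrow>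
     derivable TT (\<Gamma> @ [(x, T)] \<turnstile> HasType (Var x) T)"
| weakening:
    "derivable TT (\<Gamma> \<turnstile> IsType T) \<Longrightarrow> derivable TT (\<Gamma> @ \<Delta> \<turnstile> K) \<Longrightarrow>
     x \<notin> fv_ctx \<Gamma> \<union> fv_ctx \<Delta> \<Longrightarrow> derivable TT (\<Gamma> @ [(x, T)] @ \<Delta> \<turnstile> K)"
| substitution:
    "derivable TT (\<Gamma> \<turnstile> HasType t T) \<Longrightarrow> derivable TT (\<Gamma> @ [(x, T)] @ \<Delta> \<turnstile> K) \<Longrightarrow>
     derivable TT (\<Gamma> @ subst1_ctx t x \<Delta> \<turnstile> map_stmt (subst1 t x) K)"
| type_cong:
    "derivable TT (\<Gamma> \<turnstile> TermEq t\<^sub>1 t\<^sub>2 T) \<Longrightarrow> derivable TT (\<Gamma> @ [(x, T)] @ \<Delta> \<turnstile> IsType T') \<Longrightarrow>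
     derivable TT (\<Gamma> @ subst1_ctx t\<^sub>1 x \<Delta> \<turnstile> TypeEq (subst1 t\<^sub>1 x T') (subst1 t\<^sub>2 x T'))"
| term_cong:
    "derivable TT (\<Gamma> \<turnstile> TermEq t\<^sub>1 t\<^sub>2 T) \<Longrightarrow> derivable TT (\<Gamma> @ [(x, T)] @ \<Delta> \<turnstile> HasType t' T') \<Longrightarrow>
     derivable TT
       (\<Gamma> @ subst1_ctx t\<^sub>1 x \<Delta> \<turnstile> TermEq (subst1 t\<^sub>1 x t') (subst1 t\<^sub>2 x t') (subst1 t\<^sub>1 x T'))"
| sort_intro:
    "A \<in> sorts TT \<Longrightarrow> derivable TT (Ctx (sort_ctx TT A)) \<Longrightarrow> derivable TT (sort_judgment TT A)"
| op_intro:
    "f \<in> ops TT \<Longrightarrow> derivable TT (op_ctx TT f \<turnstile> IsType (op_type TT f)) \<Longrightarrow>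
     derivable TT (op_judgment TT f)"
| axiom_intro:
    "(\<Gamma>, t, t', T) \<in> axioms TT \<Longrightarrow>
     derivable TT (\<Gamma> \<turnstile> HasType t T) \<Longrightarrow> derivable TT (\<Gamma> \<turnstile> HasType t' T) \<Longrightarrow>
     derivable TT (\<Gamma> \<turnstile> TermEq t t' T)"

definition gat :: "('u \<Rightarrow> 'u set) \<Rightarrow> ('v, 'a, 'f) theory_data \<Rightarrow> bool" where
  "gat elts TT \<longleftrightarrow>
     pretheory elts TT \<and>
     (\<forall>A \<in> sorts TT. derivable TT (sort_judgment TT A)) \<and>
     (\<forall>f \<in> ops TT. derivable TT (op_judgment TT f)) \<and>
     (\<forall>(\<Gamma>, t, t', T) \<in> axioms TT. derivable TT (\<Gamma> \<turnstile> TermEq t t' T))"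


section \<open>The syntactic clan and its models\<close>

text \<open>\<open>comp_type \<Delta> ts i\<close> is \<open>T\<^sub>i[t\<^sub>1/x\<^sub>1, \<dots>, t\<^sub>i\<^sub>-\<^sub>1/x\<^sub>i\<^sub>-\<^sub>1]\<close>, with indices counted from 0 in the code.\<close>

definition comp_type ::
  "('v, 'a, 'f) precontext \<Rightarrow> ('v, 'a, 'f) expr list \<Rightarrow> nat \<Rightarrow> ('v, 'a, 'f) expr" where
  "comp_type \<Delta> ts i = subst_list (take i (vars \<Delta>)) (take i ts) (snd (\<Delta> ! i))"

definition ctx_mor ::
  "('v, 'a, 'f) theory_data \<Rightarrow> ('v, 'a, 'f) precontext \<Rightarrow> ('v, 'a, 'f) precontext \<Rightarrow>
     ('v, 'a, 'f) expr list \<Rightarrow> bool" where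
  "ctx_mor TT \<Gamma> \<Delta> ts \<longleftrightarrow>
     length ts = length \<Delta> \<and>
     (\<forall>i < length \<Delta>. derivable TT (\<Gamma> \<turnstile> HasType (ts ! i) (comp_type \<Delta> ts i)))"

definition ctx_mor_eq ::
  "('v, 'a, 'f) theory_data \<Rightarrow> ('v, 'a, 'f) precontext \<Rightarrow> ('v, 'a, 'f) precontext \<Rightarrow>
     ('v, 'a, 'f) expr list \<Rightarrow> ('v, 'a, 'f) expr list \<Rightarrow> bool" where
  "ctx_mor_eq TT \<Gamma> \<Delta> ts us \<longleftrightarrow>
     ctx_mor TT \<Gamma> \<Delta> ts \<and> ctx_mor TT \<Gamma> \<Delta> us \<and>
     (\<forall>i < length \<Delta>. derivable TT (\<Gamma> \<turnstile> TermEq (ts ! i) (us ! i) (comp_type \<Delta> ts i)))"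

type_synonym ('v, 'a, 'f) cl_arrow =
  "('v, 'a, 'f) precontext \<times> ('v, 'a, 'f) expr list set \<times> ('v, 'a, 'f) precontext"

definition cl_arrow ::
  "('v, 'a, 'f) theory_data \<Rightarrow> ('v, 'a, 'f) precontext \<Rightarrow> ('v, 'a, 'f) precontext \<Rightarrow>
     ('v, 'a, 'f) expr list \<Rightarrow> ('v, 'a, 'f) cl_arrow" where
  "cl_arrow TT \<Gamma> \<Delta> ts = (\<Gamma>, {us. ctx_mor_eq TT \<Gamma> \<Delta> ts us}, \<Delta>)"

text \<open>Composition is substitution on representatives; the union over all representatives is the
  usual way of avoiding a choice.\<close>

definition Cl ::
  "('v, 'a, 'f) theory_data \<Rightarrow> (('v, 'a, 'f) precontext, ('v, 'a, 'f) cl_arrow) category" where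
  "Cl TT =
     \<lparr> Ob = {\<Gamma>. derivable TT (Ctx \<Gamma>)},
       Ar = {cl_arrow TT \<Gamma> \<Delta> ts | \<Gamma> \<Delta> ts.
               derivable TT (Ctx \<Gamma>) \<and> derivable TT (Ctx \<Delta>) \<and> ctx_mor TT \<Gamma> \<Delta> ts},
       Dom = (\<lambda>(\<Gamma>, M, \<Delta>). \<Gamma>),
       Cod = (\<lambda>(\<Gamma>, M, \<Delta>). \<Delta>),
       Ident = (\<lambda>\<Gamma>. cl_arrow TT \<Gamma> \<Gamma> (var_terms \<Gamma>)),
       Comp = (\<lambda>(\<Delta>, N, \<Theta>) (\<Gamma>, M, \<Delta>').
         (\<Gamma>, \<Union>us \<in> N. \<Union>ts \<in> M.
               {ws. ctx_mor_eq TT \<Gamma> \<Theta> (map (subst_list (vars \<Delta>) ts) us) ws}, \<Theta>)) \<rparr>"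

definition cl_projection ::
  "('v, 'a, 'f) theory_data \<Rightarrow> ('v, 'a, 'f) precontext \<Rightarrow> nat \<Rightarrow> ('v, 'a, 'f) cl_arrow" where
  "cl_projection TT \<Gamma> k = cl_arrow TT \<Gamma> (take k \<Gamma>) (var_terms (take k \<Gamma>))"

definition is_display :: "('v, 'a, 'f) theory_data \<Rightarrow> ('v, 'a, 'f) cl_arrow \<Rightarrow> bool" where
  "is_display TT d \<longleftrightarrow>
     (\<exists>\<Gamma> k i. \<Gamma> \<in> Ob (Cl TT) \<and> k \<le> length \<Gamma> \<and>
        is_iso (Cl TT) i \<and> Cod (Cl TT) i = \<Gamma> \<and>
        d = Comp (Cl TT) (cl_projection TT \<Gamma> k) i)"

definition is_model ::
  "('u \<Rightarrow> 'u set) \<Rightarrow> ('v, 'a, 'f) theory_data \<Rightarrow>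
     (('v, 'a, 'f) precontext, ('v, 'a, 'f) cl_arrow, 'u, 'u \<times> ('u \<Rightarrow> 'u) \<times> 'u) ftor \<Rightarrow> bool" where
  "is_model elts TT F \<longleftrightarrow>
     is_functor (Cl TT) (set_cat elts) F \<and>
     (\<forall>\<Gamma>. is_terminal (Cl TT) \<Gamma> \<longrightarrow> is_terminal (set_cat elts) (fob F \<Gamma>)) \<and>
     (\<forall>p q f d. is_display TT d \<longrightarrow> is_pullback (Cl TT) p q f d \<longrightarrow>
        is_pullback (set_cat elts) (far F p) (far F q) (far F f) (far F d))"

definition Mod_Cl where
  "Mod_Cl elts TT = full_subcat (functor_cat (Cl TT) (set_cat elts)) (is_model elts TT)"


section \<open>Dependency rank\<close>

text \<open>The convention \<open>max \<emptyset> = -1\<close>; all ranks are nonnegative, so inserting \<open>-1\<close> is harmless for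
  nonempty sets.\<close>

definition max_rank :: "int set \<Rightarrow> int" where
  "max_rank S = Max (insert (-1) S)"

definition ctx_sorts :: "('v, 'a, 'f) precontext \<Rightarrow> 'a set" where
  "ctx_sorts \<Gamma> = (\<Union>(x, T) \<in> set \<Gamma>. sorts_of T)"

definition sort_dep :: "('v, 'a, 'f) theory_data \<Rightarrow> ('a \<times> 'a) set" where
  "sort_dep TT = {(B, A). A \<in> sorts TT \<and> B \<in> ctx_sorts (sort_ctx TT A)}"

definition dr :: "('v, 'a, 'f) theory_data \<Rightarrow> 'a \<Rightarrow> int" where
  "dr TT = wfrec (sort_dep TT) (\<lambda>r A. max_rank (r ` ctx_sorts (sort_ctx TT A)) + 1)"

definition dr_type :: "('v, 'a, 'f) theory_data \<Rightarrow> ('v, 'a, 'f) expr \<Rightarrow> int" where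
  "dr_type TT T = (case T of App (Inl A) ts \<Rightarrow> dr TT A | _ \<Rightarrow> undefined)"

definition dr_ctx :: "('v, 'a, 'f) theory_data \<Rightarrow> ('v, 'a, 'f) precontext \<Rightarrow> int" where
  "dr_ctx TT \<Gamma> = max_rank (dr TT ` ctx_sorts \<Gamma>)"

definition non_descending :: "('v, 'a, 'f) theory_data \<Rightarrow> bool" where
  "non_descending TT \<longleftrightarrow>
     (\<forall>f \<in> ops TT. dr_ctx TT (op_ctx TT f) \<le> dr_type TT (op_type TT f)) \<and>
     (\<forall>(\<Gamma>, t, t', T) \<in> axioms TT. dr_ctx TT \<Gamma> \<le> dr_type TT T)"

definition is_max_dr :: "('v, 'a, 'f) theory_data \<Rightarrow> int \<Rightarrow> bool" where
  "is_max_dr TT n \<longleftrightarrow> finite (dr TT ` sorts TT) \<and> n = max_rank (dr TT ` sorts TT)"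

text \<open>For a generalized algebraic theory the recursion defining \<open>dr\<close> is well-founded.\<close>

lemma sorts_of_subst: "sorts_of (subst \<sigma> e) \<subseteq> sorts_of e \<union> (\<Union>x \<in> fv e. sorts_of (\<sigma> x))"
proof (induction e)
  case (App s es)
  show ?case
  proof
    fix A
    assume "A \<in> sorts_of (subst \<sigma> (App s es))"
    then consider "A \<in> sorts_of (App s [])" | e where "e \<in> set es" "A \<in> sorts_of (subst \<sigma> e)"
      by auto
    then show "A \<in> sorts_of (App s es) \<union> (\<Union>x \<in> fv (App s es). sorts_of (\<sigma> x))"
    proof cases
      case 2
      from subsetD[OF App.IH[OF 2(1)] 2(2)] 2(1) show ?thesis by auto
    qed auto
  qed
qed simp

lemma sorts_of_subst1: "sorts_of (subst1 t x e) \<subseteq> sorts_of e \<union> sorts_of t"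
proof -
  have "(\<Union>y \<in> fv e. sorts_of ((Var(x := t)) y)) \<subseteq> sorts_of t"
    by (auto split: if_splits)
  then show ?thesis using sorts_of_subst[of "Var(x := t)" e] unfolding subst1_def by blast
qed

primrec judgment_sorts :: "('v, 'a, 'f) prejudgment \<Rightarrow> 'a set" where
  "judgment_sorts (Ctx \<Gamma>) = ctx_sorts \<Gamma>"
| "judgment_sorts (\<Gamma> \<turnstile> K) = ctx_sorts \<Gamma> \<union> (\<Union>e \<in> set_stmt K. sorts_of e)"

lemma ctx_sorts_simps [simp]:
  "ctx_sorts [] = {}"
  "ctx_sorts ((x, T) # \<Gamma>) = sorts_of T \<union> ctx_sorts \<Gamma>"
  "ctx_sorts (\<Gamma> @ \<Delta>) = ctx_sorts \<Gamma> \<union> ctx_sorts \<Delta>"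
  by (auto simp: ctx_sorts_def)

lemma ctx_sorts_subst1: "ctx_sorts (subst1_ctx t x \<Delta>) \<subseteq> ctx_sorts \<Delta> \<union> sorts_of t"
proof (induction \<Delta>)
  case (Cons a \<Delta>)
  then show ?case using sorts_of_subst1[of t x "snd a"]
    by (cases a) (auto simp: subst1_ctx_def)
qed (simp add: subst1_ctx_def)

lemma ctx_sorts_rename: "ctx_sorts (rename_ctx \<pi> \<Delta>) = ctx_sorts \<Delta>"
  by (induction \<Delta>) (auto simp: rename_ctx_def expr.set_map)

lemma derivable_sorts_induct:
  assumes "derivable TT J"
    and W: "\<And>A. A \<in> sorts TT \<Longrightarrow> ctx_sorts (sort_ctx TT A) \<subseteq> W \<Longrightarrow> A \<in> W"
  shows "judgment_sorts J \<subseteq> W"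
  using assms(1)
proof (induction rule: derivable.induct)
  case (substitution \<Gamma> t T x \<Delta> K)
  then have *: "sorts_of t \<subseteq> W" "ctx_sorts \<Gamma> \<subseteq> W" "ctx_sorts \<Delta> \<subseteq> W"
    and K: "e \<in> set_stmt K \<Longrightarrow> sorts_of e \<subseteq> W" for e
    by auto
  have "sorts_of (subst1 t x e) \<subseteq> W" if "e \<in> set_stmt K" for e
    using sorts_of_subst1[of t x e] K[OF that] * by blast
  moreover have "ctx_sorts (subst1_ctx t x \<Delta>) \<subseteq> W"
    using ctx_sorts_subst1[of t x \<Delta>] * by blast
  ultimately show ?case using * by (simp add: stmt.set_map UN_subset_iff)
next
  case (type_cong \<Gamma> t1 t2 T x \<Delta> T')
  then show ?case
    using sorts_of_subst1[of t1 x T'] sorts_of_subst1[of t2 x T'] ctx_sorts_subst1[of t1 x \<Delta>]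
    by (simp; blast)
next
  case (term_cong \<Gamma> t1 t2 T x \<Delta> t' T')
  then show ?case
    using sorts_of_subst1[of t1 x t'] sorts_of_subst1[of t2 x t'] sorts_of_subst1[of t1 x T']
      ctx_sorts_subst1[of t1 x \<Delta>]
    by (simp; blast)
next
  case (sort_intro A)
  with W[of A] show ?case by (auto simp: sort_judgment_def)
next
  case (op_intro f)
  then show ?case by (auto simp: op_judgment_def)
qed (simp_all add: ctx_sorts_rename stmt.set_map expr.set_map)

lemma gat_wf_sort_dep:
  fixes TT :: "('v, 'a, 'f) theory_data"
  assumes "gat elts TT"
  shows "wf (sort_dep TT)"
proof (rule wfUNIVI)
  fix P :: "'a \<Rightarrow> bool" and A
  assume IH: "\<forall>A. (\<forall>B. (B, A) \<in> sort_dep TT \<longrightarrow> P B) \<longrightarrow> P A"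
  have step: "P A" if "ctx_sorts (sort_ctx TT A) \<subseteq> Collect P" for A
    using IH that by (auto simp: sort_dep_def)
  show "P A"
  proof (cases "A \<in> sorts TT")
    case True
    then have "derivable TT (sort_judgment TT A)" using assms by (simp add: gat_def)
    then have "judgment_sorts (sort_judgment TT A) \<subseteq> Collect P"
      by (rule derivable_sorts_induct) (simp add: step)
    then show ?thesis by (simp add: sort_judgment_def)
  next
    case False
    then show ?thesis using IH by (simp add: sort_dep_def)
  qed
qed

lemma dr_eq:
  assumes "gat elts TT" and "A \<in> sorts TT"
  shows "dr TT A = dr_ctx TT (sort_ctx TT A) + 1"
proof -
  have "dr TT A = max_rank (cut (dr TT) (sort_dep TT) A ` ctx_sorts (sort_ctx TT A)) + 1"
    unfolding dr_def by (subst wfrec[OF gat_wf_sort_dep[OF assms(1)]]) (rule refl)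
  also have "cut (dr TT) (sort_dep TT) A ` ctx_sorts (sort_ctx TT A) =
      dr TT ` ctx_sorts (sort_ctx TT A)"
    using assms(2) by (intro image_cong) (auto simp: cut_apply sort_dep_def)
  finally show ?thesis by (simp add: dr_ctx_def)
qed

end

theory Submission
  imports Defs
begin

text \<open>
  A morphism \<open>f: M \<rightarrow> X\<close> of models is orthogonal to all regular epimorphisms when it is a monomorphism,
  in particular when it is injective on every context. So it suffices to reach, in \<open>n + 1\<close> steps, an
  injective map, where one step replaces \<open>M\<close> by the coequalizer \<open>B\<close> of the kernel pair of \<open>f\<close>. After that
  the decomposition is constant (\<open>chain_regular_decomposition\<close>).

  The claim about one step is: if \<open>f\<close> is injective on contexts of rank below \<open>k\<close>, then the induced map
  \<open>B \<rightarrow> X\<close> is injective on contexts of rank at most \<open>k\<close> (\<open>g_inj_low\<close>). For this it is enough that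
  \<open>q: M \<rightarrow> B\<close> is surjective there (\<open>q_surj_low\<close>), since \<open>q\<close> identifies what \<open>f\<close> identifies. Now \<open>B\<close> has no
  proper submodel containing the image of \<open>q\<close>. Consider the elements of \<open>B\<close> at which every term of
  rank at most \<open>k\<close> takes a value in the image of \<open>q\<close>. They form a submodel, and on contexts of rank
  at most \<open>k\<close> this submodel lies in the image, for three reasons.

  \<^item> An element of a context of rank at most \<open>k\<close> lifts to \<open>M\<close> as soon as each of its coordinates does
    (\<open>in_image_if_coordinates\<close>). A coordinate of type \<open>A(\<sigma>)\<close> and the preceding ones have to be lifted
    to matching elements, and whether they match is a question about the context of the sort symbol
    \<open>A\<close>. Its rank is below \<open>k\<close>, so the question can be decided in \<open>X\<close>, where \<open>f\<close> is injective.

  \<^item> If the variables of rank at most \<open>k\<close> take values in the image, so do all terms of rank at most \<open>k\<close>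
    (\<open>terms_in_image\<close>). The theory being non-descending, the arguments of a term of rank at most \<open>k\<close>
    again have rank at most \<open>k\<close>; by the first point they lift together, and the operation can be
    performed in \<open>M\<close>.

  \<^item> The variables of a pullback of a display map come from its two sides (\<open>liftable_pair\<close>), so by the
    second point the family is closed under the pullbacks that models preserve.

  At the start, rank below 0 means the empty context, on which every map is injective.

  Two bodies of theory support this argument. The first is the existence of the coequalizer together with
  its minimality (\<open>kernel_pair_coequalizer\<close>): it is generated by \<open>M\<close> inside the product of all models that
  receive a map from \<open>M\<close> identifying what \<open>f\<close> identifies. That product is large, but the submodel
  generated by \<open>M\<close> is small, being a countable union of images of small sets. The second is the
  metatheory of the syntax: simultaneous substitution (\<open>subst_lemma\<close>), presuppositions
  (\<open>derivable_presup\<close>), congruence (\<open>cong_lemma\<close>) and generation (\<open>derivable_generated\<close>). From these,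
  the syntactic clan is a category with the pullback \<open>extension_pullback\<close> and the comparison squares
  \<open>telescope_pullback\<close>. Generation is what gives the rank of a type a meaning: equal types have the same
  sort symbol.
\<close>

section \<open>Sets and ordinals of a universe\<close>

locale set_universe =
  fixes elts :: "'u \<Rightarrow> 'u set"
  assumes universe: "universe elts"
begin

lemma
  shows inj_elts: "inj elts"
    and wf_elts: "wf {(x, y). x \<in> elts y}"
    and subset_condition: "\<forall>x Y. Y \<subseteq> elts x \<longrightarrow> Y \<in> range elts"
    and Union_condition: "\<forall>x. \<Union> (elts ` elts x) \<in> range elts"
    and image_condition: "\<forall>x f. f ` elts x \<in> range elts"
    and coded_infinite: "\<exists>x. infinite (elts x)"
proof -
  note u = universe[unfolded universe_def]
  show "inj elts" by (rule conjunct1[OF u])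
  note u1 = conjunct2[OF u]
  show "wf {(x, y). x \<in> elts y}" by (rule conjunct1[OF u1])
  note u2 = conjunct2[OF u1]
  show "\<forall>x Y. Y \<subseteq> elts x \<longrightarrow> Y \<in> range elts" by (rule conjunct1[OF u2])
  note u3 = conjunct2[OF u2]
  show "\<forall>x. \<Union> (elts ` elts x) \<in> range elts" by (rule conjunct1[OF u3])
  note u4 = conjunct2[OF conjunct2[OF u3]]
  show "\<forall>x f. f ` elts x \<in> range elts" by (rule conjunct1[OF u4])
  show "\<exists>x. infinite (elts x)" by (rule conjunct2[OF u4])
qed

lemma elts_eq_iff: "elts x = elts y \<longleftrightarrow> x = y"
  by (rule inj_eq[OF inj_elts])

lemma elts_irrefl: "x \<notin> elts x"
  using wf_not_refl[OF wf_elts, of x] by simp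

lemma elts_asym: "x \<in> elts y \<Longrightarrow> y \<notin> elts x"
  using wf_not_sym[OF wf_elts, of x y] by simp

lemma coded_subset: "Y \<subseteq> elts x \<Longrightarrow> Y \<in> range elts"
  using subset_condition by simp

lemma coded_image: "f ` elts x \<in> range elts"
  using image_condition by simp

lemma coded_Union: "\<Union> (elts ` elts x) \<in> range elts"
  using Union_condition by simp

lemma coded_UN:
  assumes "\<And>i. i \<in> elts x \<Longrightarrow> F i \<in> range elts"
  shows "(\<Union>i \<in> elts x. F i) \<in> range elts"
proof -
  obtain u where u: "elts u = (\<lambda>i. inv elts (F i)) ` elts x"
    using coded_image by (metis rangeE)
  have "\<Union> (elts ` elts u) = (\<Union>i \<in> elts x. F i)"
    unfolding u using assms by (auto simp: f_inv_into_f)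
  then show ?thesis using coded_Union by metis
qed

text \<open>An infinite coded set has two elements, and replacement along the map that separates them gives
  every pair.\<close>

lemma coded_pair: "{a, b} \<in> range elts"
proof -
  obtain x where "infinite (elts x)" using coded_infinite by blast
  then obtain y z where yz: "y \<in> elts x" "z \<in> elts x" "y \<noteq> z"
    by (metis finite.simps insertI1 is_singletonI' is_singleton_def)
  then have "(\<lambda>w. if w = y then a else b) ` elts x = {a, b}" by auto
  then show ?thesis using coded_image by metis
qed

lemma coded_insert: "insert a (elts b) \<in> range elts"
proof -
  obtain s where s: "elts s = {a}" using coded_pair[of a a] by (metis insert_absorb2 rangeE)
  obtain p where p: "elts p = {s, b}" using coded_pair[of s b] by (metis rangeE)
  have "\<Union> (elts ` elts p) = insert a (elts b)" using s p by auto
  then show ?thesis using coded_Union by metis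
qed

lemma coded_empty: "{} \<in> range elts"
  by (rule coded_subset) (rule empty_subsetI)

lemma elts_inv: "Y \<in> range elts \<Longrightarrow> elts (inv elts Y) = Y"
  by (rule f_inv_into_f)

subsection \<open>Small sets\<close>

text \<open>Being covered by a coded set is the form in which smallness is established below: the
  covering map need not be injective.\<close>

lemma small_iff_covered: "small elts X \<longleftrightarrow> (\<exists>u g. X \<subseteq> g ` elts u)"
proof
  assume "small elts X"
  then obtain u g where "bij_betw g X (elts u)" unfolding small_def by blast
  then have "inv_into X g ` elts u = X"
    by (rule bij_betw_imp_surj_on[OF bij_betw_inv_into])
  then have "X \<subseteq> inv_into X g ` elts u" by simp
  then show "\<exists>u g. X \<subseteq> g ` elts u" by blast
next
  assume "\<exists>u g. X \<subseteq> g ` elts u"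
  then obtain u g where ug: "X \<subseteq> g ` elts u" by blast
  then have inj: "inj_on (inv_into (elts u) g) X" by (rule inj_on_inv_into)
  have "inv_into (elts u) g ` X \<subseteq> elts u"
    using ug by (auto intro: inv_into_into)
  then obtain v where "elts v = inv_into (elts u) g ` X"
    using coded_subset by (metis rangeE)
  then show "small elts X" unfolding small_def bij_betw_def using inj by metis
qed

lemma small_elts: "small elts (elts u)"
  unfolding small_iff_covered by (intro exI[of _ u] exI[of _ "\<lambda>x. x"]) simp

lemma small_subset: "small elts X \<Longrightarrow> Y \<subseteq> X \<Longrightarrow> small elts Y"
  unfolding small_iff_covered by fast

lemma small_image:
  assumes "small elts X" shows "small elts (f ` X)"
proof -
  obtain u g where "X \<subseteq> g ` elts u" using assms unfolding small_iff_covered by blast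
  then have "f ` X \<subseteq> (f \<circ> g) ` elts u" by auto
  then show ?thesis unfolding small_iff_covered by blast
qed

text \<open>Kuratowski pairs.\<close>

definition kpair :: "'u \<Rightarrow> 'u \<Rightarrow> 'u" where
  "kpair a b = inv elts {inv elts {a, a}, inv elts {a, b}}"

lemma kpair_inject: "kpair a b = kpair c d \<longleftrightarrow> a = c \<and> b = d"
proof
  assume "kpair a b = kpair c d"
  then have "{inv elts {a, a}, inv elts {a, b}} = {inv elts {c, c}, inv elts {c, d}}"
    unfolding kpair_def using elts_inv[OF coded_pair] by metis
  then have "elts ` {inv elts {a, a}, inv elts {a, b}} = elts ` {inv elts {c, c}, inv elts {c, d}}"
    by simp
  then have "{{a, a}, {a, b}} = {{c, c}, {c, d}}"
    by (simp only: image_insert image_empty elts_inv[OF coded_pair])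
  then show "a = c \<and> b = d" by (auto simp: doubleton_eq_iff)
qed simp

text \<open>The members of the family are covered by coded sets \<open>u j\<close> by way of maps \<open>g j\<close>. The disjoint union
  of the \<open>u j\<close>, formed with Kuratowski pairs, is a coded set that covers the union.\<close>

lemma small_UN:
  assumes "small elts I" and "\<And>i. i \<in> I \<Longrightarrow> small elts (X i)"
  shows "small elts (\<Union>i \<in> I. X i)"
proof -
  obtain v h where v: "I \<subseteq> h ` elts v" using assms(1) unfolding small_iff_covered by blast
  define J where "J = {j \<in> elts v. h j \<in> I}"
  have "J \<subseteq> elts v" by (auto simp: J_def)
  then obtain w where w: "elts w = J" using coded_subset by (metis rangeE)
  have "\<forall>j \<in> J. \<exists>u g. X (h j) \<subseteq> g ` elts u"
    using assms(2) unfolding J_def small_iff_covered by blast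
  then obtain u g where ug: "\<And>j. j \<in> J \<Longrightarrow> X (h j) \<subseteq> g j ` elts (u j)" by metis
  have "(\<Union>j \<in> elts w. kpair j ` elts (u j)) \<in> range elts"
    by (rule coded_UN) (rule coded_image)
  then obtain s where s: "elts s = (\<Union>j \<in> J. kpair j ` elts (u j))" using w by (metis rangeE)
  define k where "k p = (let (j, y) = SOME (j, y). p = kpair j y in g j y)" for p
  have k: "k (kpair j y) = g j y" for j y
  proof -
    have "(SOME (j', y'). kpair j y = kpair j' y') = (j, y)"
      by (rule some_equality) (auto simp: kpair_inject)
    then show ?thesis unfolding k_def by simp
  qed
  have "(\<Union>i \<in> I. X i) \<subseteq> k ` elts s"
  proof
    fix x assume "x \<in> (\<Union>i \<in> I. X i)"
    then obtain i where i: "i \<in> I" "x \<in> X i" by blast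
    then obtain j where j: "j \<in> J" "i = h j" using v unfolding J_def by blast
    then obtain y where y: "y \<in> elts (u j)" "x = g j y" using ug[OF j(1)] i(2) by blast
    have "kpair j y \<in> elts s" unfolding s using j(1) y(1) by blast
    moreover have "x = k (kpair j y)" using k y(2) by simp
    ultimately show "x \<in> k ` elts s" by (rule rev_image_eqI)
  qed
  then show ?thesis unfolding small_iff_covered by blast
qed

lemma small_finite_pair: "small elts {a, b}"
proof -
  obtain u where u: "elts u = {inv elts {}, inv elts {inv elts {}, inv elts {}}}"
    using coded_pair by (metis rangeE)
  have "inv elts {inv elts {}, inv elts {}} \<noteq> inv elts {}"
    using elts_inv[OF coded_pair] elts_inv[OF coded_empty] by (metis insert_not_empty)
  then have "{a, b} \<subseteq> (\<lambda>x. if x = inv elts {} then a else b) ` elts u" unfolding u by auto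
  then show ?thesis unfolding small_iff_covered by blast
qed

lemma small_singleton: "small elts {a}"
  using small_finite_pair[of a a] by simp

lemma small_Un:
  assumes "small elts X" "small elts Y" shows "small elts (X \<union> Y)"
proof -
  have "small elts (\<Union>i \<in> {True, False}. if i then X else Y)"
    by (rule small_UN[OF small_finite_pair]) (use assms in auto)
  then show ?thesis by (simp add: Un_commute)
qed

lemma small_Times:
  assumes "small elts X" "small elts Y" shows "small elts (X \<times> Y)"
proof -
  have "small elts (\<Union>x \<in> X. Pair x ` Y)"
    by (intro small_UN small_image assms)
  moreover have "(\<Union>x \<in> X. Pair x ` Y) = X \<times> Y" by auto
  ultimately show ?thesis by simp
qed

lemma small_nat: "small elts (UNIV :: nat set)"
proof -
  obtain x where "infinite (elts x)" using coded_infinite by blast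
  then obtain f :: "nat \<Rightarrow> 'u" where f: "inj f" "range f \<subseteq> elts x"
    using infinite_countable_subset by blast
  have "UNIV \<subseteq> inv f ` elts x"
  proof
    fix n :: nat
    have "n = inv f (f n)" using f(1) by simp
    then show "n \<in> inv f ` elts x" using f(2) by blast
  qed
  then show ?thesis unfolding small_iff_covered by blast
qed

lemma small_lists:
  assumes "small elts X" shows "small elts (lists X)"
proof -
  have len: "small elts {xs \<in> lists X. length xs = n}" for n
  proof (induction n)
    case 0
    have "{xs \<in> lists X. length xs = 0} = {[]}" by auto
    then show ?case using small_singleton by simp
  next
    case (Suc n)
    have "{xs \<in> lists X. length xs = Suc n} \<subseteq>
        (\<lambda>(x, xs). x # xs) ` (X \<times> {xs \<in> lists X. length xs = n})"
      by (auto simp: length_Suc_conv image_iff)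
    then show ?case by (rule small_subset[OF small_image[OF small_Times[OF assms Suc]]])
  qed
  have "lists X = (\<Union>n. {xs \<in> lists X. length xs = n})" by auto
  then show ?thesis using small_UN[OF small_nat, of "\<lambda>n. {xs \<in> lists X. length xs = n}"] len by simp
qed

subsection \<open>Ordinals\<close>

lemma elts_ozero: "elts (ozero elts) = {}"
  unfolding ozero_def by (rule elts_inv[OF coded_empty])

lemma elts_osucc: "elts (osucc elts b) = insert b (elts b)"
  unfolding osucc_def by (rule elts_inv[OF coded_insert])

lemma is_ord_member: "is_ord elts a \<Longrightarrow> b \<in> elts a \<Longrightarrow> is_ord elts b"
proof -
  assume "is_ord elts a" and b: "b \<in> elts a"
  then have 1: "\<And>y. y \<in> elts a \<Longrightarrow> elts y \<subseteq> elts a"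
    and 2: "\<And>y z. y \<in> elts a \<Longrightarrow> z \<in> elts y \<Longrightarrow> elts z \<subseteq> elts y"
    unfolding is_ord_def by simp_all
  have "y \<in> elts a" if "y \<in> elts b" for y using 1[OF b] that by (rule subsetD)
  then show "is_ord elts b" unfolding is_ord_def using 2 b by simp
qed

lemma is_ord_trans: "is_ord elts a \<Longrightarrow> b \<in> elts a \<Longrightarrow> c \<in> elts b \<Longrightarrow> c \<in> elts a"
  unfolding is_ord_def by (meson subsetD)

lemma is_ord_ozero: "is_ord elts (ozero elts)"
  unfolding is_ord_def by (simp add: elts_ozero)

lemma is_ord_osucc: "is_ord elts b \<Longrightarrow> is_ord elts (osucc elts b)"
  unfolding is_ord_def by (auto simp: elts_osucc)

lemma is_ord_linear:
  assumes "is_ord elts a" "is_ord elts b"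
  shows "a \<in> elts b \<or> a = b \<or> b \<in> elts a"
  using assms
proof (induction a arbitrary: b rule: wf_induct_rule[OF wf_elts])
  case (1 a)
  note a_hyps = 1(1) and a_ord = 1(2)
  from 1(3) show ?case
  proof (induction b rule: wf_induct_rule[OF wf_elts])
    case (1 b)
    have IHa: "x \<in> elts c \<or> x = c \<or> c \<in> elts x" if "x \<in> elts a" "is_ord elts c" for x c
      using a_hyps[of x c] that is_ord_member[OF a_ord] by simp
    have IHb: "a \<in> elts y \<or> a = y \<or> y \<in> elts a" if "y \<in> elts b" for y
      using "1.IH"[of y] that is_ord_member[OF "1.prems"] by simp
    show ?case
    proof (rule ccontr)
      assume neg: "\<not> (a \<in> elts b \<or> a = b \<or> b \<in> elts a)"
      have "elts a = elts b"
      proof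
        show "elts a \<subseteq> elts b"
          using IHa[OF _ "1.prems"] neg is_ord_trans[OF a_ord] by blast
        show "elts b \<subseteq> elts a"
          using IHb neg is_ord_trans[OF "1.prems"] by blast
      qed
      then show False using neg elts_eq_iff by blast
    qed
  qed
qed

lemma ole_linear: "is_ord elts a \<Longrightarrow> is_ord elts b \<Longrightarrow> ole elts a b \<or> b \<in> elts a"
  using is_ord_linear[of a b] unfolding ole_def by blast

lemma ole_trans: "is_ord elts c \<Longrightarrow> ole elts a b \<Longrightarrow> ole elts b c \<Longrightarrow> ole elts a c"
  unfolding ole_def using is_ord_trans[of c b a] by blast

lemma ole_refl: "ole elts a a"
  by (simp add: ole_def)

lemma ole_subset: "is_ord elts b \<Longrightarrow> ole elts a b \<Longrightarrow> elts a \<subseteq> elts b"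
  unfolding ole_def using is_ord_trans[of b a] by blast

lemma is_least_ord_exists:
  assumes "is_ord elts a" "P a"
  shows "\<exists>b. is_least_ord elts P b \<and> ole elts b a"
proof -
  obtain b where b: "is_ord elts b" "P b"
    and min: "\<And>y. y \<in> elts b \<Longrightarrow> \<not> (is_ord elts y \<and> P y)"
    using wfE_min[OF wf_elts, of a "{y. is_ord elts y \<and> P y}"] assms
    by (metis (mono_tags, lifting) case_prodI mem_Collect_eq)
  have *: "\<forall>c. is_ord elts c \<longrightarrow> P c \<longrightarrow> ole elts b c"
    using min ole_linear[OF b(1)] by metis
  then have "is_least_ord elts P b" using b unfolding is_least_ord_def by simp
  moreover have "ole elts b a" using * assms by simp
  ultimately show ?thesis by blast
qed

lemma is_ord_of_nat: "is_ord elts (ord_of_nat elts n)"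
  by (induction n) (simp_all add: is_ord_ozero is_ord_osucc)

lemma elts_ord_of_nat: "elts (ord_of_nat elts n) = ord_of_nat elts ` {..<n}"
  by (induction n) (simp_all add: elts_ozero elts_osucc lessThan_Suc)

lemma ord_of_nat_mem: "i < j \<Longrightarrow> ord_of_nat elts i \<in> elts (ord_of_nat elts j)"
  by (simp add: elts_ord_of_nat)

lemma ord_of_nat_inj: "inj (ord_of_nat elts)"
proof (rule linorder_injI)
  fix i j :: nat assume "i < j"
  then show "ord_of_nat elts i \<noteq> ord_of_nat elts j"
    using ord_of_nat_mem[of i j] elts_irrefl[of "ord_of_nat elts i"] by auto
qed

lemma olimit_contains_nat:
  assumes "olimit elts c" shows "ord_of_nat elts j \<in> elts c"
proof (induction j)
  case 0
  have c: "is_ord elts c" "c \<noteq> ozero elts" using assms unfolding olimit_def by auto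
  show ?case using is_ord_linear[OF is_ord_ozero c(1)] c(2) by (auto simp: elts_ozero)
next
  case (Suc j)
  have c: "is_ord elts c" using assms unfolding olimit_def by auto
  have "c \<noteq> osucc elts (ord_of_nat elts j)" using assms is_ord_of_nat[of j] unfolding olimit_def by simp
  moreover have "c \<notin> elts (osucc elts (ord_of_nat elts j))"
    using Suc elts_asym[of "ord_of_nat elts j" c] elts_irrefl[of c] by (auto simp: elts_osucc)
  ultimately show ?case
    using is_ord_linear[OF is_ord_osucc[OF is_ord_of_nat] c] by auto
qed

text \<open>\<open>ostep N a\<close> is the ordinal \<open>a\<close> cut off at the natural number \<open>N\<close>; counting makes it monotone
  without a case distinction on \<open>a\<close>.\<close>

definition ostep :: "nat \<Rightarrow> 'u \<Rightarrow> nat" where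
  "ostep N a = card (elts a \<inter> ord_of_nat elts ` {..<N})"

lemma ostep_mono: "is_ord elts b \<Longrightarrow> ole elts a b \<Longrightarrow> ostep N a \<le> ostep N b"
  unfolding ostep_def using ole_subset[of b a] by (intro card_mono) auto

lemma ostep_zero: "ostep N (ozero elts) = 0"
  by (simp add: ostep_def elts_ozero)

lemma ostep_osucc: "ostep N (osucc elts b) = ostep N b \<or> ostep N (osucc elts b) = Suc (ostep N b)"
proof -
  have "elts (osucc elts b) \<inter> ord_of_nat elts ` {..<N} =
      (if b \<in> ord_of_nat elts ` {..<N} then insert b (elts b \<inter> ord_of_nat elts ` {..<N})
       else elts b \<inter> ord_of_nat elts ` {..<N})"
    by (auto simp: elts_osucc)
  then show ?thesis using elts_irrefl[of b] by (simp add: ostep_def)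
qed

lemma ostep_top:
  assumes "is_ord elts b" "ole elts (ord_of_nat elts N) b" shows "ostep N b = N"
proof -
  have "elts b \<inter> ord_of_nat elts ` {..<N} = ord_of_nat elts ` {..<N}"
    using ole_subset[OF assms] by (auto simp: elts_ord_of_nat)
  moreover have "card (ord_of_nat elts ` {..<N}) = N"
    using card_image[OF inj_on_subset[OF ord_of_nat_inj subset_UNIV]] by simp
  ultimately show ?thesis by (simp add: ostep_def)
qed

end

section \<open>Regular decompositions from countable chains\<close>

lemma HomD:
  assumes "f \<in> Hom C a b"
  shows "f \<in> Ar C" "a \<in> Ob C" "b \<in> Ob C" "Dom C f = a" "Cod C f = b"
  using assms by (simp_all add: Hom_def)

lemma
  assumes "is_category C"
  shows cat_Ident: "a \<in> Ob C \<Longrightarrow> Ident C a \<in> Hom C a a"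
    and cat_Comp: "f \<in> Hom C a b \<Longrightarrow> g \<in> Hom C b c \<Longrightarrow> Comp C g f \<in> Hom C a c"
    and cat_Comp_Ident: "f \<in> Hom C a b \<Longrightarrow> Comp C f (Ident C a) = f"
    and cat_Ident_Comp: "f \<in> Hom C a b \<Longrightarrow> Comp C (Ident C b) f = f"
    and cat_assoc: "f \<in> Hom C a b \<Longrightarrow> g \<in> Hom C b c \<Longrightarrow> h \<in> Hom C c d \<Longrightarrow>
        Comp C h (Comp C g f) = Comp C (Comp C h g) f"
    and cat_Ar_Hom: "f \<in> Ar C \<Longrightarrow> f \<in> Hom C (Dom C f) (Cod C f)"
proof -
  note c = assms[unfolded is_category_def]
  note c1 = conjunct1[OF c] and d1 = conjunct2[OF c]
  note c2 = conjunct1[OF d1] and d2 = conjunct2[OF d1]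
  note c3 = conjunct1[OF d2] and d3 = conjunct2[OF d2]
  note c4 = conjunct1[OF d3] and c5 = conjunct2[OF d3]
  show "a \<in> Ob C \<Longrightarrow> Ident C a \<in> Hom C a a" using c2 by blast
  show "f \<in> Hom C a b \<Longrightarrow> g \<in> Hom C b c \<Longrightarrow> Comp C g f \<in> Hom C a c" using c3 by blast
  show "f \<in> Hom C a b \<Longrightarrow> Comp C f (Ident C a) = f" using c4 by blast
  show "f \<in> Hom C a b \<Longrightarrow> Comp C (Ident C b) f = f" using c4 by blast
  show "f \<in> Hom C a b \<Longrightarrow> g \<in> Hom C b c \<Longrightarrow> h \<in> Hom C c d \<Longrightarrow>
        Comp C h (Comp C g f) = Comp C (Comp C h g) f" using c5 by blast
  show "f \<in> Ar C \<Longrightarrow> f \<in> Hom C (Dom C f) (Cod C f)" using c1 by (simp add: Hom_def)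
qed

text \<open>A square from a coequalizer \<open>e\<close> of \<open>s, t\<close> to a monomorphism \<open>m\<close> has a filler because its
  upper side \<open>u\<close> equalizes \<open>s\<close> and \<open>t\<close> after composing with \<open>m\<close>, hence already before.\<close>

lemma mono_orthogonal_regular_epi:
  assumes C: "is_category C" and m: "m \<in> Hom C M X"
    and mono: "\<And>Z s t. s \<in> Hom C Z M \<Longrightarrow> t \<in> Hom C Z M \<Longrightarrow> Comp C m s = Comp C m t \<Longrightarrow> s = t"
    and e: "regular_epi C e"
  shows "orthogonal C e m"
  unfolding orthogonal_def
proof (intro ballI impI)
  obtain s t K B Q where s: "s \<in> Hom C K B" and t: "t \<in> Hom C K B" and eH: "e \<in> Hom C B Q"
    and est: "Comp C e s = Comp C e t"
    and univ: "\<And>Z k. Z \<in> Ob C \<Longrightarrow> k \<in> Hom C B Z \<Longrightarrow> Comp C k s = Comp C k t \<Longrightarrow>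
        \<exists>!h. h \<in> Hom C Q Z \<and> Comp C h e = k"
    using e unfolding regular_epi_def is_coequalizer_def by blast
  fix u v
  assume "u \<in> Hom C (Dom C e) (Dom C m)" "v \<in> Hom C (Cod C e) (Cod C m)"
    and sq: "Comp C m u = Comp C v e"
  then have u: "u \<in> Hom C B M" and v: "v \<in> Hom C Q X" using HomD[OF eH] HomD[OF m] by simp_all
  have "Comp C m (Comp C u s) = Comp C (Comp C v e) s"
    using cat_assoc[OF C s u m] sq by simp
  also have "\<dots> = Comp C v (Comp C e t)" using cat_assoc[OF C s eH v] est by simp
  also have "\<dots> = Comp C m (Comp C u t)"
    using cat_assoc[OF C t u m] cat_assoc[OF C t eH v] sq by simp
  finally have ust: "Comp C u s = Comp C u t"
    by (rule mono[OF cat_Comp[OF C s u] cat_Comp[OF C t u]])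
  obtain h where h: "h \<in> Hom C Q M" "Comp C h e = u"
    and uniq: "\<And>h'. h' \<in> Hom C Q M \<Longrightarrow> Comp C h' e = u \<Longrightarrow> h' = h"
    using univ[OF HomD(2)[OF m] u ust] by blast
  have mu: "Comp C m u \<in> Hom C B X" by (rule cat_Comp[OF C u m])
  have "Comp C (Comp C m u) s = Comp C (Comp C m u) t"
    using ust cat_assoc[OF C s u m] cat_assoc[OF C t u m] by simp
  from univ[OF HomD(3)[OF m] mu this]
  have uniq': "\<And>k k'. k \<in> Hom C Q X \<Longrightarrow> Comp C k e = Comp C m u \<Longrightarrow> k' \<in> Hom C Q X \<Longrightarrow>
      Comp C k' e = Comp C m u \<Longrightarrow> k = k'" by blast
  have "Comp C m h = v"
  proof (rule uniq')
    show "Comp C m h \<in> Hom C Q X" by (rule cat_Comp[OF C h(1) m])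
    show "Comp C (Comp C m h) e = Comp C m u" using cat_assoc[OF C eH h(1) m] h(2) by simp
  qed (use v sq in auto)
  then show "\<exists>!h. h \<in> Hom C (Cod C e) (Dom C m) \<and> Comp C h e = u \<and> Comp C m h = v"
    unfolding HomD(5)[OF eH] HomD(4)[OF m]
    by (intro ex1I[of _ h] conjI h) (auto intro: uniq)
qed

lemma regular_epi_Ident:
  assumes C: "is_category C" and a: "a \<in> Ob C" shows "regular_epi C (Ident C a)"
proof -
  note i = cat_Ident[OF C a]
  have "\<exists>!h. h \<in> Hom C a Z \<and> Comp C h (Ident C a) = k" if "k \<in> Hom C a Z" for Z k
    using that cat_Comp_Ident[OF C] by metis
  then have "is_coequalizer C (Ident C a) (Ident C a) (Ident C a)"
    unfolding is_coequalizer_def using i by blast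
  then show ?thesis unfolding regular_epi_def by blast
qed

primrec chain :: "('o, 'm) category \<Rightarrow> (nat \<Rightarrow> 'o) \<Rightarrow> (nat \<Rightarrow> 'm) \<Rightarrow> nat \<Rightarrow> nat \<Rightarrow> 'm" where
  "chain C A q i 0 = Ident C (A i)"
| "chain C A q i (Suc d) = Comp C (q (i + d)) (chain C A q i d)"

locale countable_chain =
  fixes C :: "('o, 'm) category" and A :: "nat \<Rightarrow> 'o" and q :: "nat \<Rightarrow> 'm"
    and g :: "nat \<Rightarrow> 'm" and X :: 'o
  assumes C: "is_category C"
    and q: "\<And>j. q j \<in> Hom C (A j) (A (Suc j))"
    and g: "\<And>j. g j \<in> Hom C (A j) X"
    and gq: "\<And>j. Comp C (g (Suc j)) (q j) = g j"
begin

lemma A_Ob: "A j \<in> Ob C" and X_Ob: "X \<in> Ob C"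
  using HomD[OF g] by blast+

lemma chain_Hom: "chain C A q i d \<in> Hom C (A i) (A (i + d))"
proof (induction d)
  case 0 show ?case using cat_Ident[OF C A_Ob] by simp
next
  case (Suc d) then show ?case using cat_Comp[OF C Suc q] by simp
qed

lemma chain_add: "Comp C (chain C A q (i + d) e) (chain C A q i d) = chain C A q i (d + e)"
proof (induction e)
  case 0 show ?case using cat_Ident_Comp[OF C chain_Hom] by simp
next
  case (Suc e)
  have "chain C A q (i + d) e \<in> Hom C (A (i + d)) (A (i + (d + e)))"
    using chain_Hom[of "i + d" e] by (simp add: add.assoc)
  from cat_assoc[OF C chain_Hom this q] show ?case using Suc by (simp add: add.assoc)
qed

lemma chain_g: "Comp C (g (i + d)) (chain C A q i d) = g i"
proof (induction d)
  case 0 show ?case using cat_Comp_Ident[OF C g] by simp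
next
  case (Suc d)
  from cat_assoc[OF C chain_Hom q g, of i d] show ?case using Suc gq by simp
qed

definition link :: "nat \<Rightarrow> nat \<Rightarrow> 'm" where
  "link i j = chain C A q i (j - i)"

lemma link_Hom: "i \<le> j \<Longrightarrow> link i j \<in> Hom C (A i) (A j)"
  using chain_Hom[of i "j - i"] by (simp add: link_def)

lemma link_refl: "link i i = Ident C (A i)"
  by (simp add: link_def)

lemma link_Suc: "link i (Suc i) = q i"
  using cat_Comp_Ident[OF C q] by (simp add: link_def)

lemma link_trans: "i \<le> j \<Longrightarrow> j \<le> k \<Longrightarrow> Comp C (link j k) (link i j) = link i k"
  using chain_add[of i "j - i" "k - j"] by (simp add: link_def)

lemma g_link: "i \<le> j \<Longrightarrow> Comp C (g j) (link i j) = g i"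
  using chain_g[of i "j - i"] by (simp add: link_def)

end

lemma Hom_poset_cat:
  "Hom (poset_cat I le) a b = (if a \<in> I \<and> b \<in> I \<and> le a b then {(a, b)} else {})"
  by (auto simp: Hom_def poset_cat_def)

lemma Ob_poset_cat [simp]: "Ob (poset_cat I le) = I"
  by (simp add: poset_cat_def)

lemma Ar_poset_cat: "Ar (poset_cat I le) = {(i, j). i \<in> I \<and> j \<in> I \<and> le i j}"
  by (simp add: poset_cat_def)

text \<open>The chain is stopped at \<open>N\<close> and continued constantly, by composing it with \<open>ostep N\<close>. Below a limit
  ordinal the diagram has then become constant at \<open>A N\<close>, so that its colimit is \<open>A N\<close>.\<close>

lemma (in set_universe) chain_regular_decomposition:
  assumes chain: "countable_chain C A q g X"
    and q_epi: "\<And>j. regular_epi C (q j)"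
    and g0: "f = g 0"
    and orth: "\<And>e. regular_epi C e \<Longrightarrow> orthogonal C e (g N)"
  shows "\<exists>F \<phi>. regular_decomposition elts C f F \<phi> \<and> stable_from elts C \<phi> (ord_of_nat elts N)"
proof -
  interpret countable_chain C A q g X by (rule chain)
  let ?i = "ostep N"
  define F where "F = \<lparr> fob = restrict (\<lambda>a. A (?i a)) {a. is_ord elts a},
    far = restrict (\<lambda>(a, b). link (?i a) (?i b)) (Ar (ord_cat elts)) \<rparr>"
  define \<phi> where "\<phi> = (\<lambda>a. g (?i a))"
  have fob: "fob F a = A (?i a)" if "is_ord elts a" for a using that by (simp add: F_def)
  have far: "far F (a, b) = link (?i a) (?i b)"
    if "is_ord elts a" "is_ord elts b" "ole elts a b" for a b
    using that by (simp add: F_def ord_cat_def Ar_poset_cat)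
  have mono: "?i a \<le> ?i b" if "is_ord elts b" "ole elts a b" for a b
    using ostep_mono that .
  have functorial: "is_functor (ord_cat elts) C F"
    unfolding is_functor_def ord_cat_def
  proof (intro conjI allI ballI)
    show "fob F \<in> Ob (poset_cat {a. is_ord elts a} (ole elts)) \<rightarrow>\<^sub>E Ob C"
      using A_Ob by (auto simp: F_def)
    show "far F \<in> extensional (Ar (poset_cat {a. is_ord elts a} (ole elts)))"
      by (simp add: F_def ord_cat_def)
  next
    fix a b f assume "f \<in> Hom (poset_cat {a. is_ord elts a} (ole elts)) a b"
    then have "is_ord elts a" "is_ord elts b" "ole elts a b" "f = (a, b)"
      by (auto simp: Hom_poset_cat split: if_splits)
    then show "far F f \<in> Hom C (fob F a) (fob F b)"
      using link_Hom[OF mono] by (simp add: fob far)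
  next
    fix a assume "a \<in> Ob (poset_cat {a. is_ord elts a} (ole elts))"
    then show "far F (Ident (poset_cat {a. is_ord elts a} (ole elts)) a) = Ident C (fob F a)"
      using ole_refl[of a] link_refl by (simp add: fob far poset_cat_def)
  next
    fix a b c f g'
    assume "f \<in> Hom (poset_cat {a. is_ord elts a} (ole elts)) a b"
      "g' \<in> Hom (poset_cat {a. is_ord elts a} (ole elts)) b c"
    then have *: "is_ord elts a" "is_ord elts b" "ole elts a b" "f = (a, b)"
      "is_ord elts c" "ole elts b c" "g' = (b, c)"
      by (auto simp: Hom_poset_cat split: if_splits)
    then have "ole elts a c" using ole_trans[of c a b] by simp
    then show "far F (Comp (poset_cat {a. is_ord elts a} (ole elts)) g' f) =
        Comp C (far F g') (far F f)"
      using * mono[of b a] mono[of c b] link_trans by (simp add: far poset_cat_def)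
  qed
  have cocone: "is_cocone (ord_cat elts) C F X \<phi>"
    unfolding is_cocone_def ord_cat_def
    using X_Ob g g_link mono by (auto simp: fob far \<phi>_def Hom_poset_cat split: if_splits)
  have succ: "regular_epi C (far F (b, osucc elts b))" if b: "is_ord elts b" for b
  proof -
    have "far F (b, osucc elts b) = link (?i b) (?i (osucc elts b))"
      using b is_ord_osucc[OF b] by (simp add: far ole_def elts_osucc)
    then show ?thesis
      using ostep_osucc[of N b] q_epi regular_epi_Ident[OF C A_Ob] by (auto simp: link_refl link_Suc)
  qed
  have limit: "is_colimit (poset_cat (elts c) (ole elts)) C F (fob F c) (\<lambda>b. far F (b, c))"
    if c: "olimit elts c" for c
  proof -
    have co: "is_ord elts c" using c by (simp add: olimit_def)
    have bo: "is_ord elts b" "ole elts b c" if "b \<in> elts c" for b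
      using that is_ord_member[OF co] by (simp_all add: ole_def)
    let ?N = "ord_of_nat elts N"
    have N: "?N \<in> elts c" "is_ord elts ?N" using olimit_contains_nat[OF c] is_ord_of_nat by simp_all
    have iN: "?i ?N = N" "?i c = N"
      using ostep_top[OF is_ord_of_nat ole_refl] ostep_top[OF co bo(2)[OF N(1)]] by simp_all
    have "is_cocone (poset_cat (elts c) (ole elts)) C F (fob F c) (\<lambda>b. far F (b, c))"
      unfolding is_cocone_def
    proof (intro conjI ballI allI)
      show "fob F c \<in> Ob C" using A_Ob by (simp add: fob co)
    next
      fix b assume "b \<in> Ob (poset_cat (elts c) (ole elts))"
      then show "far F (b, c) \<in> Hom C (fob F b) (fob F c)"
        using link_Hom[OF mono[OF co]] by (simp add: far fob bo co)
    next
      fix a b j assume "j \<in> Hom (poset_cat (elts c) (ole elts)) a b"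
      then have "a \<in> elts c" "b \<in> elts c" "ole elts a b" "j = (a, b)"
        by (auto simp: Hom_poset_cat split: if_splits)
      then show "Comp C (far F (b, c)) (far F j) = far F (a, c)"
        using link_trans[OF mono[of b a] mono[OF co]] by (simp add: far bo co)
    qed
    moreover have "\<exists>!h. h \<in> Hom C (fob F c) Y \<and>
        (\<forall>i \<in> Ob (poset_cat (elts c) (ole elts)). Comp C h (far F (i, c)) = \<psi> i)"
      if "is_cocone (poset_cat (elts c) (ole elts)) C F Y \<psi>" for Y \<psi>
    proof -
      have \<psi>: "\<psi> b \<in> Hom C (A (?i b)) Y" if "b \<in> elts c" for b
        using \<open>is_cocone _ C F Y \<psi>\<close> that bo(1) by (auto simp: is_cocone_def fob)
      have \<psi>\<psi>: "Comp C (\<psi> b) (link (?i a) (?i b)) = \<psi> a"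
        if "a \<in> elts c" "b \<in> elts c" "ole elts a b" for a b
      proof -
        have "(a, b) \<in> Hom (poset_cat (elts c) (ole elts)) a b"
          using that by (simp add: Hom_poset_cat)
        then have "Comp C (\<psi> b) (far F (a, b)) = \<psi> a"
          using \<open>is_cocone _ C F Y \<psi>\<close> unfolding is_cocone_def by blast
        then show ?thesis using that bo(1) by (simp add: far)
      qed
      have hN: "\<psi> ?N \<in> Hom C (A N) Y" using \<psi>[OF N(1)] iN by simp
      have "Comp C (\<psi> ?N) (far F (b, c)) = \<psi> b" if b: "b \<in> elts c" for b
      proof (cases "ole elts b ?N")
        case True
        then show ?thesis using \<psi>\<psi>[OF b N(1)] by (simp add: far bo b co iN)
      next
        case False
        then have Nb: "ole elts ?N b" using ole_linear[OF bo(1)[OF b] N(2)] by (auto simp: ole_def)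
        then have "?i b = N" by (rule ostep_top[OF bo(1)[OF b]])
        then show ?thesis
          using \<psi>\<psi>[OF N(1) b Nb] \<psi>[OF b] cat_Comp_Ident[OF C]
          by (simp add: far bo b co iN link_refl)
      qed
      moreover have "h = \<psi> ?N" if "h \<in> Hom C (A N) Y" "Comp C h (far F (?N, c)) = \<psi> ?N" for h
        using that cat_Comp_Ident[OF C that(1)] by (simp add: far bo N co iN link_refl)
      ultimately show ?thesis
        unfolding fob[OF co] iN(2) Ob_poset_cat using hN N(1) by (intro ex1I[of _ "\<psi> ?N"]) blast+
    qed
    ultimately show ?thesis unfolding is_colimit_def by blast
  qed
  have stable: "stable_from elts C \<phi> (ord_of_nat elts N)"
    unfolding stable_from_def \<phi>_def using orth ostep_top by simp
  have "regular_decomposition elts C f F \<phi>"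
    unfolding regular_decomposition_def
    using functorial succ limit cocone stable is_ord_of_nat is_ord_ozero HomD[OF g]
    by (auto simp: g0 fob \<phi>_def ostep_zero)
  then show ?thesis using stable by blast
qed

text \<open>The decompositions at hand need not have least length. That \<open>\<delta>\<close> is defined at all, on morphisms and
  then on the category, is the well-ordering of the ordinals.\<close>

lemma (in set_universe) is_delta_bounded:
  assumes dec: "\<And>f. f \<in> Ar C \<Longrightarrow>
      \<exists>F \<phi>. regular_decomposition elts C f F \<phi> \<and> stable_from elts C \<phi> (ord_of_nat elts N)"
  shows "\<exists>d. is_delta elts C d \<and> ole elts d (ord_of_nat elts (Suc N))"
proof -
  have "\<exists>b \<in> elts (ord_of_nat elts (Suc N)). is_delta_mor elts C f b" if f: "f \<in> Ar C" for f
  proof -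
    obtain F \<phi> where F: "regular_decomposition elts C f F \<phi>"
      and st: "stable_from elts C \<phi> (ord_of_nat elts N)" using dec[OF f] by blast
    obtain a where a: "is_least_ord elts (stable_from elts C \<phi>) a" "ole elts a (ord_of_nat elts N)"
      using is_least_ord_exists[of _ "stable_from elts C \<phi>", OF is_ord_of_nat st] by blast
    have "is_decomposition_length elts C f a"
      using F a(1) unfolding is_decomposition_length_def by blast
    moreover have "is_ord elts a" using a(1) by (simp add: is_least_ord_def)
    ultimately obtain b where b: "is_least_ord elts (is_decomposition_length elts C f) b"
      "ole elts b a" using is_least_ord_exists by metis
    have "ole elts b (ord_of_nat elts N)" using ole_trans[OF is_ord_of_nat b(2) a(2)] .
    then have "b \<in> elts (ord_of_nat elts (Suc N))" by (auto simp: ole_def elts_osucc)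
    then show ?thesis using b(1) unfolding is_delta_mor_def by blast
  qed
  then have "\<forall>f \<in> Ar C. \<exists>b \<in> elts (ord_of_nat elts (Suc N)). is_delta_mor elts C f b" by blast
  then show ?thesis
    unfolding is_delta_def by (rule is_least_ord_exists[OF is_ord_of_nat])
qed

section \<open>Set-valued models\<close>

subsection \<open>Functor categories\<close>

lemma is_pullback_iff:
  assumes H: "p \<in> Hom C P A" "q \<in> Hom C P B" "f \<in> Hom C A X" "g \<in> Hom C B X"
  shows "is_pullback C p q f g \<longleftrightarrow> Comp C f p = Comp C g q \<and>
     (\<forall>Q \<in> Ob C. \<forall>u \<in> Hom C Q A. \<forall>v \<in> Hom C Q B. Comp C f u = Comp C g v \<longrightarrow>
        (\<exists>!h. h \<in> Hom C Q P \<and> Comp C p h = u \<and> Comp C q h = v))"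
    (is "_ \<longleftrightarrow> ?R")
proof
  assume "is_pullback C p q f g"
  then obtain P' A' B' X' where
    H': "p \<in> Hom C P' A'" "q \<in> Hom C P' B'" "f \<in> Hom C A' X'" "g \<in> Hom C B' X'"
    and R: "Comp C f p = Comp C g q \<and>
     (\<forall>Q \<in> Ob C. \<forall>u \<in> Hom C Q A'. \<forall>v \<in> Hom C Q B'. Comp C f u = Comp C g v \<longrightarrow>
        (\<exists>!h. h \<in> Hom C Q P' \<and> Comp C p h = u \<and> Comp C q h = v))"
    unfolding is_pullback_def by blast
  have "P' = P" "A' = A" "B' = B" using H H' by (auto simp: Hom_def)
  then show ?R using R by simp
next
  assume ?R
  then show "is_pullback C p q f g" unfolding is_pullback_def using H by blast
qed

lemma Hom_set_cat: "Hom (set_cat elts) A B = {(A, f, B) | f. f \<in> elts A \<rightarrow>\<^sub>E elts B}"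
  by (auto simp: Hom_def set_cat_def)

lemma mem_Hom_set_cat:
  "(A', f, B') \<in> Hom (set_cat elts) A B \<longleftrightarrow> A' = A \<and> B' = B \<and> f \<in> elts A \<rightarrow>\<^sub>E elts B"
  by (auto simp: Hom_set_cat)

lemma Comp_set_cat: "Comp (set_cat elts) (B, g, X) (A, f, B') = (A, \<lambda>x \<in> elts A. g (f x), X)"
  by (simp add: set_cat_def)

lemma Ob_set_cat: "Ob (set_cat elts) = UNIV"
  by (simp add: set_cat_def)

lemma is_category_set_cat: "is_category (set_cat elts)"
  unfolding is_category_def
proof (intro conjI ballI allI)
  fix A show "Ident (set_cat elts) A \<in> Hom (set_cat elts) A A"
    unfolding Hom_set_cat by (auto simp: set_cat_def)
next
  fix A B X f g assume "f \<in> Hom (set_cat elts) A B" "g \<in> Hom (set_cat elts) B X"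
  then show "Comp (set_cat elts) g f \<in> Hom (set_cat elts) A X"
    unfolding Hom_set_cat by (auto simp: Comp_set_cat PiE_iff)
next
  fix A B f assume "f \<in> Hom (set_cat elts) A B"
  then obtain f' where f: "f = (A, f', B)" "f' \<in> elts A \<rightarrow>\<^sub>E elts B" unfolding Hom_set_cat by blast
  have "(\<lambda>x\<in>elts A. f' x) = f'" "(\<lambda>x\<in>elts A. (\<lambda>x\<in>elts B. x) (f' x)) = f'"
    using PiE_mem[OF f(2)] PiE_arb[OF f(2)] by (auto simp: fun_eq_iff restrict_def)
  then show "Comp (set_cat elts) f (Ident (set_cat elts) A) = f"
    "Comp (set_cat elts) (Ident (set_cat elts) B) f = f"
    using PiE_mem[OF f(2)] PiE_arb[OF f(2)]
    unfolding f(1) by (auto simp: set_cat_def fun_eq_iff restrict_def)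
next
  fix A B X Y f g h
  assume "f \<in> Hom (set_cat elts) A B" "g \<in> Hom (set_cat elts) B X" "h \<in> Hom (set_cat elts) X Y"
  then show "Comp (set_cat elts) h (Comp (set_cat elts) g f) =
      Comp (set_cat elts) (Comp (set_cat elts) h g) f"
    unfolding Hom_set_cat by (auto simp: Comp_set_cat fun_eq_iff)
qed (auto simp: set_cat_def)

lemma Hom_functor_cat:
  "Hom (functor_cat C D) F G =
    {(F, \<tau>, G) | \<tau>. is_functor C D F \<and> is_functor C D G \<and> is_nat_trans C D F G \<tau>}"
  by (auto simp: Hom_def functor_cat_def)

lemma Comp_functor_cat:
  "Comp (functor_cat C D) (G, \<sigma>, H) (F, \<tau>, G') = (F, \<lambda>a \<in> Ob C. Comp D (\<sigma> a) (\<tau> a), H)"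
  by (simp add: functor_cat_def)

lemma nat_trans_Hom: "is_nat_trans C D F G \<tau> \<Longrightarrow> a \<in> Ob C \<Longrightarrow> \<tau> a \<in> Hom D (fob F a) (fob G a)"
  by (simp add: is_nat_trans_def)

lemma nat_trans_natural:
  "is_nat_trans C D F G \<tau> \<Longrightarrow> f \<in> Hom C a b \<Longrightarrow> Comp D (\<tau> b) (far F f) = Comp D (far G f) (\<tau> a)"
  unfolding is_nat_trans_def by blast

lemma functor_Hom: "is_functor C D F \<Longrightarrow> f \<in> Hom C a b \<Longrightarrow> far F f \<in> Hom D (fob F a) (fob F b)"
  unfolding is_functor_def by blast

lemma functor_Ob: "is_functor C D F \<Longrightarrow> a \<in> Ob C \<Longrightarrow> fob F a \<in> Ob D"
  unfolding is_functor_def by (auto dest: PiE_mem)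

lemma nat_trans_Comp:
  assumes D: "is_category D"
    and \<tau>: "is_nat_trans C D F G \<tau>" and \<sigma>: "is_nat_trans C D G H \<sigma>"
    and F: "is_functor C D F" "is_functor C D G" "is_functor C D H"
  shows "is_nat_trans C D F H (\<lambda>a \<in> Ob C. Comp D (\<sigma> a) (\<tau> a))"
  unfolding is_nat_trans_def
proof (intro conjI ballI allI)
  show "(\<lambda>a\<in>Ob C. Comp D (\<sigma> a) (\<tau> a)) \<in> extensional (Ob C)" by simp
next
  fix a assume "a \<in> Ob C"
  then show "(\<lambda>a\<in>Ob C. Comp D (\<sigma> a) (\<tau> a)) a \<in> Hom D (fob F a) (fob H a)"
    using cat_Comp[OF D nat_trans_Hom[OF \<tau>] nat_trans_Hom[OF \<sigma>]] by simp
next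
  fix a b f assume f: "f \<in> Hom C a b"
  note ab = HomD(2,3)[OF f]
  note \<tau>a = nat_trans_Hom[OF \<tau> ab(1)] and \<tau>b = nat_trans_Hom[OF \<tau> ab(2)]
    and \<sigma>a = nat_trans_Hom[OF \<sigma> ab(1)] and \<sigma>b = nat_trans_Hom[OF \<sigma> ab(2)]
    and Ff = functor_Hom[OF F(1) f] and Gf = functor_Hom[OF F(2) f] and Hf = functor_Hom[OF F(3) f]
  have "Comp D (Comp D (\<sigma> b) (\<tau> b)) (far F f) = Comp D (\<sigma> b) (Comp D (far G f) (\<tau> a))"
    using cat_assoc[OF D Ff \<tau>b \<sigma>b] nat_trans_natural[OF \<tau> f] by simp
  also have "\<dots> = Comp D (far H f) (Comp D (\<sigma> a) (\<tau> a))"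
    using cat_assoc[OF D \<tau>a Gf \<sigma>b] cat_assoc[OF D \<tau>a \<sigma>a Hf] nat_trans_natural[OF \<sigma> f] by simp
  finally show "Comp D ((\<lambda>a\<in>Ob C. Comp D (\<sigma> a) (\<tau> a)) b) (far F f) =
      Comp D (far H f) ((\<lambda>a\<in>Ob C. Comp D (\<sigma> a) (\<tau> a)) a)"
    using ab by simp
qed

lemma nat_trans_Ident:
  assumes D: "is_category D" and F: "is_functor C D F"
  shows "is_nat_trans C D F F (\<lambda>a \<in> Ob C. Ident D (fob F a))"
  unfolding is_nat_trans_def
proof (intro conjI ballI allI)
  fix a b f assume f: "f \<in> Hom C a b"
  show "Comp D ((\<lambda>a\<in>Ob C. Ident D (fob F a)) b) (far F f) =
      Comp D (far F f) ((\<lambda>a\<in>Ob C. Ident D (fob F a)) a)"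
    using HomD(2,3)[OF f] cat_Comp_Ident[OF D functor_Hom[OF F f]]
      cat_Ident_Comp[OF D functor_Hom[OF F f]] by simp
qed (use cat_Ident[OF D functor_Ob[OF F]] in auto)

lemma is_category_functor_cat:
  assumes D: "is_category D"
  shows "is_category (functor_cat C D)"
  unfolding is_category_def
proof (intro conjI ballI allI)
  fix F assume "F \<in> Ob (functor_cat C D)"
  then show "Ident (functor_cat C D) F \<in> Hom (functor_cat C D) F F"
    unfolding Hom_functor_cat using nat_trans_Ident[OF D] by (simp add: functor_cat_def)
next
  fix F G H f g assume "f \<in> Hom (functor_cat C D) F G" "g \<in> Hom (functor_cat C D) G H"
  then show "Comp (functor_cat C D) g f \<in> Hom (functor_cat C D) F H"
    unfolding Hom_functor_cat using nat_trans_Comp[OF D] by (auto simp: Comp_functor_cat)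
next
  fix F G f assume "f \<in> Hom (functor_cat C D) F G"
  then obtain \<tau> where f: "f = (F, \<tau>, G)" and \<tau>: "is_nat_trans C D F G \<tau>"
    unfolding Hom_functor_cat by blast
  have "\<tau> \<in> extensional (Ob C)" using \<tau> by (simp add: is_nat_trans_def)
  then have "(\<lambda>a\<in>Ob C. Comp D (\<tau> a) ((\<lambda>a\<in>Ob C. Ident D (fob F a)) a)) = \<tau>"
    "(\<lambda>a\<in>Ob C. Comp D ((\<lambda>a\<in>Ob C. Ident D (fob G a)) a) (\<tau> a)) = \<tau>"
    using cat_Comp_Ident[OF D nat_trans_Hom[OF \<tau>]] cat_Ident_Comp[OF D nat_trans_Hom[OF \<tau>]]
    by (auto simp: fun_eq_iff extensional_def)
  then show "Comp (functor_cat C D) f (Ident (functor_cat C D) F) = f"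
    "Comp (functor_cat C D) (Ident (functor_cat C D) G) f = f"
    unfolding f by (simp_all add: functor_cat_def)
next
  fix F G H K f g h
  assume "f \<in> Hom (functor_cat C D) F G" "g \<in> Hom (functor_cat C D) G H"
    "h \<in> Hom (functor_cat C D) H K"
  then obtain \<tau> \<sigma> \<rho> where *: "f = (F, \<tau>, G)" "g = (G, \<sigma>, H)" "h = (H, \<rho>, K)"
    and nt: "is_nat_trans C D F G \<tau>" "is_nat_trans C D G H \<sigma>" "is_nat_trans C D H K \<rho>"
    unfolding Hom_functor_cat by blast
  have "Comp D (\<rho> a) (Comp D (\<sigma> a) (\<tau> a)) = Comp D (Comp D (\<rho> a) (\<sigma> a)) (\<tau> a)" if "a \<in> Ob C" for a
    using cat_assoc[OF D] nat_trans_Hom[OF nt(1) that] nat_trans_Hom[OF nt(2) that]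
      nat_trans_Hom[OF nt(3) that] by blast
  then show "Comp (functor_cat C D) h (Comp (functor_cat C D) g f) =
      Comp (functor_cat C D) (Comp (functor_cat C D) h g) f"
    unfolding * by (auto simp: Comp_functor_cat fun_eq_iff)
qed (auto simp: functor_cat_def)

lemma Hom_full_subcat:
  "Hom (full_subcat C P) a b = (if P a \<and> P b then Hom C a b else {})"
  by (auto simp: Hom_def full_subcat_def)

lemma full_subcat_simps:
  "Comp (full_subcat C P) = Comp C" "Ident (full_subcat C P) = Ident C"
  "Dom (full_subcat C P) = Dom C" "Cod (full_subcat C P) = Cod C"
  "Ob (full_subcat C P) = {a \<in> Ob C. P a}"
  "Ar (full_subcat C P) = {f \<in> Ar C. P (Dom C f) \<and> P (Cod C f)}"
  by (simp_all add: full_subcat_def)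

lemma is_category_full_subcat:
  assumes "is_category C" shows "is_category (full_subcat C P)"
proof -
  have "Dom C f \<in> Ob C \<and> Cod C f \<in> Ob C" if "f \<in> Ar C" for f
    using HomD(2,3)[OF cat_Ar_Hom[OF assms that]] by simp
  then show ?thesis
    unfolding is_category_def
    using cat_Ident[OF assms] cat_Comp[OF assms] cat_Comp_Ident[OF assms] cat_Ident_Comp[OF assms]
      cat_assoc[OF assms]
    by (auto simp: Hom_full_subcat full_subcat_simps split: if_splits)
qed

subsection \<open>Elements\<close>

text \<open>Everything below is computed on elements: \<open>act F m\<close> is the function underlying \<open>far F m\<close>, and
  \<open>cmp h a\<close> the function underlying the component of the transformation \<open>h\<close> at \<open>a\<close>.\<close>

definition act :: "('o, 'm, 'u, 'u \<times> ('u \<Rightarrow> 'u) \<times> 'u) ftor \<Rightarrow> 'm \<Rightarrow> 'u \<Rightarrow> 'u" where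
  "act F m = fst (snd (far F m))"

definition cmp :: "'a \<times> ('o \<Rightarrow> 'u \<times> ('u \<Rightarrow> 'u) \<times> 'u) \<times> 'b \<Rightarrow> 'o \<Rightarrow> 'u \<Rightarrow> 'u" where
  "cmp h a = fst (snd (fst (snd h) a))"

lemma far_eq:
  assumes "is_functor C (set_cat elts) F" "m \<in> Hom C a b"
  shows "far F m = (fob F a, act F m, fob F b)" "act F m \<in> elts (fob F a) \<rightarrow>\<^sub>E elts (fob F b)"
  using functor_Hom[OF assms] by (auto simp: Hom_set_cat act_def)

lemma act_in:
  assumes "is_functor C (set_cat elts) F" "m \<in> Hom C a b" "x \<in> elts (fob F a)"
  shows "act F m x \<in> elts (fob F b)"
  using far_eq(2)[OF assms(1,2)] assms(3) by (rule PiE_mem)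

lemma act_Comp:
  assumes F: "is_functor C (set_cat elts) F" and C: "is_category C"
    and m: "m \<in> Hom C a b" and n: "n \<in> Hom C b c" and x: "x \<in> elts (fob F a)"
  shows "act F (Comp C n m) x = act F n (act F m x)"
proof -
  have "far F (Comp C n m) = Comp (set_cat elts) (far F n) (far F m)"
    using F m n unfolding is_functor_def by blast
  then show ?thesis
    using x by (simp add: far_eq(1)[OF F m] far_eq(1)[OF F n] Comp_set_cat
        far_eq(1)[OF F cat_Comp[OF C m n]])
qed

lemma act_Ident:
  assumes F: "is_functor C (set_cat elts) F" and "a \<in> Ob C" and x: "x \<in> elts (fob F a)"
  shows "act F (Ident C a) x = x"
proof -
  have "far F (Ident C a) = Ident (set_cat elts) (fob F a)"
    using assms unfolding is_functor_def by blast
  then show ?thesis using x by (simp add: act_def set_cat_def)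
qed

context set_universe
begin

lemma set_terminal_iff: "is_terminal (set_cat elts) t \<longleftrightarrow> (\<exists>!x. x \<in> elts t)"
proof
  assume "\<exists>!x. x \<in> elts t"
  then obtain x where x: "elts t = {x}" by auto
  have "\<exists>!f. f \<in> Hom (set_cat elts) A t" for A
  proof (rule ex1I[of _ "(A, \<lambda>_ \<in> elts A. x, t)"])
    fix f assume "f \<in> Hom (set_cat elts) A t"
    then obtain h where h: "f = (A, h, t)" "h \<in> elts A \<rightarrow>\<^sub>E {x}"
      unfolding Hom_set_cat x[symmetric] by blast
    then have "h = (\<lambda>_ \<in> elts A. x)" using PiE_mem[OF h(2)] PiE_arb[OF h(2)] by (auto simp: fun_eq_iff)
    then show "f = (A, \<lambda>_ \<in> elts A. x, t)" using h by simp
  qed (simp add: Hom_set_cat x)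
  then show "is_terminal (set_cat elts) t" unfolding is_terminal_def by (simp add: Ob_set_cat)
next
  assume t: "is_terminal (set_cat elts) t"
  obtain s y where s: "elts s = {y}" using coded_pair[of t t] by (metis insert_absorb2 rangeE)
  obtain f where f: "f \<in> Hom (set_cat elts) s t"
    and uniq: "\<And>f'. f' \<in> Hom (set_cat elts) s t \<Longrightarrow> f' = f"
    using t unfolding is_terminal_def Ob_set_cat by blast
  obtain h where h: "f = (s, h, t)" "h \<in> {y} \<rightarrow>\<^sub>E elts t" using f unfolding Hom_set_cat s by blast
  have hy: "h y \<in> elts t" using h(2) by auto
  have "x = h y" if "x \<in> elts t" for x
  proof -
    have "(s, \<lambda>_ \<in> {y}. x, t) \<in> Hom (set_cat elts) s t" using that by (simp add: Hom_set_cat s)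
    from uniq[OF this] have "(\<lambda>_ \<in> {y}. x) = h" using h(1) by simp
    then show ?thesis by (metis restrict_apply singletonI)
  qed
  then show "\<exists>!x. x \<in> elts t" using hy by blast
qed

text \<open>An element of a set is a map from a singleton; testing the universal property on singletons gives the
  condition on elements, which in turn gives the universal property pointwise.\<close>

lemma set_pullback_iff:
  assumes p: "p \<in> elts P \<rightarrow>\<^sub>E elts A" and q: "q \<in> elts P \<rightarrow>\<^sub>E elts B"
    and f: "f \<in> elts A \<rightarrow>\<^sub>E elts X" and g: "g \<in> elts B \<rightarrow>\<^sub>E elts X"
    and sq: "\<And>z. z \<in> elts P \<Longrightarrow> f (p z) = g (q z)"
  shows "is_pullback (set_cat elts) (P, p, A) (P, q, B) (A, f, X) (B, g, X) \<longleftrightarrow>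
    (\<forall>x \<in> elts A. \<forall>y \<in> elts B. f x = g y \<longrightarrow> (\<exists>!z. z \<in> elts P \<and> p z = x \<and> q z = y))"
    (is "?L \<longleftrightarrow> ?R")
proof -
  have H: "(P, p, A) \<in> Hom (set_cat elts) P A" "(P, q, B) \<in> Hom (set_cat elts) P B"
    "(A, f, X) \<in> Hom (set_cat elts) A X" "(B, g, X) \<in> Hom (set_cat elts) B X"
    using p q f g by (simp_all add: Hom_set_cat)
  show ?thesis
  proof
    assume ?L
    then have univ: "\<And>Q u v. u \<in> Hom (set_cat elts) Q A \<Longrightarrow> v \<in> Hom (set_cat elts) Q B \<Longrightarrow>
        Comp (set_cat elts) (A, f, X) u = Comp (set_cat elts) (B, g, X) v \<Longrightarrow>
        \<exists>!h. h \<in> Hom (set_cat elts) Q P \<and> Comp (set_cat elts) (P, p, A) h = u \<and>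
          Comp (set_cat elts) (P, q, B) h = v"
      unfolding is_pullback_iff[OF H] Ob_set_cat by blast
    show ?R
    proof (intro ballI impI)
      fix x y assume x: "x \<in> elts A" and y: "y \<in> elts B" and xy: "f x = g y"
      obtain s where s: "elts s = {x}" using coded_pair[of x x] by (metis insert_absorb2 rangeE)
      have u: "(s, \<lambda>_ \<in> {x}. x, A) \<in> Hom (set_cat elts) s A" using x by (simp add: Hom_set_cat s)
      have v: "(s, \<lambda>_ \<in> {x}. y, B) \<in> Hom (set_cat elts) s B" using y by (simp add: Hom_set_cat s)
      have eq: "Comp (set_cat elts) (A, f, X) (s, \<lambda>_ \<in> {x}. x, A) =
          Comp (set_cat elts) (B, g, X) (s, \<lambda>_ \<in> {x}. y, B)"
        using xy by (auto simp: Comp_set_cat s)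
      obtain k where k: "k \<in> Hom (set_cat elts) s P"
        "Comp (set_cat elts) (P, p, A) k = (s, \<lambda>_ \<in> {x}. x, A)"
        "Comp (set_cat elts) (P, q, B) k = (s, \<lambda>_ \<in> {x}. y, B)"
        and kuniq: "\<And>k'. k' \<in> Hom (set_cat elts) s P \<Longrightarrow>
          Comp (set_cat elts) (P, p, A) k' = (s, \<lambda>_ \<in> {x}. x, A) \<Longrightarrow>
          Comp (set_cat elts) (P, q, B) k' = (s, \<lambda>_ \<in> {x}. y, B) \<Longrightarrow> k' = k"
        using univ[OF u v eq] by (elim ex1E) blast
      obtain h where h: "k = (s, h, P)" "h \<in> {x} \<rightarrow>\<^sub>E elts P" using k(1) unfolding Hom_set_cat s by blast
      have hx: "h x \<in> elts P" using h(2) by auto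
      have pq: "p (h x) = x" "q (h x) = y"
      proof -
        have *: "(\<lambda>w \<in> {x}. p (h w)) = (\<lambda>_ \<in> {x}. x)" "(\<lambda>w \<in> {x}. q (h w)) = (\<lambda>_ \<in> {x}. y)"
          using k(2,3) unfolding h(1) Comp_set_cat s by simp_all
        from fun_cong[OF *(1), of x] show "p (h x) = x" by simp
        from fun_cong[OF *(2), of x] show "q (h x) = y" by simp
      qed
      show "\<exists>!z. z \<in> elts P \<and> p z = x \<and> q z = y"
      proof (rule ex1I[of _ "h x"])
        fix z assume z: "z \<in> elts P \<and> p z = x \<and> q z = y"
        have "(s, \<lambda>_ \<in> {x}. z, P) = k"
        proof (rule kuniq)
          show "(s, \<lambda>_ \<in> {x}. z, P) \<in> Hom (set_cat elts) s P"
            unfolding mem_Hom_set_cat s using z by simp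
        next
          have "(\<lambda>w \<in> {x}. p ((\<lambda>_ \<in> {x}. z) w)) = (\<lambda>_ \<in> {x}. x)"
            "(\<lambda>w \<in> {x}. q ((\<lambda>_ \<in> {x}. z) w)) = (\<lambda>_ \<in> {x}. y)"
            using z by (auto simp: restrict_def)
          then show "Comp (set_cat elts) (P, p, A) (s, \<lambda>_ \<in> {x}. z, P) = (s, \<lambda>_ \<in> {x}. x, A)"
            "Comp (set_cat elts) (P, q, B) (s, \<lambda>_ \<in> {x}. z, P) = (s, \<lambda>_ \<in> {x}. y, B)"
            unfolding Comp_set_cat s by simp_all
        qed
        then have "(\<lambda>_ \<in> {x}. z) = h" unfolding h(1) by simp
        from fun_cong[OF this, of x] show "z = h x" by simp
      qed (use hx pq in simp)
    qed
  next
    assume R: ?R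
    show ?L
      unfolding is_pullback_iff[OF H]
    proof (intro conjI ballI impI)
      show "Comp (set_cat elts) (A, f, X) (P, p, A) = Comp (set_cat elts) (B, g, X) (P, q, B)"
        using sq by (auto simp: Comp_set_cat fun_eq_iff)
      fix Q u v assume "u \<in> Hom (set_cat elts) Q A" "v \<in> Hom (set_cat elts) Q B"
        and eq: "Comp (set_cat elts) (A, f, X) u = Comp (set_cat elts) (B, g, X) v"
      then obtain u' v' where u: "u = (Q, u', A)" "u' \<in> elts Q \<rightarrow>\<^sub>E elts A"
        and v: "v = (Q, v', B)" "v' \<in> elts Q \<rightarrow>\<^sub>E elts B" unfolding Hom_set_cat by blast
      have fg: "f (u' w) = g (v' w)" if "w \<in> elts Q" for w
      proof -
        have "(\<lambda>w \<in> elts Q. f (u' w)) = (\<lambda>w \<in> elts Q. g (v' w))"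
          using eq unfolding u v Comp_set_cat by simp
        from fun_cong[OF this, of w] that show ?thesis by simp
      qed
      have ex1: "\<exists>!z. z \<in> elts P \<and> p z = u' w \<and> q z = v' w" if "w \<in> elts Q" for w
        using R fg[OF that] PiE_mem[OF u(2) that] PiE_mem[OF v(2) that] by blast
      then obtain k where k: "\<And>w. w \<in> elts Q \<Longrightarrow> k w \<in> elts P \<and> p (k w) = u' w \<and> q (k w) = v' w"
        by metis
      show "\<exists>!h. h \<in> Hom (set_cat elts) Q P \<and> Comp (set_cat elts) (P, p, A) h = u \<and>
          Comp (set_cat elts) (P, q, B) h = v"
      proof (rule ex1I[of _ "(Q, \<lambda>w \<in> elts Q. k w, P)"])
        show "(Q, \<lambda>w \<in> elts Q. k w, P) \<in> Hom (set_cat elts) Q P \<and>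
            Comp (set_cat elts) (P, p, A) (Q, \<lambda>w \<in> elts Q. k w, P) = u \<and>
            Comp (set_cat elts) (P, q, B) (Q, \<lambda>w \<in> elts Q. k w, P) = v"
          using k PiE_arb[OF u(2)] PiE_arb[OF v(2)]
          by (auto simp: mem_Hom_set_cat Comp_set_cat u(1) v(1) fun_eq_iff)
      next
        fix h assume h: "h \<in> Hom (set_cat elts) Q P \<and> Comp (set_cat elts) (P, p, A) h = u \<and>
            Comp (set_cat elts) (P, q, B) h = v"
        then obtain h' where h': "h = (Q, h', P)" "h' \<in> elts Q \<rightarrow>\<^sub>E elts P" unfolding Hom_set_cat by blast
        have "h' w = k w" if w: "w \<in> elts Q" for w
        proof -
          have "h' w \<in> elts P \<and> p (h' w) = u' w \<and> q (h' w) = v' w"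
          proof -
            have "(\<lambda>w \<in> elts Q. p (h' w)) = u'" "(\<lambda>w \<in> elts Q. q (h' w)) = v'"
              using h unfolding h'(1) u v Comp_set_cat by simp_all
            from fun_cong[OF this(1), of w] fun_cong[OF this(2), of w]
            show ?thesis using w PiE_mem[OF h'(2) w] by simp
          qed
          then show ?thesis using ex1[OF w] k[OF w] by blast
        qed
        then show "h = (Q, \<lambda>w \<in> elts Q. k w, P)"
          using PiE_arb[OF h'(2)] unfolding h'(1) by (auto simp: fun_eq_iff)
      qed
    qed
  qed
qed

end

section \<open>Coequalizers of kernel pairs of models\<close>

text \<open>Models can be formed for every small category with a class of display maps in it. The coequalizers
  constructed here exist in this generality.\<close>

locale small_clan = set_universe elts for elts :: "'u \<Rightarrow> 'u set" +
  fixes C :: "('o, 'm) category" and disp :: "'m \<Rightarrow> bool"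
  assumes C: "is_category C"
    and small_Ob: "small elts (Ob C)" and small_Ar: "small elts (Ar C)"
begin

definition model :: "('o, 'm, 'u, 'u \<times> ('u \<Rightarrow> 'u) \<times> 'u) ftor \<Rightarrow> bool" where
  "model F \<longleftrightarrow>
     is_functor C (set_cat elts) F \<and>
     (\<forall>a. is_terminal C a \<longrightarrow> is_terminal (set_cat elts) (fob F a)) \<and>
     (\<forall>p q f d. disp d \<longrightarrow> is_pullback C p q f d \<longrightarrow>
        is_pullback (set_cat elts) (far F p) (far F q) (far F f) (far F d))"

definition MOD where
  "MOD = full_subcat (functor_cat C (set_cat elts)) model"

definition disp_square :: "'o \<Rightarrow> 'o \<Rightarrow> 'o \<Rightarrow> 'o \<Rightarrow> 'm \<Rightarrow> 'm \<Rightarrow> 'm \<Rightarrow> 'm \<Rightarrow> bool" where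
  "disp_square P A B X p q f d \<longleftrightarrow> disp d \<and> is_pullback C p q f d \<and>
     p \<in> Hom C P A \<and> q \<in> Hom C P B \<and> f \<in> Hom C A X \<and> d \<in> Hom C B X"

lemma disp_squareI:
  assumes "disp d" "is_pullback C p q f d"
  obtains P A B X where "disp_square P A B X p q f d"
  using assms unfolding disp_square_def is_pullback_def by blast

lemma disp_square_comm: "disp_square P A B X p q f d \<Longrightarrow> Comp C f p = Comp C d q"
  unfolding disp_square_def by (auto simp: is_pullback_iff)

lemma model_functor: "model F \<Longrightarrow> is_functor C (set_cat elts) F"
  by (simp add: model_def)

lemma m_act_in: "model F \<Longrightarrow> m \<in> Hom C a b \<Longrightarrow> x \<in> elts (fob F a) \<Longrightarrow> act F m x \<in> elts (fob F b)"
  by (rule act_in[OF model_functor])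

lemma m_act_Comp: "model F \<Longrightarrow> m \<in> Hom C a b \<Longrightarrow> n \<in> Hom C b c \<Longrightarrow> x \<in> elts (fob F a) \<Longrightarrow>
    act F (Comp C n m) x = act F n (act F m x)"
  by (rule act_Comp[OF model_functor C])

lemma m_act_Ident: "model F \<Longrightarrow> a \<in> Ob C \<Longrightarrow> x \<in> elts (fob F a) \<Longrightarrow> act F (Ident C a) x = x"
  by (rule act_Ident[OF model_functor])

lemma functor_pullback_iff:
  assumes F: "is_functor C (set_cat elts) F" and sq: "disp_square P A B X p q f d"
  shows "is_pullback (set_cat elts) (far F p) (far F q) (far F f) (far F d) \<longleftrightarrow>
    (\<forall>x \<in> elts (fob F A). \<forall>y \<in> elts (fob F B). act F f x = act F d y \<longrightarrow>
       (\<exists>!z. z \<in> elts (fob F P) \<and> act F p z = x \<and> act F q z = y))"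
proof -
  have H: "p \<in> Hom C P A" "q \<in> Hom C P B" "f \<in> Hom C A X" "d \<in> Hom C B X"
    using sq by (simp_all add: disp_square_def)
  have "act F f (act F p z) = act F d (act F q z)" if "z \<in> elts (fob F P)" for z
    using act_Comp[OF F C H(1,3) that] act_Comp[OF F C H(2,4) that] disp_square_comm[OF sq] by simp
  then show ?thesis
    unfolding far_eq(1)[OF F H(1)] far_eq(1)[OF F H(2)] far_eq(1)[OF F H(3)] far_eq(1)[OF F H(4)]
    by (rule set_pullback_iff[OF far_eq(2)[OF F H(1)] far_eq(2)[OF F H(2)] far_eq(2)[OF F H(3)]
          far_eq(2)[OF F H(4)]])
qed

lemma model_iff:
  "model F \<longleftrightarrow> is_functor C (set_cat elts) F \<and>
     (\<forall>a. is_terminal C a \<longrightarrow> (\<exists>!x. x \<in> elts (fob F a))) \<and>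
     (\<forall>P A B X p q f d. disp_square P A B X p q f d \<longrightarrow>
       (\<forall>x \<in> elts (fob F A). \<forall>y \<in> elts (fob F B). act F f x = act F d y \<longrightarrow>
         (\<exists>!z. z \<in> elts (fob F P) \<and> act F p z = x \<and> act F q z = y)))"
    (is "_ \<longleftrightarrow> ?F \<and> ?T \<and> ?P")
proof (cases ?F)
  case True
  have "(\<forall>p q f d. disp d \<longrightarrow> is_pullback C p q f d \<longrightarrow>
        is_pullback (set_cat elts) (far F p) (far F q) (far F f) (far F d)) \<longleftrightarrow>
      (\<forall>P A B X p q f d. disp_square P A B X p q f d \<longrightarrow>
        is_pullback (set_cat elts) (far F p) (far F q) (far F f) (far F d))"
    (is "?P1 \<longleftrightarrow> ?P2")
  proof
    assume ?P1 then show ?P2 unfolding disp_square_def by blast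
  next
    assume P2: ?P2
    show ?P1
    proof (intro allI impI)
      fix p q f d assume "disp d" "is_pullback C p q f d"
      then obtain P A B X where "disp_square P A B X p q f d" by (rule disp_squareI)
      then show "is_pullback (set_cat elts) (far F p) (far F q) (far F f) (far F d)"
        using P2 by blast
    qed
  qed
  also have "\<dots> \<longleftrightarrow> ?P"
    by (intro iff_allI imp_cong[OF refl] functor_pullback_iff[OF True])
  finally show ?thesis using True unfolding model_def set_terminal_iff by (simp only: simp_thms)
qed (simp add: model_def)

lemma model_terminal: "model F \<Longrightarrow> is_terminal C a \<Longrightarrow> \<exists>!x. x \<in> elts (fob F a)"
  by (simp add: model_iff)

lemma model_pair:
  assumes "model F" "disp_square P A B X p q f d" "x \<in> elts (fob F A)" "y \<in> elts (fob F B)"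
    "act F f x = act F d y"
  shows "\<exists>!z. z \<in> elts (fob F P) \<and> act F p z = x \<and> act F q z = y"
  using assms unfolding model_iff by blast

lemma model_pair_unique:
  assumes F: "model F" and sq: "disp_square P A B X p q f d"
    and z: "z \<in> elts (fob F P)" "z' \<in> elts (fob F P)"
    and eq: "act F p z = act F p z'" "act F q z = act F q z'"
  shows "z = z'"
proof -
  have H: "p \<in> Hom C P A" "q \<in> Hom C P B" "f \<in> Hom C A X" "d \<in> Hom C B X"
    using sq by (simp_all add: disp_square_def)
  have "act F f (act F p z) = act F d (act F q z)"
    using m_act_Comp[OF F H(1,3) z(1)] m_act_Comp[OF F H(2,4) z(1)] disp_square_comm[OF sq] by simp
  from model_pair[OF F sq m_act_in[OF F H(1) z(1)] m_act_in[OF F H(2) z(1)] this]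
  show ?thesis using z eq by metis
qed

subsection \<open>Morphisms of models\<close>

lemma is_category_MOD: "is_category MOD"
  unfolding MOD_def
  by (intro is_category_full_subcat is_category_functor_cat is_category_set_cat)

lemma Hom_MOD_iff:
  "h \<in> Hom MOD F G \<longleftrightarrow> model F \<and> model G \<and>
     (\<exists>\<tau>. h = (F, \<tau>, G) \<and> is_nat_trans C (set_cat elts) F G \<tau>)"
  unfolding MOD_def Hom_full_subcat Hom_functor_cat
  using model_functor by auto

lemma Cod_MOD: "h \<in> Hom MOD F G \<Longrightarrow> Cod MOD h = G" and Dom_MOD: "h \<in> Hom MOD F G \<Longrightarrow> Dom MOD h = F"
  by (simp_all add: HomD)

lemma component_eq:
  assumes h: "(F, \<tau>, G) \<in> Hom MOD F G" and a: "a \<in> Ob C"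
  shows "\<tau> a = (fob F a, cmp (F, \<tau>, G) a, fob G a)"
    "cmp (F, \<tau>, G) a \<in> elts (fob F a) \<rightarrow>\<^sub>E elts (fob G a)"
proof -
  have "\<tau> a \<in> Hom (set_cat elts) (fob F a) (fob G a)"
    using h nat_trans_Hom[of C "set_cat elts" F G \<tau> a] a by (simp add: Hom_MOD_iff)
  then show "\<tau> a = (fob F a, cmp (F, \<tau>, G) a, fob G a)"
    "cmp (F, \<tau>, G) a \<in> elts (fob F a) \<rightarrow>\<^sub>E elts (fob G a)"
    by (auto simp: Hom_set_cat cmp_def)
qed

lemma Hom_MOD_cases:
  assumes "h \<in> Hom MOD F G"
  obtains \<tau> where "h = (F, \<tau>, G)" "(F, \<tau>, G) \<in> Hom MOD F G" "model F" "model G"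
    "is_nat_trans C (set_cat elts) F G \<tau>"
  using assms that unfolding Hom_MOD_iff by blast

lemma cmp_in:
  assumes "h \<in> Hom MOD F G" "a \<in> Ob C" "x \<in> elts (fob F a)"
  shows "cmp h a x \<in> elts (fob G a)"
  using assms(1)
proof (rule Hom_MOD_cases)
  fix \<tau> assume "h = (F, \<tau>, G)" "(F, \<tau>, G) \<in> Hom MOD F G"
  then show ?thesis using PiE_mem[OF component_eq(2) assms(3)] assms(2) by simp
qed

lemma cmp_natural:
  assumes h: "h \<in> Hom MOD F G" and m: "m \<in> Hom C a b" and x: "x \<in> elts (fob F a)"
  shows "cmp h b (act F m x) = act G m (cmp h a x)"
  using h
proof (rule Hom_MOD_cases)
  fix \<tau> assume h: "h = (F, \<tau>, G)" "(F, \<tau>, G) \<in> Hom MOD F G" "model F" "model G"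
    and \<tau>: "is_nat_trans C (set_cat elts) F G \<tau>"
  have "Comp (set_cat elts) (\<tau> b) (far F m) = Comp (set_cat elts) (far G m) (\<tau> a)"
    by (rule nat_trans_natural[OF \<tau> m])
  then have "(\<lambda>x \<in> elts (fob F a). cmp h b (act F m x)) = (\<lambda>x \<in> elts (fob F a). act G m (cmp h a x))"
    unfolding far_eq(1)[OF model_functor[OF h(3)] m] far_eq(1)[OF model_functor[OF h(4)] m]
      component_eq(1)[OF h(2) HomD(2)[OF m]] component_eq(1)[OF h(2) HomD(3)[OF m]] Comp_set_cat h(1)
    by simp
  from fun_cong[OF this, of x] show ?thesis using x by simp
qed

lemma cmp_Comp:
  assumes h: "h \<in> Hom MOD F G" and k: "k \<in> Hom MOD G H" and a: "a \<in> Ob C"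
    and x: "x \<in> elts (fob F a)"
  shows "cmp (Comp MOD k h) a x = cmp k a (cmp h a x)"
proof -
  obtain \<tau> where h': "h = (F, \<tau>, G)" "(F, \<tau>, G) \<in> Hom MOD F G" using h by (rule Hom_MOD_cases)
  obtain \<sigma> where k': "k = (G, \<sigma>, H)" "(G, \<sigma>, H) \<in> Hom MOD G H" using k by (rule Hom_MOD_cases)
  have "cmp (Comp MOD k h) a x = fst (snd (Comp (set_cat elts) (\<sigma> a) (\<tau> a))) x"
    using a unfolding h'(1) k'(1) MOD_def full_subcat_simps Comp_functor_cat by (simp add: cmp_def)
  then show ?thesis
    unfolding component_eq(1)[OF h'(2) a] component_eq(1)[OF k'(2) a] Comp_set_cat h'(1) k'(1)
    using x by simp
qed

lemma MOD_ext:
  assumes h: "h \<in> Hom MOD F G" and k: "k \<in> Hom MOD F G"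
    and eq: "\<And>a x. a \<in> Ob C \<Longrightarrow> x \<in> elts (fob F a) \<Longrightarrow> cmp h a x = cmp k a x"
  shows "h = k"
proof -
  obtain \<tau> where h': "h = (F, \<tau>, G)" "(F, \<tau>, G) \<in> Hom MOD F G"
    "is_nat_trans C (set_cat elts) F G \<tau>" using h by (rule Hom_MOD_cases)
  obtain \<sigma> where k': "k = (F, \<sigma>, G)" "(F, \<sigma>, G) \<in> Hom MOD F G"
    "is_nat_trans C (set_cat elts) F G \<sigma>" using k by (rule Hom_MOD_cases)
  have "\<tau> a = \<sigma> a" if a: "a \<in> Ob C" for a
  proof -
    have "cmp h a = cmp k a"
      using component_eq(2)[OF h'(2) a] component_eq(2)[OF k'(2) a] eq[OF a]
      unfolding h'(1) k'(1) by (rule PiE_ext)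
    then show ?thesis
      using component_eq(1)[OF h'(2) a] component_eq(1)[OF k'(2) a] h'(1) k'(1) by simp
  qed
  then have "\<tau> = \<sigma>"
    using h'(3) k'(3) unfolding is_nat_trans_def by (auto intro: extensionalityI)
  then show ?thesis using h'(1) k'(1) by simp
qed

definition mk_mor where
  "mk_mor F G t = (F, \<lambda>a \<in> Ob C. (fob F a, restrict (t a) (elts (fob F a)), fob G a), G)"

lemma mk_mor:
  assumes F: "model F" and G: "model G"
    and t: "\<And>a x. a \<in> Ob C \<Longrightarrow> x \<in> elts (fob F a) \<Longrightarrow> t a x \<in> elts (fob G a)"
    and nat: "\<And>a b m x. m \<in> Hom C a b \<Longrightarrow> x \<in> elts (fob F a) \<Longrightarrow>
      t b (act F m x) = act G m (t a x)"
  shows "mk_mor F G t \<in> Hom MOD F G"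
    and "a \<in> Ob C \<Longrightarrow> x \<in> elts (fob F a) \<Longrightarrow> cmp (mk_mor F G t) a x = t a x"
proof -
  let ?\<tau> = "\<lambda>a \<in> Ob C. (fob F a, restrict (t a) (elts (fob F a)), fob G a)"
  have "is_nat_trans C (set_cat elts) F G ?\<tau>"
    unfolding is_nat_trans_def
  proof (intro conjI allI ballI)
    fix a assume "a \<in> Ob C"
    then show "?\<tau> a \<in> Hom (set_cat elts) (fob F a) (fob G a)"
      using t by (simp add: mem_Hom_set_cat)
  next
    fix a b m assume m: "m \<in> Hom C a b"
    note ab = HomD(2,3)[OF m]
    show "Comp (set_cat elts) (?\<tau> b) (far F m) = Comp (set_cat elts) (far G m) (?\<tau> a)"
      unfolding far_eq(1)[OF model_functor[OF F] m] far_eq(1)[OF model_functor[OF G] m]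
      using ab nat[OF m] m_act_in[OF F m] by (auto simp: Comp_set_cat fun_eq_iff)
  qed simp
  then show "mk_mor F G t \<in> Hom MOD F G"
    unfolding Hom_MOD_iff mk_mor_def using F G by blast
  show "a \<in> Ob C \<Longrightarrow> x \<in> elts (fob F a) \<Longrightarrow> cmp (mk_mor F G t) a x = t a x"
    by (simp add: mk_mor_def cmp_def)
qed

subsection \<open>Submodels of products\<close>

text \<open>Limits of models are computed pointwise, so the operations of a product of models restrict to \<open>S\<close>;
  \<open>\<beta>\<close> identifies the small sets \<open>S a\<close> with coded ones. Only the sets \<open>S a\<close> have to be small. The index
  set \<open>I\<close>, and with it the product, may be as large as the class of all models; the coequalizer below is a
  subfamily of such a product.\<close>

lemma subproduct_model:
  fixes Z :: "'i \<Rightarrow> ('o, 'm, 'u, 'u \<times> ('u \<Rightarrow> 'u) \<times> 'u) ftor"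
  assumes Z: "\<And>i. i \<in> I \<Longrightarrow> model (Z i)"
    and S: "\<And>a. a \<in> Ob C \<Longrightarrow> S a \<subseteq> (\<Pi>\<^sub>E i \<in> I. elts (fob (Z i) a))"
    and small: "\<And>a. a \<in> Ob C \<Longrightarrow> small elts (S a)"
    and S_act: "\<And>a b m z. m \<in> Hom C a b \<Longrightarrow> z \<in> S a \<Longrightarrow> (\<lambda>i \<in> I. act (Z i) m (z i)) \<in> S b"
    and S_terminal: "\<And>a. is_terminal C a \<Longrightarrow> S a \<noteq> {}"
    and S_pair: "\<And>P A B X p q f d z. disp_square P A B X p q f d \<Longrightarrow>
      z \<in> (\<Pi>\<^sub>E i \<in> I. elts (fob (Z i) P)) \<Longrightarrow> (\<lambda>i \<in> I. act (Z i) p (z i)) \<in> S A \<Longrightarrow>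
      (\<lambda>i \<in> I. act (Z i) q (z i)) \<in> S B \<Longrightarrow> z \<in> S P"
  obtains F \<beta> where "model F" "\<And>a. a \<in> Ob C \<Longrightarrow> bij_betw (\<beta> a) (elts (fob F a)) (S a)"
    "\<And>a b m x. m \<in> Hom C a b \<Longrightarrow> x \<in> elts (fob F a) \<Longrightarrow>
      \<beta> b (act F m x) = (\<lambda>i \<in> I. act (Z i) m (\<beta> a x i))"
proof -
  have "\<forall>a. \<exists>u g. a \<in> Ob C \<longrightarrow> bij_betw g (S a) (elts u)"
    using small unfolding small_def by blast
  then obtain u g where g: "\<And>a. a \<in> Ob C \<Longrightarrow> bij_betw (g a) (S a) (elts (u a))" by metis
  define \<beta> where "\<beta> a = inv_into (S a) (g a)" for a
  have \<beta>: "bij_betw (\<beta> a) (elts (u a)) (S a)" if "a \<in> Ob C" for a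
    unfolding \<beta>_def using bij_betw_inv_into[OF g[OF that]] .
  have g\<beta>: "g a (\<beta> a x) = x" if "a \<in> Ob C" "x \<in> elts (u a)" for a x
    unfolding \<beta>_def using bij_betw_inv_into_right[OF g[OF that(1)] that(2)] .
  have \<beta>g: "\<beta> a (g a z) = z" if "a \<in> Ob C" "z \<in> S a" for a z
    unfolding \<beta>_def using bij_betw_inv_into_left[OF g[OF that(1)] that(2)] .
  have \<beta>S: "\<beta> a x \<in> S a" if "a \<in> Ob C" "x \<in> elts (u a)" for a x
    using bij_betw_apply[OF \<beta>[OF that(1)] that(2)] .
  have gS: "g a z \<in> elts (u a)" if "a \<in> Ob C" "z \<in> S a" for a z
    using bij_betw_apply[OF g[OF that(1)] that(2)] .
  have SI: "z i \<in> elts (fob (Z i) a)" if "a \<in> Ob C" "z \<in> S a" "i \<in> I" for a z i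
    using PiE_mem[OF subsetD[OF S[OF that(1)] that(2)] that(3)] .
  have S_ext: "(\<lambda>i \<in> I. z i) = z" if "a \<in> Ob C" "z \<in> S a" for a z
    using subsetD[OF S[OF that(1)] that(2)] by (rule PiE_restrict)
  define t where "t m z = (\<lambda>i \<in> I. act (Z i) m (z i))" for m z
  have t: "t m z \<in> S b" if "m \<in> Hom C a b" "z \<in> S a" for m z a b
    unfolding t_def using S_act[OF that] .
  have t_Ident: "t (Ident C a) z = z" if "a \<in> Ob C" "z \<in> S a" for a z
  proof -
    have "t (Ident C a) z = (\<lambda>i \<in> I. z i)"
      unfolding t_def by (intro restrict_ext m_act_Ident Z that SI)
    then show ?thesis using S_ext that by simp
  qed
  have t_Comp: "t (Comp C n m) z = t n (t m z)"
    if "m \<in> Hom C a b" "n \<in> Hom C b c" "z \<in> S a" for a b c m n z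
    unfolding t_def using m_act_Comp[OF Z that(1,2) SI[OF HomD(2)[OF that(1)] that(3)]]
    by (auto simp: fun_eq_iff)
  define F where "F = \<lparr> fob = restrict u (Ob C),
    far = (\<lambda>m \<in> Ar C. (u (Dom C m), \<lambda>x \<in> elts (u (Dom C m)). g (Cod C m) (t m (\<beta> (Dom C m) x)),
        u (Cod C m))) \<rparr>"
  have fob: "fob F a = u a" if "a \<in> Ob C" for a using that by (simp add: F_def)
  have far: "far F m = (u a, \<lambda>x \<in> elts (u a). g b (t m (\<beta> a x)), u b)" if "m \<in> Hom C a b" for m a b
    using HomD[OF that] by (simp add: F_def)
  have F: "is_functor C (set_cat elts) F"
    unfolding is_functor_def
  proof (intro conjI allI ballI)
    show "fob F \<in> Ob C \<rightarrow>\<^sub>E Ob (set_cat elts)" by (simp add: F_def Ob_set_cat)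
    show "far F \<in> extensional (Ar C)" by (simp add: F_def)
  next
    fix a b m assume m: "m \<in> Hom C a b"
    note ab = HomD(2,3)[OF m]
    show "far F m \<in> Hom (set_cat elts) (fob F a) (fob F b)"
      unfolding far[OF m] fob[OF ab(1)] fob[OF ab(2)] mem_Hom_set_cat
      using gS[OF ab(2) t[OF m \<beta>S[OF ab(1)]]] by simp
  next
    fix a assume a: "a \<in> Ob C"
    have "(\<lambda>x \<in> elts (u a). g a (t (Ident C a) (\<beta> a x))) = (\<lambda>x \<in> elts (u a). x)"
      by (intro restrict_ext) (simp only: t_Ident[OF a \<beta>S[OF a]] g\<beta>[OF a])
    then show "far F (Ident C a) = Ident (set_cat elts) (fob F a)"
      unfolding far[OF cat_Ident[OF C a]] fob[OF a] by (simp add: set_cat_def)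
  next
    fix a b c m n assume m: "m \<in> Hom C a b" and n: "n \<in> Hom C b c"
    note ab = HomD(2,3)[OF m]
    have "g c (t (Comp C n m) (\<beta> a x)) = g c (t n (\<beta> b (g b (t m (\<beta> a x)))))"
      if "x \<in> elts (u a)" for x
      using t_Comp[OF m n \<beta>S[OF ab(1) that]] \<beta>g[OF ab(2) t[OF m \<beta>S[OF ab(1) that]]] by simp
    then show "far F (Comp C n m) = Comp (set_cat elts) (far F n) (far F m)"
      unfolding far[OF m] far[OF n] far[OF cat_Comp[OF C m n]] Comp_set_cat
      using gS[OF ab(2) t[OF m \<beta>S[OF ab(1)]]] by (auto simp: fun_eq_iff)
  qed
  have actF: "\<beta> b (act F m x) = t m (\<beta> a x)" if m: "m \<in> Hom C a b" and x: "x \<in> elts (u a)" for a b m x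
    unfolding act_def far[OF m] using x \<beta>g[OF HomD(3)[OF m] t[OF m \<beta>S[OF HomD(2)[OF m] x]]] by simp
  have inj: "x = y" if "a \<in> Ob C" "x \<in> elts (u a)" "y \<in> elts (u a)" "\<beta> a x = \<beta> a y" for a x y
    using that g\<beta> by metis
  have "model F"
    unfolding model_iff
  proof (intro conjI allI impI ballI)
    fix a assume a: "is_terminal C a"
    then have ao: "a \<in> Ob C" by (simp add: is_terminal_def)
    obtain z where z: "z \<in> S a" using S_terminal[OF a] by blast
    have "x = y" if "x \<in> elts (u a)" "y \<in> elts (u a)" for x y
    proof (rule inj[OF ao that])
      show "\<beta> a x = \<beta> a y"
      proof (rule PiE_ext[OF subsetD[OF S[OF ao] \<beta>S[OF ao that(1)]]
            subsetD[OF S[OF ao] \<beta>S[OF ao that(2)]]])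
        fix i assume i: "i \<in> I"
        show "\<beta> a x i = \<beta> a y i"
          using model_terminal[OF Z[OF i] a] SI[OF ao \<beta>S[OF ao that(1)] i]
            SI[OF ao \<beta>S[OF ao that(2)] i] by blast
      qed
    qed
    then show "\<exists>!x. x \<in> elts (fob F a)" unfolding fob[OF ao] using gS[OF ao z] by blast
  next
    fix P A B X p q f d x y
    assume sq: "disp_square P A B X p q f d"
      and x: "x \<in> elts (fob F A)" and y: "y \<in> elts (fob F B)" and xy: "act F f x = act F d y"
    have H: "p \<in> Hom C P A" "q \<in> Hom C P B" "f \<in> Hom C A X" "d \<in> Hom C B X"
      using sq by (simp_all add: disp_square_def)
    note o = HomD(2)[OF H(1)] HomD(3)[OF H(1)] HomD(3)[OF H(2)] HomD(3)[OF H(3)]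
    note x' = x[unfolded fob[OF o(2)]] and y' = y[unfolded fob[OF o(3)]]
    note x'' = \<beta>S[OF o(2) x'] and y'' = \<beta>S[OF o(3) y']
    have fd: "t f (\<beta> A x) = t d (\<beta> B y)" using actF[OF H(3) x'] actF[OF H(4) y'] xy by simp
    have ex1: "\<exists>!w. w \<in> elts (fob (Z i) P) \<and> act (Z i) p w = \<beta> A x i \<and> act (Z i) q w = \<beta> B y i"
      if i: "i \<in> I" for i
    proof (rule model_pair[OF Z[OF i] sq SI[OF o(2) x'' i] SI[OF o(3) y'' i]])
      show "act (Z i) f (\<beta> A x i) = act (Z i) d (\<beta> B y i)"
        using fun_cong[OF fd, of i] i by (simp add: t_def)
    qed
    then obtain w where w: "\<And>i. i \<in> I \<Longrightarrow>
        w i \<in> elts (fob (Z i) P) \<and> act (Z i) p (w i) = \<beta> A x i \<and> act (Z i) q (w i) = \<beta> B y i"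
      by metis
    define z where "z = (\<lambda>i \<in> I. w i)"
    have zP: "z \<in> (\<Pi>\<^sub>E i \<in> I. elts (fob (Z i) P))" using w by (simp add: z_def)
    have zA: "t p z = \<beta> A x"
    proof -
      have "t p z = (\<lambda>i \<in> I. \<beta> A x i)" using w by (auto simp: t_def z_def fun_eq_iff)
      then show ?thesis using S_ext[OF o(2) x''] by simp
    qed
    have zB: "t q z = \<beta> B y"
    proof -
      have "t q z = (\<lambda>i \<in> I. \<beta> B y i)" using w by (auto simp: t_def z_def fun_eq_iff)
      then show ?thesis using S_ext[OF o(3) y''] by simp
    qed
    have zS: "z \<in> S P"
      by (rule S_pair[OF sq zP]) (use zA zB x'' y'' in \<open>simp_all add: t_def\<close>)
    have gz: "g P z \<in> elts (u P)" "\<beta> P (g P z) = z" using gS[OF o(1) zS] \<beta>g[OF o(1) zS] by simp_all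
    have gzA: "act F p (g P z) = x"
    proof (rule inj[OF o(2) _ x'])
      show "act F p (g P z) \<in> elts (u A)"
        using act_in[OF F H(1)] gz(1) fob[OF o(1)] fob[OF o(2)] by simp
      show "\<beta> A (act F p (g P z)) = \<beta> A x" using actF[OF H(1) gz(1)] gz(2) zA by simp
    qed
    have gzB: "act F q (g P z) = y"
    proof (rule inj[OF o(3) _ y'])
      show "act F q (g P z) \<in> elts (u B)"
        using act_in[OF F H(2)] gz(1) fob[OF o(1)] fob[OF o(3)] by simp
      show "\<beta> B (act F q (g P z)) = \<beta> B y" using actF[OF H(2) gz(1)] gz(2) zB by simp
    qed
    have uniq: "v = g P z" if v: "v \<in> elts (u P)" and vA: "act F p v = x" and vB: "act F q v = y" for v
    proof (rule inj[OF o(1) v gz(1)])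
      have "\<beta> P v = z"
      proof (rule PiE_ext[OF subsetD[OF S[OF o(1)] \<beta>S[OF o(1) v]] zP])
        fix i assume i: "i \<in> I"
        have "act (Z i) p (\<beta> P v i) = \<beta> A x i" "act (Z i) q (\<beta> P v i) = \<beta> B y i"
          using fun_cong[OF actF[OF H(1) v], of i] fun_cong[OF actF[OF H(2) v], of i] vA vB i
          by (simp_all add: t_def)
        then show "\<beta> P v i = z i"
          using ex1[OF i] w[OF i] SI[OF o(1) \<beta>S[OF o(1) v] i] i unfolding z_def
          by (metis restrict_apply')
      qed
      then show "\<beta> P v = \<beta> P (g P z)" using gz(2) by simp
    qed
    show "\<exists>!z. z \<in> elts (fob F P) \<and> act F p z = x \<and> act F q z = y"
      unfolding fob[OF o(1)] using gz(1) gzA gzB uniq by (intro ex1I[of _ "g P z"]) blast+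
  qed (rule F)
  then show ?thesis
  proof (rule that)
    show "bij_betw (\<beta> a) (elts (fob F a)) (S a)" if "a \<in> Ob C" for a
      using \<beta>[OF that] fob[OF that] by simp
    show "\<beta> b (act F m x) = (\<lambda>i \<in> I. act (Z i) m (\<beta> a x i))"
      if "m \<in> Hom C a b" "x \<in> elts (fob F a)" for a b m x
      using actF[OF that(1), of x] that(2) fob[OF HomD(2)[OF that(1)]] by (simp add: t_def)
  qed
qed

end

context small_clan
begin

subsection \<open>The coequalizer\<close>

text \<open>The test maps are the morphisms that have to factor through the coequalizer of the kernel pair of
  \<open>\<phi>\<close>. The coequalizer is found as the submodel generated by \<open>A\<close> in the product of all their codomains.\<close>

definition test_maps where
  "test_maps A \<phi> = {h \<in> Ar MOD. Dom MOD h = A \<and> (\<forall>a \<in> Ob C. \<forall>x \<in> elts (fob A a). \<forall>y \<in> elts (fob A a).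
     cmp \<phi> a x = cmp \<phi> a y \<longrightarrow> cmp h a x = cmp h a y)}"

inductive generated for A \<phi> where
  base: "a \<in> Ob C \<Longrightarrow> x \<in> elts (fob A a) \<Longrightarrow> generated A \<phi> a (\<lambda>h \<in> test_maps A \<phi>. cmp h a x)"
| act: "generated A \<phi> a z \<Longrightarrow> m \<in> Hom C a b \<Longrightarrow>
    generated A \<phi> b (\<lambda>h \<in> test_maps A \<phi>. act (Cod MOD h) m (z h))"
| pair: "disp_square P K L X p q f d \<Longrightarrow> z \<in> (\<Pi>\<^sub>E h \<in> test_maps A \<phi>. elts (fob (Cod MOD h) P)) \<Longrightarrow>
    generated A \<phi> K (\<lambda>h \<in> test_maps A \<phi>. act (Cod MOD h) p (z h)) \<Longrightarrow>
    generated A \<phi> L (\<lambda>h \<in> test_maps A \<phi>. act (Cod MOD h) q (z h)) \<Longrightarrow>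
    generated A \<phi> P z"

lemma test_maps_Hom: "h \<in> test_maps A \<phi> \<Longrightarrow> h \<in> Hom MOD A (Cod MOD h)"
  using cat_Ar_Hom[OF is_category_MOD, of h] by (auto simp: test_maps_def)

lemma test_maps_model: "h \<in> test_maps A \<phi> \<Longrightarrow> model (Cod MOD h)"
  using test_maps_Hom[of h A \<phi>] by (simp add: Hom_MOD_iff)

lemma generated_in:
  "generated A \<phi> a z \<Longrightarrow> a \<in> Ob C \<and> z \<in> (\<Pi>\<^sub>E h \<in> test_maps A \<phi>. elts (fob (Cod MOD h) a))"
proof (induction rule: generated.induct)
  case (base a x)
  then show ?case
    by (intro conjI restrict_PiE_iff[THEN iffD2] ballI cmp_in[OF test_maps_Hom])
next
  case (act a z m b)
  have "z h \<in> elts (fob (Cod MOD h) a)" if "h \<in> test_maps A \<phi>" for h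
    using PiE_mem[OF conjunct2[OF act(3)] that] .
  then show ?case
    by (intro conjI restrict_PiE_iff[THEN iffD2] ballI m_act_in[OF test_maps_model act(2)]
        HomD(3)[OF act(2)])
next
  case (pair P K L X p q f d z)
  then show ?case using HomD(2)[of p C P K] by (simp add: disp_square_def)
qed

text \<open>The generated submodel is the union of countably many stages, each the image of a small set.
  In the pairing step the new element is determined by its two projections, because the members of
  the product are models.\<close>

primrec stage where
  "stage A \<phi> 0 = (\<Union>a \<in> Ob C. (\<lambda>x. (a, \<lambda>h \<in> test_maps A \<phi>. cmp h a x)) ` elts (fob A a))"
| "stage A \<phi> (Suc n) = stage A \<phi> n \<union>
    (\<lambda>(m, _, z). (Cod C m, \<lambda>h \<in> test_maps A \<phi>. act (Cod MOD h) m (z h))) ` (Ar C \<times> stage A \<phi> n) \<union>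
    (\<lambda>((p, q), (_, v), (_, w)). (Dom C p,
       SOME z. z \<in> (\<Pi>\<^sub>E h \<in> test_maps A \<phi>. elts (fob (Cod MOD h) (Dom C p))) \<and>
         (\<lambda>h \<in> test_maps A \<phi>. act (Cod MOD h) p (z h)) = v \<and>
         (\<lambda>h \<in> test_maps A \<phi>. act (Cod MOD h) q (z h)) = w)) `
      ((Ar C \<times> Ar C) \<times> stage A \<phi> n \<times> stage A \<phi> n)"

lemma small_stage: "small elts (stage A \<phi> n)"
proof (induction n)
  case 0
  show ?case unfolding stage.simps by (intro small_UN small_Ob small_image small_elts)
next
  case (Suc n)
  then show ?case unfolding stage.simps by (intro small_Un small_image small_Times small_Ar)
qed

lemma stage_mono: "k \<le> n \<Longrightarrow> stage A \<phi> k \<subseteq> stage A \<phi> n"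
  by (rule lift_Suc_mono_le[of "stage A \<phi>"]) auto

lemma generated_stage: "generated A \<phi> a z \<Longrightarrow> \<exists>n. (a, z) \<in> stage A \<phi> n"
proof (induction rule: generated.induct)
  case (base a x)
  then have "(a, \<lambda>h \<in> test_maps A \<phi>. cmp h a x) \<in> stage A \<phi> 0" by auto
  then show ?case by blast
next
  case (act a z m b)
  then obtain n where n: "(a, z) \<in> stage A \<phi> n" by blast
  have m: "m \<in> Ar C" "Cod C m = b" using HomD[OF act(2)] by simp_all
  let ?f = "\<lambda>(m, _ :: 'o, z). (Cod C m, \<lambda>h \<in> test_maps A \<phi>. act (Cod MOD h) m (z h))"
  have "?f (m, a, z) \<in> ?f ` (Ar C \<times> stage A \<phi> n)" using n m by (intro imageI) simp
  then have "(b, \<lambda>h \<in> test_maps A \<phi>. act (Cod MOD h) m (z h)) \<in> stage A \<phi> (Suc n)"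
    unfolding stage.simps prod.case m(2) by blast
  then show ?case by blast
next
  case (pair P K L X p q f d z)
  let ?I = "test_maps A \<phi>"
  let ?v = "\<lambda>h \<in> ?I. act (Cod MOD h) p (z h)" and ?w = "\<lambda>h \<in> ?I. act (Cod MOD h) q (z h)"
  obtain n1 n2 where "(K, ?v) \<in> stage A \<phi> n1" "(L, ?w) \<in> stage A \<phi> n2" using pair.IH by blast
  then have n: "(K, ?v) \<in> stage A \<phi> (max n1 n2)" "(L, ?w) \<in> stage A \<phi> (max n1 n2)"
    using stage_mono[of n1 "max n1 n2" A \<phi>] stage_mono[of n2 "max n1 n2" A \<phi>] by auto
  have H: "p \<in> Ar C" "q \<in> Ar C" "Dom C p = P" using pair(1) by (auto simp: disp_square_def Hom_def)
  have some: "(SOME z'. z' \<in> (\<Pi>\<^sub>E h \<in> ?I. elts (fob (Cod MOD h) P)) \<and>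
       (\<lambda>h \<in> ?I. act (Cod MOD h) p (z' h)) = ?v \<and> (\<lambda>h \<in> ?I. act (Cod MOD h) q (z' h)) = ?w) = z"
  proof (rule some_equality)
    fix z' assume z': "z' \<in> (\<Pi>\<^sub>E h \<in> ?I. elts (fob (Cod MOD h) P)) \<and>
       (\<lambda>h \<in> ?I. act (Cod MOD h) p (z' h)) = ?v \<and> (\<lambda>h \<in> ?I. act (Cod MOD h) q (z' h)) = ?w"
    show "z' = z"
    proof (rule PiE_ext[OF conjunct1[OF z'] pair(2)])
      fix h assume h: "h \<in> ?I"
      have e: "(\<lambda>h \<in> ?I. act (Cod MOD h) p (z' h)) = ?v" "(\<lambda>h \<in> ?I. act (Cod MOD h) q (z' h)) = ?w"
        using z' by blast+
      show "z' h = z h"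
      proof (rule model_pair_unique[OF test_maps_model[OF h] pair(1)
            PiE_mem[OF conjunct1[OF z'] h] PiE_mem[OF pair(2) h]])
        show "act (Cod MOD h) p (z' h) = act (Cod MOD h) p (z h)"
          using fun_cong[OF e(1), of h] unfolding restrict_apply'[OF h] .
        show "act (Cod MOD h) q (z' h) = act (Cod MOD h) q (z h)"
          using fun_cong[OF e(2), of h] unfolding restrict_apply'[OF h] .
      qed
    qed
  qed (use pair(2) in blast)
  let ?g = "\<lambda>((p, q), (_ :: 'o, v), (_ :: 'o, w)). (Dom C p,
       SOME z. z \<in> (\<Pi>\<^sub>E h \<in> ?I. elts (fob (Cod MOD h) (Dom C p))) \<and>
         (\<lambda>h \<in> ?I. act (Cod MOD h) p (z h)) = v \<and> (\<lambda>h \<in> ?I. act (Cod MOD h) q (z h)) = w)"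
  have "?g ((p, q), (K, ?v), (L, ?w)) \<in>
      ?g ` ((Ar C \<times> Ar C) \<times> stage A \<phi> (max n1 n2) \<times> stage A \<phi> (max n1 n2))"
    using n H by (intro imageI) simp
  then have "(P, z) \<in> stage A \<phi> (Suc (max n1 n2))"
    unfolding stage.simps prod.case H(3) some by blast
  then show ?case by blast
qed

lemma small_generated: "small elts {z. generated A \<phi> a z}"
proof (rule small_subset)
  show "small elts (snd ` (\<Union>n. stage A \<phi> n))" by (intro small_image small_UN small_nat small_stage)
  show "{z. generated A \<phi> a z} \<subseteq> snd ` (\<Union>n. stage A \<phi> n)"
  proof
    fix z assume "z \<in> {z. generated A \<phi> a z}"
    then obtain n where "(a, z) \<in> stage A \<phi> n" using generated_stage by blast
    then show "z \<in> snd ` (\<Union>n. stage A \<phi> n)" by (intro image_eqI[of _ _ "(a, z)"]) auto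
  qed
qed

definition closed_family where
  "closed_family F S \<longleftrightarrow>
     (\<forall>a b m x. m \<in> Hom C a b \<longrightarrow> x \<in> elts (fob F a) \<longrightarrow> x \<in> S a \<longrightarrow> act F m x \<in> S b) \<and>
     (\<forall>P A B X p q f d x. disp_square P A B X p q f d \<longrightarrow> x \<in> elts (fob F P) \<longrightarrow> act F p x \<in> S A \<longrightarrow>
        act F q x \<in> S B \<longrightarrow> x \<in> S P)"

text \<open>Built as the submodel of \<open>A \<times> A\<close>, a product indexed by the two truth values, of the pairs identified
  by \<open>\<phi>\<close>. It is closed under pairing because pairs in \<open>X\<close> are unique.\<close>

lemma kernel_pair:
  assumes \<phi>: "\<phi> \<in> Hom MOD A X"
  obtains K s t where "s \<in> Hom MOD K A" "t \<in> Hom MOD K A"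
    "\<forall>a \<in> Ob C. \<forall>w \<in> elts (fob K a). cmp \<phi> a (cmp s a w) = cmp \<phi> a (cmp t a w)"
    "\<forall>a \<in> Ob C. \<forall>x \<in> elts (fob A a). \<forall>y \<in> elts (fob A a). cmp \<phi> a x = cmp \<phi> a y \<longrightarrow>
      (\<exists>w \<in> elts (fob K a). cmp s a w = x \<and> cmp t a w = y)"
proof -
  have A: "model A" and X: "model X" using \<phi> by (simp_all add: Hom_MOD_iff)
  define S where "S a = {z \<in> (\<Pi>\<^sub>E (i::bool) \<in> UNIV. elts (fob A a)).
    cmp \<phi> a (z True) = cmp \<phi> a (z False)}" for a
  have S_iff: "z \<in> S a \<longleftrightarrow> z True \<in> elts (fob A a) \<and> z False \<in> elts (fob A a) \<and>
      cmp \<phi> a (z True) = cmp \<phi> a (z False)" for z a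
  proof -
    have "z \<in> (\<Pi>\<^sub>E (i::bool) \<in> UNIV. elts (fob A a)) \<longleftrightarrow> z True \<in> elts (fob A a) \<and> z False \<in> elts (fob A a)"
      unfolding PiE_iff by (metis (full_types) UNIV_I extensional_UNIV)
    then show ?thesis unfolding S_def by simp
  qed
  have sm: "small elts (S a)" for a
  proof (rule small_subset)
    show "small elts ((\<lambda>(x, y) i. if i then x else y) ` (elts (fob A a) \<times> elts (fob A a)))"
      by (intro small_image small_Times small_elts)
    show "S a \<subseteq> (\<lambda>(x, y) i. if i then x else y) ` (elts (fob A a) \<times> elts (fob A a))"
    proof
      fix z assume z: "z \<in> S a"
      have "z = (\<lambda>(x, y) i. if i then x else y) (z True, z False)"
        by (auto simp: fun_eq_iff)
      then show "z \<in> (\<lambda>(x, y) i. if i then x else y) ` (elts (fob A a) \<times> elts (fob A a))"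
        using z unfolding S_iff by (intro image_eqI[of _ _ "(z True, z False)"]) auto
    qed
  qed
  obtain K \<beta> where K: "model K" and \<beta>: "\<And>a. a \<in> Ob C \<Longrightarrow> bij_betw (\<beta> a) (elts (fob K a)) (S a)"
    and \<beta>act: "\<And>a b m x. m \<in> Hom C a b \<Longrightarrow> x \<in> elts (fob K a) \<Longrightarrow>
      \<beta> b (act K m x) = (\<lambda>i \<in> UNIV. act A m (\<beta> a x i))"
  proof (rule subproduct_model[of UNIV "\<lambda>_. A" S])
    show "S a \<subseteq> (\<Pi>\<^sub>E i \<in> UNIV. elts (fob A a))" for a by (auto simp: S_def)
    show "(\<lambda>i \<in> UNIV. act A m (z i)) \<in> S b" if m: "m \<in> Hom C a b" and z: "z \<in> S a" for a b m z
      using z cmp_natural[OF \<phi> m] m_act_in[OF A m] unfolding S_iff by simp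
    show "S a \<noteq> {}" if "is_terminal C a" for a
    proof -
      obtain x where "x \<in> elts (fob A a)" using model_terminal[OF A \<open>is_terminal C a\<close>] by blast
      then have "(\<lambda>_. x) \<in> S a" unfolding S_iff by simp
      then show ?thesis by blast
    qed
    show "z \<in> S P" if sq: "disp_square P A' B X' p q f d"
      and z: "z \<in> (\<Pi>\<^sub>E (i::bool) \<in> UNIV. elts (fob A P))"
      and zA: "(\<lambda>i \<in> UNIV. act A p (z i)) \<in> S A'" and zB: "(\<lambda>i \<in> UNIV. act A q (z i)) \<in> S B"
      for P A' B X' p q f d z
    proof -
      have zi: "z i \<in> elts (fob A P)" for i using PiE_mem[OF z] by simp
      have H: "p \<in> Hom C P A'" "q \<in> Hom C P B" using sq by (simp_all add: disp_square_def)
      have "cmp \<phi> P (z True) = cmp \<phi> P (z False)"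
      proof (rule model_pair_unique[OF X sq])
        show "act X p (cmp \<phi> P (z True)) = act X p (cmp \<phi> P (z False))"
          using zA unfolding cmp_natural[OF \<phi> H(1) zi, symmetric] S_iff by simp
        show "act X q (cmp \<phi> P (z True)) = act X q (cmp \<phi> P (z False))"
          using zB unfolding cmp_natural[OF \<phi> H(2) zi, symmetric] S_iff by simp
      qed (use cmp_in[OF \<phi> HomD(2)[OF H(1)] zi] in auto)
      then show ?thesis using zi unfolding S_iff by simp
    qed
  qed (use A sm in auto)
  have \<beta>in: "\<beta> a w \<in> S a" if "a \<in> Ob C" "w \<in> elts (fob K a)" for a w
    using bij_betw_apply[OF \<beta>[OF that(1)] that(2)] .
  define s where "s = mk_mor K A (\<lambda>a w. \<beta> a w True)"
  define t where "t = mk_mor K A (\<lambda>a w. \<beta> a w False)"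
  have s: "s \<in> Hom MOD K A" "\<And>a w. a \<in> Ob C \<Longrightarrow> w \<in> elts (fob K a) \<Longrightarrow> cmp s a w = \<beta> a w True"
    unfolding s_def using \<beta>in \<beta>act HomD(2) by (auto simp: S_iff intro!: mk_mor[OF K A])
  have t: "t \<in> Hom MOD K A" "\<And>a w. a \<in> Ob C \<Longrightarrow> w \<in> elts (fob K a) \<Longrightarrow> cmp t a w = \<beta> a w False"
    unfolding t_def using \<beta>in \<beta>act HomD(2) by (auto simp: S_iff intro!: mk_mor[OF K A])
  show ?thesis
  proof (rule that[OF s(1) t(1)])
    show "\<forall>a \<in> Ob C. \<forall>w \<in> elts (fob K a). cmp \<phi> a (cmp s a w) = cmp \<phi> a (cmp t a w)"
      using \<beta>in by (simp add: s(2) t(2) S_iff)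
  next
    show "\<forall>a \<in> Ob C. \<forall>x \<in> elts (fob A a). \<forall>y \<in> elts (fob A a). cmp \<phi> a x = cmp \<phi> a y \<longrightarrow>
      (\<exists>w \<in> elts (fob K a). cmp s a w = x \<and> cmp t a w = y)"
    proof (intro ballI impI)
      fix a x y assume a: "a \<in> Ob C" and xy: "x \<in> elts (fob A a)" "y \<in> elts (fob A a)"
        "cmp \<phi> a x = cmp \<phi> a y"
      then have "(\<lambda>i. if i then x else y) \<in> S a" unfolding S_iff by simp
      then obtain w where w: "w \<in> elts (fob K a)" "\<beta> a w = (\<lambda>i. if i then x else y)"
        using bij_betw_imp_surj_on[OF \<beta>[OF a]] by (metis imageE)
      then show "\<exists>w \<in> elts (fob K a). cmp s a w = x \<and> cmp t a w = y"
        using s(2)[OF a w(1)] t(2)[OF a w(1)] by auto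
    qed
  qed
qed

text \<open>The factorization of a test map \<open>h\<close> is the projection to the component \<open>h\<close>. Factorizations are unique
  because the elements on which two maps agree form a closed family, and a closed family containing
  the image of \<open>A\<close> is everything, by induction on \<open>generated\<close>. The last clause records this induction
  principle, which carries the rank argument below.\<close>

lemma kernel_pair_coequalizer:
  assumes \<phi>: "\<phi> \<in> Hom MOD A X"
  obtains B q g where "q \<in> Hom MOD A B" "g \<in> Hom MOD B X" "Comp MOD g q = \<phi>" "regular_epi MOD q"
    "\<forall>a \<in> Ob C. \<forall>x \<in> elts (fob A a). \<forall>y \<in> elts (fob A a).
      cmp \<phi> a x = cmp \<phi> a y \<longrightarrow> cmp q a x = cmp q a y"
    "\<forall>S. closed_family B S \<longrightarrow> (\<forall>a \<in> Ob C. \<forall>x \<in> elts (fob A a). cmp q a x \<in> S a) \<longrightarrow>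
      (\<forall>a \<in> Ob C. elts (fob B a) \<subseteq> S a)"
proof -
  have A: "model A" and X: "model X" using \<phi> by (simp_all add: Hom_MOD_iff)
  let ?I = "test_maps A \<phi>"
  define S where "S a = {z. generated A \<phi> a z}" for a
  obtain B \<beta> where B: "model B" and \<beta>: "\<And>a. a \<in> Ob C \<Longrightarrow> bij_betw (\<beta> a) (elts (fob B a)) (S a)"
    and \<beta>act: "\<And>a b m x. m \<in> Hom C a b \<Longrightarrow> x \<in> elts (fob B a) \<Longrightarrow>
      \<beta> b (act B m x) = (\<lambda>h \<in> ?I. act (Cod MOD h) m (\<beta> a x h))"
  proof (rule subproduct_model[of ?I "Cod MOD" S])
    show "S a \<subseteq> (\<Pi>\<^sub>E h \<in> ?I. elts (fob (Cod MOD h) a))" for a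
      using generated_in[of A \<phi> a] unfolding S_def by blast
    show "S a \<noteq> {}" if a: "is_terminal C a" for a
    proof -
      have "a \<in> Ob C" using a by (simp add: is_terminal_def)
      moreover obtain x where "x \<in> elts (fob A a)" using model_terminal[OF A a] by blast
      ultimately show ?thesis using base[of a x A \<phi>] by (auto simp: S_def)
    qed
  qed (auto simp: S_def test_maps_model small_generated intro: generated.act generated.pair)
  have \<beta>in: "generated A \<phi> a (\<beta> a w)" if "a \<in> Ob C" "w \<in> elts (fob B a)" for a w
    using bij_betw_apply[OF \<beta>[OF that(1)] that(2)] by (simp add: S_def)
  have \<beta>inj: "w = w'" if "a \<in> Ob C" "w \<in> elts (fob B a)" "w' \<in> elts (fob B a)" "\<beta> a w = \<beta> a w'" for a w w'
    using bij_betw_imp_inj_on[OF \<beta>[OF that(1)]] that by (simp add: inj_on_def)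
  have \<beta>surj: "\<exists>w \<in> elts (fob B a). \<beta> a w = z" if "a \<in> Ob C" "generated A \<phi> a z" for a z
    using bij_betw_imp_surj_on[OF \<beta>[OF that(1)]] that(2) unfolding S_def by (metis imageE mem_Collect_eq)
  have "\<forall>a x. \<exists>w. a \<in> Ob C \<longrightarrow> x \<in> elts (fob A a) \<longrightarrow>
      w \<in> elts (fob B a) \<and> \<beta> a w = (\<lambda>h \<in> ?I. cmp h a x)"
    using \<beta>surj[OF _ base] by blast
  then obtain qf where qf: "\<And>a x. a \<in> Ob C \<Longrightarrow> x \<in> elts (fob A a) \<Longrightarrow>
      qf a x \<in> elts (fob B a) \<and> \<beta> a (qf a x) = (\<lambda>h \<in> ?I. cmp h a x)" by metis
  define q where "q = mk_mor A B qf"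
  have q: "q \<in> Hom MOD A B" "\<And>a x. a \<in> Ob C \<Longrightarrow> x \<in> elts (fob A a) \<Longrightarrow> cmp q a x = qf a x"
  proof -
    have nat: "qf b (act A m x) = act B m (qf a x)"
      if m: "m \<in> Hom C a b" and x: "x \<in> elts (fob A a)" for a b m x
    proof -
      note o = HomD(2,3)[OF m]
      note qx = qf[OF o(1) x] and qmx = qf[OF o(2) m_act_in[OF A m x]]
      have "\<beta> b (qf b (act A m x)) = (\<lambda>h \<in> ?I. act (Cod MOD h) m (cmp h a x))"
        unfolding conjunct2[OF qmx] by (intro restrict_ext cmp_natural[OF test_maps_Hom m x])
      also have "\<dots> = \<beta> b (act B m (qf a x))"
        unfolding \<beta>act[OF m conjunct1[OF qx]] conjunct2[OF qx] by (intro restrict_ext) simp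
      finally show ?thesis
        using qmx m_act_in[OF B m conjunct1[OF qx]] \<beta>inj[OF o(2)] by blast
    qed
    show "q \<in> Hom MOD A B" unfolding q_def by (rule mk_mor(1)[OF A B]) (use qf nat in auto)
    show "cmp q a x = qf a x" if "a \<in> Ob C" "x \<in> elts (fob A a)" for a x
      unfolding q_def by (rule mk_mor(2)[OF A B]) (use qf nat that in auto)
  qed
  define pr where "pr h = mk_mor B (Cod MOD h) (\<lambda>a w. \<beta> a w h)" for h
  have pr: "pr h \<in> Hom MOD B (Cod MOD h)"
    "\<And>a w. a \<in> Ob C \<Longrightarrow> w \<in> elts (fob B a) \<Longrightarrow> cmp (pr h) a w = \<beta> a w h" if h: "h \<in> ?I" for h
  proof -
    have 1: "\<beta> a w h \<in> elts (fob (Cod MOD h) a)" if "a \<in> Ob C" "w \<in> elts (fob B a)" for a w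
      using generated_in[OF \<beta>in[OF that]] h PiE_mem by blast
    have 2: "\<beta> b (act B m w) h = act (Cod MOD h) m (\<beta> a w h)"
      if "m \<in> Hom C a b" "w \<in> elts (fob B a)" for a b m w
      using \<beta>act[OF that] h by simp
    show "pr h \<in> Hom MOD B (Cod MOD h)"
      unfolding pr_def by (rule mk_mor(1)[OF B test_maps_model[OF h]]) (use 1 2 in auto)
    show "cmp (pr h) a w = \<beta> a w h" if "a \<in> Ob C" "w \<in> elts (fob B a)" for a w
      unfolding pr_def by (rule mk_mor(2)[OF B test_maps_model[OF h]]) (use 1 2 that in auto)
  qed
  have pr_q: "Comp MOD (pr h) q = h" if h: "h \<in> ?I" for h
  proof (rule MOD_ext[OF cat_Comp[OF is_category_MOD q(1) pr(1)[OF h]] test_maps_Hom[OF h]])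
    fix a x assume ax: "a \<in> Ob C" "x \<in> elts (fob A a)"
    show "cmp (Comp MOD (pr h) q) a x = cmp h a x"
      using cmp_Comp[OF q(1) pr(1)[OF h] ax] q(2)[OF ax] qf[OF ax] pr(2)[OF h ax(1), of "qf a x"] h
      by simp
  qed
  have closed: "elts (fob B a) \<subseteq> T a"
    if T: "closed_family B T" and qT: "\<And>a x. a \<in> Ob C \<Longrightarrow> x \<in> elts (fob A a) \<Longrightarrow> cmp q a x \<in> T a"
      and a: "a \<in> Ob C" for T a
  proof -
    have *: "\<forall>w \<in> elts (fob B a). \<beta> a w = z \<longrightarrow> w \<in> T a" if "generated A \<phi> a z" for a z
      using that
    proof (induction rule: generated.induct)
      case (base a x)
      show ?case
      proof (intro ballI impI)
        fix w assume w: "w \<in> elts (fob B a)" "\<beta> a w = (\<lambda>h \<in> ?I. cmp h a x)"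
        have "w = qf a x" using \<beta>inj[OF base(1) w(1), of "qf a x"] qf[OF base] w(2) by simp
        then show "w \<in> T a" using qT[OF base] q(2)[OF base] by simp
      qed
    next
      case (act a z m b)
      note o = HomD(2,3)[OF act(2)]
      show ?case
      proof (intro ballI impI)
        fix w assume w: "w \<in> elts (fob B b)" "\<beta> b w = (\<lambda>h \<in> ?I. act (Cod MOD h) m (z h))"
        obtain v where v: "v \<in> elts (fob B a)" "\<beta> a v = z" using \<beta>surj[OF o(1) act(1)] by blast
        have "w = act B m v"
          using \<beta>inj[OF o(2) w(1) m_act_in[OF B act(2) v(1)]] \<beta>act[OF act(2) v(1)] v(2) w(2) by simp
        moreover have "v \<in> T a" using act(3) v by blast
        ultimately show "w \<in> T b" using T act(2) v(1) unfolding closed_family_def by blast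
      qed
    next
      case (pair P K L X' p r f d z)
      have H: "p \<in> Hom C P K" "r \<in> Hom C P L" using pair(1) by (simp_all add: disp_square_def)
      show ?case
      proof (intro ballI impI)
        fix w assume w: "w \<in> elts (fob B P)" "\<beta> P w = z"
        have "act B p w \<in> T K"
          using pair(5) m_act_in[OF B H(1) w(1)] \<beta>act[OF H(1) w(1)] w(2) by blast
        moreover have "act B r w \<in> T L"
          using pair(6) m_act_in[OF B H(2) w(1)] \<beta>act[OF H(2) w(1)] w(2) by blast
        ultimately show "w \<in> T P" using T pair(1) w(1) unfolding closed_family_def by blast
      qed
    qed
    show ?thesis using *[OF \<beta>in[OF a]] by blast
  qed
  have q_eq: "cmp q a x = cmp q a y"
    if "a \<in> Ob C" "x \<in> elts (fob A a)" "y \<in> elts (fob A a)" "cmp \<phi> a x = cmp \<phi> a y" for a x y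
  proof -
    have "cmp h a x = cmp h a y" if "h \<in> ?I" for h
      using that \<open>a \<in> Ob C\<close> \<open>x \<in> _\<close> \<open>y \<in> _\<close> \<open>cmp \<phi> a x = _\<close> unfolding test_maps_def by blast
    then have "\<beta> a (qf a x) = \<beta> a (qf a y)"
      unfolding conjunct2[OF qf[OF that(1,2)]] conjunct2[OF qf[OF that(1,3)]]
      by (intro restrict_ext)
    then have "qf a x = qf a y" using \<beta>inj[OF that(1)] qf[OF that(1,2)] qf[OF that(1,3)] by blast
    then show ?thesis using q(2)[OF that(1,2)] q(2)[OF that(1,3)] by simp
  qed
  have \<phi>I: "\<phi> \<in> ?I" using HomD[OF \<phi>] by (simp add: test_maps_def)
  obtain K s t where s: "s \<in> Hom MOD K A" and t: "t \<in> Hom MOD K A"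
    and st: "\<forall>a \<in> Ob C. \<forall>w \<in> elts (fob K a). cmp \<phi> a (cmp s a w) = cmp \<phi> a (cmp t a w)"
    and ker: "\<forall>a \<in> Ob C. \<forall>x \<in> elts (fob A a). \<forall>y \<in> elts (fob A a). cmp \<phi> a x = cmp \<phi> a y \<longrightarrow>
      (\<exists>w \<in> elts (fob K a). cmp s a w = x \<and> cmp t a w = y)"
    by (rule kernel_pair[OF \<phi>])
  have "is_coequalizer MOD s t q"
    unfolding is_coequalizer_def
  proof (intro exI conjI ballI impI)
    show "s \<in> Hom MOD K A" "t \<in> Hom MOD K A" "q \<in> Hom MOD A B" by (fact s t q(1))+
    show "Comp MOD q s = Comp MOD q t"
    proof (rule MOD_ext[OF cat_Comp[OF is_category_MOD s q(1)] cat_Comp[OF is_category_MOD t q(1)]])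
      fix a w assume aw: "a \<in> Ob C" "w \<in> elts (fob K a)"
      show "cmp (Comp MOD q s) a w = cmp (Comp MOD q t) a w"
        unfolding cmp_Comp[OF s q(1) aw] cmp_Comp[OF t q(1) aw]
        by (rule q_eq[OF aw(1) cmp_in[OF s aw] cmp_in[OF t aw] st[rule_format, OF aw]])
    qed
    fix Z k assume "Z \<in> Ob MOD" and k: "k \<in> Hom MOD A Z" and kst: "Comp MOD k s = Comp MOD k t"
    have k_eq: "cmp k a x = cmp k a y"
      if axy: "a \<in> Ob C" "x \<in> elts (fob A a)" "y \<in> elts (fob A a)" "cmp \<phi> a x = cmp \<phi> a y" for a x y
    proof -
      obtain w where w: "w \<in> elts (fob K a)" "cmp s a w = x" "cmp t a w = y"
        using ker[rule_format, OF axy] by blast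
      then show ?thesis
        using cmp_Comp[OF s k axy(1) w(1)] cmp_Comp[OF t k axy(1) w(1)] kst by simp
    qed
    have kI: "k \<in> ?I"
      unfolding test_maps_def
      by (intro CollectI conjI HomD(1)[OF k] HomD(4)[OF k] ballI impI k_eq)
    have cod: "Cod MOD k = Z" by (rule Cod_MOD[OF k])
    show "\<exists>!h. h \<in> Hom MOD B Z \<and> Comp MOD h q = k"
    proof (rule ex1I[of _ "pr k"])
      show "pr k \<in> Hom MOD B Z \<and> Comp MOD (pr k) q = k" using pr(1)[OF kI] pr_q[OF kI] cod by simp
      fix h assume h: "h \<in> Hom MOD B Z \<and> Comp MOD h q = k"
      note hB = conjunct1[OF h]
      have Z: "model Z" using k by (simp add: Hom_MOD_iff)
      have pk: "pr k \<in> Hom MOD B Z" using pr(1)[OF kI] cod by simp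
      define T where "T a = {w. cmp h a w = cmp (pr k) a w}" for a
      have "closed_family B T"
        unfolding closed_family_def
      proof (intro conjI allI impI)
        fix a b m x assume m: "m \<in> Hom C a b" and x: "x \<in> elts (fob B a)" "x \<in> T a"
        then show "act B m x \<in> T b"
          using cmp_natural[OF hB m x(1)] cmp_natural[OF pk m x(1)] by (simp add: T_def)
      next
        fix P A' B' X' p r f d x
        assume sq: "disp_square P A' B' X' p r f d" and x: "x \<in> elts (fob B P)"
          and xp: "act B p x \<in> T A'" and xr: "act B r x \<in> T B'"
        have H: "p \<in> Hom C P A'" "r \<in> Hom C P B'" using sq by (simp_all add: disp_square_def)
        note P = HomD(2)[OF H(1)]
        have "cmp h P x = cmp (pr k) P x"
        proof (rule model_pair_unique[OF Z sq cmp_in[OF hB P x] cmp_in[OF pk P x]])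
          show "act Z p (cmp h P x) = act Z p (cmp (pr k) P x)"
            using xp cmp_natural[OF hB H(1) x] cmp_natural[OF pk H(1) x] by (simp add: T_def)
          show "act Z r (cmp h P x) = act Z r (cmp (pr k) P x)"
            using xr cmp_natural[OF hB H(2) x] cmp_natural[OF pk H(2) x] by (simp add: T_def)
        qed
        then show "x \<in> T P" by (simp add: T_def)
      qed
      moreover have "cmp q a x \<in> T a" if ax: "a \<in> Ob C" "x \<in> elts (fob A a)" for a x
        using cmp_Comp[OF q(1) hB ax] cmp_Comp[OF q(1) pk ax] pr_q[OF kI] h by (simp add: T_def)
      ultimately have "elts (fob B a) \<subseteq> T a" if "a \<in> Ob C" for a using that
        by (intro closed) auto
      then show "h = pr k" by (intro MOD_ext[OF hB pk]) (auto simp: T_def)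
    qed
  qed
  then have "regular_epi MOD q" unfolding regular_epi_def by blast
  moreover have "pr \<phi> \<in> Hom MOD B X" using pr(1)[OF \<phi>I] Cod_MOD[OF \<phi>] by simp
  moreover have "\<forall>a \<in> Ob C. \<forall>x \<in> elts (fob A a). \<forall>y \<in> elts (fob A a).
      cmp \<phi> a x = cmp \<phi> a y \<longrightarrow> cmp q a x = cmp q a y"
    by (intro ballI impI q_eq)
  moreover have "\<forall>S. closed_family B S \<longrightarrow> (\<forall>a \<in> Ob C. \<forall>x \<in> elts (fob A a). cmp q a x \<in> S a) \<longrightarrow>
      (\<forall>a \<in> Ob C. elts (fob B a) \<subseteq> S a)"
    by (intro allI ballI impI closed) auto
  ultimately show ?thesis using that[OF q(1) _ pr_q[OF \<phi>I]] by blast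
qed

end

section \<open>Metatheory of generalized algebraic theories\<close>

subsection \<open>Substitutions\<close>

lemma subst_cong: "(\<And>x. x \<in> fv e \<Longrightarrow> \<sigma> x = \<tau> x) \<Longrightarrow> subst \<sigma> e = subst \<tau> e"
  by (induction e) auto

lemma subst_subst: "subst \<sigma> (subst \<tau> e) = subst (\<lambda>x. subst \<sigma> (\<tau> x)) e"
  by (induction e) auto

lemma subst_Var: "subst Var e = e"
  by (induction e) (auto intro: map_idI)

lemma subst_id: "(\<And>x. x \<in> fv e \<Longrightarrow> \<sigma> x = Var x) \<Longrightarrow> subst \<sigma> e = e"
  using subst_cong[of e \<sigma> Var] subst_Var by metis

lemma fv_subst: "fv (subst \<sigma> e) = (\<Union>x \<in> fv e. fv (\<sigma> x))"
  by (induction e) auto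

lemma rename_eq_subst: "rename \<pi> e = subst (\<lambda>x. Var (\<pi> x)) e"
  by (induction e) (auto simp: sum.map_ident id_def)

lemma fv_subst1: "fv (subst1 t x e) \<subseteq> (fv e - {x}) \<union> fv t"
  unfolding subst1_def fv_subst by (auto split: if_splits)

lemma subst1_id: "x \<notin> fv e \<Longrightarrow> subst1 t x e = e"
  unfolding subst1_def by (rule subst_id) auto

lemma subst_subst1: "subst \<sigma> (subst1 t x e) = subst (\<sigma>(x := subst \<sigma> t)) e"
  unfolding subst1_def subst_subst by (rule subst_cong) auto

lemma fv_ctx_subst1 [simp]: "fst ` set (subst1_ctx t x \<Delta>) = fst ` set \<Delta>"
  by (induction \<Delta>) (auto simp: subst1_ctx_def)

lemma fv_ctx_rename: "fst ` set (rename_ctx \<pi> \<Delta>) = \<pi> ` fst ` set \<Delta>"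
  by (induction \<Delta>) (auto simp: rename_ctx_def)

lemma subst1_ctx_simps:
  "subst1_ctx t x [] = []"
  "subst1_ctx t x ((y, S) # \<Delta>) = (y, subst1 t x S) # subst1_ctx t x \<Delta>"
  "subst1_ctx t x (\<Delta> @ \<Xi>) = subst1_ctx t x \<Delta> @ subst1_ctx t x \<Xi>"
  "length (subst1_ctx t x \<Delta>) = length \<Delta>"
  by (simp_all add: subst1_ctx_def)

lemma rename_ctx_simps:
  "rename_ctx \<pi> [] = []"
  "rename_ctx \<pi> ((y, S) # \<Delta>) = (\<pi> y, rename \<pi> S) # rename_ctx \<pi> \<Delta>"
  "rename_ctx \<pi> (\<Delta> @ \<Xi>) = rename_ctx \<pi> \<Delta> @ rename_ctx \<pi> \<Xi>"
  by (simp_all add: rename_ctx_def)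

lemma map_stmt_cong: "(\<And>e. e \<in> set_stmt K \<Longrightarrow> f e = g e) \<Longrightarrow> map_stmt f K = map_stmt g K"
  by (rule stmt.map_cong) auto

text \<open>The substitution underlying \<open>subst_list\<close>.\<close>

definition assign where
  "assign xs ts y = (case map_of (zip xs ts) y of None \<Rightarrow> Var y | Some t \<Rightarrow> t)"

lemma subst_list_assign: "subst_list xs ts = subst (assign xs ts)"
  unfolding subst_list_def assign_def ..

lemma assign_nth:
  "distinct xs \<Longrightarrow> length ts = length xs \<Longrightarrow> i < length xs \<Longrightarrow> assign xs ts (xs ! i) = ts ! i"
  by (simp add: assign_def map_of_zip_nth)

lemma assign_map: "y \<in> set xs \<Longrightarrow> assign xs (map f xs) y = f y"
  by (simp add: assign_def map_of_zip_map)

subsection \<open>Scoping\<close>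

primrec scoped :: "'v set \<Rightarrow> ('v, 'a, 'f) precontext \<Rightarrow> bool" where
  "scoped V [] = True"
| "scoped V (b # \<Gamma>) = (fst b \<notin> V \<and> fv (snd b) \<subseteq> V \<and> scoped (insert (fst b) V) \<Gamma>)"

lemma scoped_append: "scoped V (\<Gamma> @ \<Delta>) \<longleftrightarrow> scoped V \<Gamma> \<and> scoped (V \<union> fv_ctx \<Gamma>) \<Delta>"
  by (induction \<Gamma> arbitrary: V) auto

lemma scoped_distinct: "scoped V \<Gamma> \<Longrightarrow> distinct (vars \<Gamma>) \<and> V \<inter> fv_ctx \<Gamma> = {}"
proof (induction \<Gamma> arbitrary: V)
  case (Cons b \<Gamma>)
  then show ?case using Cons.IH[of "insert (fst b) V"] by auto
qed simp

lemma scoped_rename: "inj \<pi> \<Longrightarrow> scoped V \<Gamma> \<Longrightarrow> scoped (\<pi> ` V) (rename_ctx \<pi> \<Gamma>)"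
proof (induction \<Gamma> arbitrary: V)
  case (Cons b \<Gamma>)
  then show ?case using Cons.IH[of "insert (fst b) V"]
    by (cases b) (auto simp: rename_ctx_simps expr.set_map inj_image_mem_iff)
qed (simp add: rename_ctx_simps)

lemma scoped_weaken: "scoped V \<Delta> \<Longrightarrow> x \<notin> fv_ctx \<Delta> \<Longrightarrow> scoped (insert x V) \<Delta>"
proof (induction \<Delta> arbitrary: V)
  case (Cons b \<Delta>)
  then show ?case using Cons.IH[of "insert (fst b) V"] by (auto simp: insert_commute)
qed simp

lemma scoped_subst1: "scoped (insert x V) \<Delta> \<Longrightarrow> fv t \<subseteq> V \<Longrightarrow> x \<notin> V \<Longrightarrow> scoped V (subst1_ctx t x \<Delta>)"
proof (induction \<Delta> arbitrary: V)
  case (Cons b \<Delta>)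
  obtain y S where b: "b = (y, S)" by (cases b)
  have "scoped (insert y V) (subst1_ctx t x \<Delta>)"
    by (rule Cons.IH) (use Cons.prems b in \<open>auto simp: insert_commute\<close>)
  then show ?case using Cons.prems fv_subst1[of t x S] unfolding b subst1_ctx_simps by auto
qed (simp add: subst1_ctx_simps)

lemma scoped_entry: "scoped V \<Gamma> \<Longrightarrow> (y, S) \<in> set \<Gamma> \<Longrightarrow> fv S \<subseteq> V \<union> fv_ctx \<Gamma>"
  by (induction \<Gamma> arbitrary: V) fastforce+

lemma scoped_nth: 
  assumes "scoped V \<Gamma>" "i < length \<Gamma>"
  shows "fv (snd (\<Gamma> ! i)) \<subseteq> V \<union> set (take i (vars \<Gamma>))"
proof -
  have "scoped V (take i \<Gamma> @ \<Gamma> ! i # drop (Suc i) \<Gamma>)"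
    using assms by (simp add: id_take_nth_drop[symmetric])
  then show ?thesis unfolding scoped_append by (simp add: take_map)
qed

primrec scoped_judgment :: "('v, 'a, 'f) prejudgment \<Rightarrow> bool" where
  "scoped_judgment (Ctx \<Gamma>) = scoped {} \<Gamma>"
| "scoped_judgment (\<Gamma> \<turnstile> K) = (scoped {} \<Gamma> \<and> (\<forall>e \<in> set_stmt K. fv e \<subseteq> fv_ctx \<Gamma>))"

lemma derivable_scoped: "derivable TT J \<Longrightarrow> scoped_judgment J"
proof (induction rule: derivable.induct)
  case (ctx_rename \<Gamma> \<pi>)
  then show ?case using scoped_rename[OF permutes_inj, of \<pi> _ "{}" \<Gamma>] by simp
next
  case (stmt_rename \<Gamma> K \<pi>)
  have "\<pi> ` fv e \<subseteq> \<pi> ` fst ` set \<Gamma>" if "e \<in> set_stmt K" for e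
    by (rule image_mono) (use stmt_rename that in auto)
  then show ?case using stmt_rename scoped_rename[OF permutes_inj, of \<pi> _ "{}" \<Gamma>]
    by (simp add: fv_ctx_rename stmt.set_map expr.set_map)
next
  case (weakening \<Gamma> T \<Delta> K x)
  then show ?case using scoped_weaken[of "fv_ctx \<Gamma>" \<Delta> x] by (auto simp: scoped_append)
next
  case (substitution \<Gamma> t T x \<Delta> K)
  then have "scoped (fv_ctx \<Gamma>) (subst1_ctx t x \<Delta>)"
    by (intro scoped_subst1) (auto simp: scoped_append)
  moreover have "fv t \<subseteq> fst ` set \<Gamma>"
    and K: "\<And>e. e \<in> set_stmt K \<Longrightarrow> fv e \<subseteq> insert x (fst ` set \<Gamma> \<union> fst ` set \<Delta>)"
    using substitution.IH by simp_all
  moreover have "fv (subst1 t x e) \<subseteq> fst ` set \<Gamma> \<union> fst ` set \<Delta>" if "e \<in> set_stmt K" for e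
    using \<open>fv t \<subseteq> _\<close> K[OF that] fv_subst1[of t x e] by blast
  ultimately show ?case using substitution.IH
    by (simp add: scoped_append stmt.set_map image_Un)
next
  case (type_cong \<Gamma> t1 t2 T x \<Delta> T')
  then have "scoped (fv_ctx \<Gamma>) (subst1_ctx t1 x \<Delta>)"
    by (intro scoped_subst1) (auto simp: scoped_append)
  moreover have "fv t1 \<subseteq> fst ` set \<Gamma>" "fv t2 \<subseteq> fst ` set \<Gamma>"
    "fv T' \<subseteq> insert x (fst ` set \<Gamma> \<union> fst ` set \<Delta>)"
    using type_cong.IH by simp_all
  then have "fv (subst1 t1 x T') \<subseteq> fst ` set \<Gamma> \<union> fst ` set \<Delta>"
    "fv (subst1 t2 x T') \<subseteq> fst ` set \<Gamma> \<union> fst ` set \<Delta>"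
    using fv_subst1[of t1 x T'] fv_subst1[of t2 x T'] by blast+
  ultimately show ?case using type_cong.IH by (simp add: scoped_append image_Un)
next
  case (term_cong \<Gamma> t1 t2 T x \<Delta> t' T')
  then have "scoped (fv_ctx \<Gamma>) (subst1_ctx t1 x \<Delta>)"
    by (intro scoped_subst1) (auto simp: scoped_append)
  moreover have "fv t1 \<subseteq> fst ` set \<Gamma>" "fv t2 \<subseteq> fst ` set \<Gamma>"
    "fv T' \<subseteq> insert x (fst ` set \<Gamma> \<union> fst ` set \<Delta>)"
    "fv t' \<subseteq> insert x (fst ` set \<Gamma> \<union> fst ` set \<Delta>)"
    using term_cong.IH by simp_all
  then have "fv (subst1 t1 x T') \<subseteq> fst ` set \<Gamma> \<union> fst ` set \<Delta>"
    "fv (subst1 t1 x t') \<subseteq> fst ` set \<Gamma> \<union> fst ` set \<Delta>"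
    "fv (subst1 t2 x t') \<subseteq> fst ` set \<Gamma> \<union> fst ` set \<Delta>"
    using fv_subst1[of t1 x T'] fv_subst1[of t1 x t'] fv_subst1[of t2 x t'] by blast+
  ultimately show ?case using term_cong.IH by (simp add: scoped_append image_Un)
qed (auto simp: scoped_append sort_judgment_def op_judgment_def)

subsection \<open>Well-formed contexts and substitution lemmas\<close>

text \<open>The rules only assert that a context is derivable, not that its initial segments are; this is
  proved for all derivable judgments below, and \<open>wf_ctx\<close> is the property to be propagated.\<close>

inductive wf_ctx :: "('v, 'a, 'f) theory_data \<Rightarrow> ('v, 'a, 'f) precontext \<Rightarrow> bool" for TT where
  wf_Nil: "wf_ctx TT []"
| wf_snoc: "wf_ctx TT \<Gamma> \<Longrightarrow> derivable TT (\<Gamma> \<turnstile> IsType T) \<Longrightarrow> x \<notin> fv_ctx \<Gamma> \<Longrightarrow>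
    wf_ctx TT (\<Gamma> @ [(x, T)])"

lemma wf_ctx_snoc_iff:
  "wf_ctx TT (\<Gamma> @ [(x, T)]) \<longleftrightarrow> wf_ctx TT \<Gamma> \<and> derivable TT (\<Gamma> \<turnstile> IsType T) \<and> x \<notin> fv_ctx \<Gamma>"
proof
  assume "wf_ctx TT (\<Gamma> @ [(x, T)])"
  then show "wf_ctx TT \<Gamma> \<and> derivable TT (\<Gamma> \<turnstile> IsType T) \<and> x \<notin> fv_ctx \<Gamma>" by cases simp_all
qed (simp add: wf_snoc)

lemma wf_ctx_append: "wf_ctx TT (\<Gamma> @ \<Delta>) \<Longrightarrow> wf_ctx TT \<Gamma>"
proof (induction \<Delta> rule: rev_induct)
  case (snoc b \<Delta>)
  then show ?case using wf_ctx_snoc_iff[of TT "\<Gamma> @ \<Delta>" "fst b" "snd b"] by simp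
qed simp

lemma wf_ctx_mid:
  assumes "wf_ctx TT (\<Gamma> @ (x, T) # \<Delta>)"
  shows "wf_ctx TT \<Gamma>" "derivable TT (\<Gamma> \<turnstile> IsType T)" "x \<notin> fv_ctx \<Gamma>"
  using wf_ctx_append[of TT "\<Gamma> @ [(x, T)]" \<Delta>] assms by (simp_all add: wf_ctx_snoc_iff)

lemma wf_ctx_scoped: "wf_ctx TT \<Gamma> \<Longrightarrow> scoped {} \<Gamma>"
proof (induction rule: wf_ctx.induct)
  case (wf_snoc \<Gamma> T x)
  then show ?case using derivable_scoped[OF wf_snoc(2)] by (simp add: scoped_append)
qed simp

lemma wf_ctx_distinct: "wf_ctx TT \<Gamma> \<Longrightarrow> distinct (vars \<Gamma>)"
  using wf_ctx_scoped scoped_distinct by blast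

lemma wf_ctx_fv: "wf_ctx TT \<Gamma> \<Longrightarrow> (y, S) \<in> set \<Gamma> \<Longrightarrow> fv S \<subseteq> fv_ctx \<Gamma>"
  using scoped_entry[OF wf_ctx_scoped, of TT \<Gamma> y S] by simp

lemma derivable_fv: "derivable TT (\<Gamma> \<turnstile> K) \<Longrightarrow> e \<in> set_stmt K \<Longrightarrow> fv e \<subseteq> fv_ctx \<Gamma>"
  using derivable_scoped by fastforce

lemma wf_ctx_derivable: "wf_ctx TT \<Gamma> \<Longrightarrow> derivable TT (Ctx \<Gamma>)"
  by (induction rule: wf_ctx.induct) (auto intro: ctx_empty ctx_extend)

lemma wf_ctx_weaken:
  assumes "derivable TT (\<Gamma> \<turnstile> IsType T)" "wf_ctx TT (\<Gamma> @ \<Delta>)" "x \<notin> fv_ctx \<Gamma> \<union> fv_ctx \<Delta>"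
  shows "wf_ctx TT (\<Gamma> @ (x, T) # \<Delta>)"
  using assms(2,3)
proof (induction \<Delta> rule: rev_induct)
  case Nil then show ?case using assms(1) by (simp add: wf_ctx_snoc_iff)
next
  case (snoc b \<Delta>)
  obtain y S where b: "b = (y, S)" by (cases b)
  have \<Delta>: "wf_ctx TT (\<Gamma> @ \<Delta>)" "derivable TT (\<Gamma> @ \<Delta> \<turnstile> IsType S)" "y \<notin> fv_ctx (\<Gamma> @ \<Delta>)"
    using snoc.prems(1) wf_ctx_snoc_iff[of TT "\<Gamma> @ \<Delta>" y S] unfolding b by simp_all
  have "wf_ctx TT ((\<Gamma> @ (x, T) # \<Delta>) @ [(y, S)])"
    unfolding wf_ctx_snoc_iff
    using snoc.IH[OF \<Delta>(1)] weakening[OF assms(1) \<Delta>(2), of x] snoc.prems(2) \<Delta>(3) b by auto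
  then show ?case unfolding b by simp
qed

lemma wf_ctx_subst1:
  assumes "derivable TT (\<Gamma> \<turnstile> HasType t T)" "wf_ctx TT (\<Gamma> @ (x, T) # \<Delta>)"
  shows "wf_ctx TT (\<Gamma> @ subst1_ctx t x \<Delta>)"
  using assms(2)
proof (induction \<Delta> rule: rev_induct)
  case Nil then show ?case using wf_ctx_mid[of TT \<Gamma> x T "[]"] by (simp add: subst1_ctx_simps)
next
  case (snoc b \<Delta>)
  obtain y S where b: "b = (y, S)" by (cases b)
  have \<Delta>: "wf_ctx TT (\<Gamma> @ (x, T) # \<Delta>)" "derivable TT (\<Gamma> @ [(x, T)] @ \<Delta> \<turnstile> IsType S)"
    "y \<notin> fv_ctx (\<Gamma> @ (x, T) # \<Delta>)"
    using snoc.prems(1) wf_ctx_snoc_iff[of TT "\<Gamma> @ (x, T) # \<Delta>" y S] unfolding b by simp_all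
  have "wf_ctx TT ((\<Gamma> @ subst1_ctx t x \<Delta>) @ [(y, subst1 t x S)])"
    unfolding wf_ctx_snoc_iff
    using snoc.IH[OF \<Delta>(1)] substitution[OF assms(1) \<Delta>(2)] \<Delta>(3)
    by (simp add: subst1_ctx_def comp_def)
  then show ?case unfolding b by (simp add: subst1_ctx_simps)
qed

lemma weaken_left:
  assumes "wf_ctx TT \<Theta>" "derivable TT (\<Gamma> \<turnstile> K)" "fv_ctx \<Theta> \<inter> fv_ctx \<Gamma> = {}"
  shows "derivable TT (\<Theta> @ \<Gamma> \<turnstile> K)"
  using assms(1,3)
proof (induction rule: wf_ctx.induct)
  case wf_Nil then show ?case using assms(2) by simp
next
  case (wf_snoc \<Theta> T x)
  then show ?case using weakening[OF wf_snoc(2), of \<Gamma> K x] by simp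
qed

lemma weaken_right: "wf_ctx TT (\<Gamma> @ \<Delta>) \<Longrightarrow> derivable TT (\<Gamma> \<turnstile> K) \<Longrightarrow> derivable TT (\<Gamma> @ \<Delta> \<turnstile> K)"
proof (induction \<Delta> rule: rev_induct)
  case (snoc b \<Delta>)
  have "wf_ctx TT (\<Gamma> @ \<Delta>)" "derivable TT (\<Gamma> @ \<Delta> \<turnstile> IsType (snd b))" "fst b \<notin> fv_ctx (\<Gamma> @ \<Delta>)"
    using snoc.prems(1) wf_ctx_snoc_iff[of TT "\<Gamma> @ \<Delta>" "fst b" "snd b"] by simp_all
  then show ?case using weakening[of TT "\<Gamma> @ \<Delta>" "snd b" "[]" K "fst b"] snoc by simp
qed simp

lemma wf_ctx_var:
  assumes "wf_ctx TT \<Gamma>" "(y, S) \<in> set \<Gamma>"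
  shows "derivable TT (\<Gamma> \<turnstile> HasType (Var y) S)"
proof -
  obtain \<Gamma>1 \<Gamma>2 where \<Gamma>: "\<Gamma> = \<Gamma>1 @ (y, S) # \<Gamma>2" using assms(2) by (metis in_set_conv_decomp)
  have "derivable TT (\<Gamma>1 @ [(y, S)] \<turnstile> HasType (Var y) S)"
    by (rule var_intro[OF wf_ctx_mid(2,3)]) (use assms(1) in \<open>simp_all add: \<Gamma>\<close>)
  then show ?thesis using weaken_right[of TT "\<Gamma>1 @ [(y, S)]" \<Gamma>2] assms(1) \<Gamma> by simp
qed

text \<open>A context morphism, given as a function that is read on the variables of \<open>\<Gamma>\<close>. In contrast to a list of
  terms it can be restricted to initial segments and updated at a variable.\<close>

definition ctx_subst ::
  "('v, 'a, 'f) theory_data \<Rightarrow> ('v, 'a, 'f) precontext \<Rightarrow> ('v, 'a, 'f) precontext \<Rightarrow>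
     ('v \<Rightarrow> ('v, 'a, 'f) expr) \<Rightarrow> bool" where
  "ctx_subst TT \<Theta> \<Gamma> \<sigma> \<longleftrightarrow> (\<forall>(y, S) \<in> set \<Gamma>. derivable TT (\<Theta> \<turnstile> HasType (\<sigma> y) (subst \<sigma> S)))"

lemma ctx_substD: "ctx_subst TT \<Theta> \<Gamma> \<sigma> \<Longrightarrow> (y, S) \<in> set \<Gamma> \<Longrightarrow>
    derivable TT (\<Theta> \<turnstile> HasType (\<sigma> y) (subst \<sigma> S))"
  unfolding ctx_subst_def by blast

lemma ctx_subst_weaken: "wf_ctx TT (\<Theta> @ \<Xi>) \<Longrightarrow> ctx_subst TT \<Theta> \<Gamma> \<sigma> \<Longrightarrow> ctx_subst TT (\<Theta> @ \<Xi>) \<Gamma> \<sigma>"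
  unfolding ctx_subst_def using weaken_right by blast

lemma ctx_subst_cong:
  assumes "wf_ctx TT \<Gamma>" "\<And>y. y \<in> fv_ctx \<Gamma> \<Longrightarrow> \<sigma> y = \<tau> y" "ctx_subst TT \<Theta> \<Gamma> \<sigma>"
  shows "ctx_subst TT \<Theta> \<Gamma> \<tau>"
  unfolding ctx_subst_def
proof (clarify)
  fix y S assume yS: "(y, S) \<in> set \<Gamma>"
  have "subst \<sigma> S = subst \<tau> S" by (rule subst_cong) (use wf_ctx_fv[OF assms(1) yS] assms(2) in blast)
  moreover have "\<sigma> y = \<tau> y" using assms(2) yS by force
  ultimately show "derivable TT (\<Theta> \<turnstile> HasType (\<tau> y) (subst \<tau> S))"
    using ctx_substD[OF assms(3) yS] by simp
qed

text \<open>The telescope version of substitution replaces the variables of \<open>\<Gamma>\<close> one after the other. This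
  agrees with simultaneous substitution because the terms substituted live in \<open>\<Theta>\<close>, whose variables
  are kept fixed.\<close>

lemma subst_telescope:
  assumes "derivable TT (\<Theta> @ \<Gamma> \<turnstile> K)" "\<And>y. y \<in> fv_ctx \<Theta> \<Longrightarrow> \<sigma> y = Var y" "ctx_subst TT \<Theta> \<Gamma> \<sigma>"
  shows "derivable TT (\<Theta> \<turnstile> map_stmt (subst \<sigma>) K)"
  using assms
proof (induction "length \<Gamma>" arbitrary: \<Gamma> K)
  case 0
  then have d: "derivable TT (\<Theta> \<turnstile> K)" by simp
  have "map_stmt (subst \<sigma>) K = map_stmt id K"
  proof (rule map_stmt_cong)
    fix e assume "e \<in> set_stmt K"
    then have "subst \<sigma> e = e" using derivable_fv[OF d] by (intro subst_id 0(3)) blast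
    then show "subst \<sigma> e = id e" by simp
  qed
  then show ?case using d by (simp add: stmt.map_id)
next
  case (Suc n)
  then obtain x T \<Gamma>1 where \<Gamma>: "\<Gamma> = (x, T) # \<Gamma>1" by (metis length_Suc_conv surj_pair)
  have sc: "scoped {} (\<Theta> @ (x, T) # \<Gamma>1)" using derivable_scoped[OF Suc(3)] by (simp add: \<Gamma>)
  have "fv T \<subseteq> fv_ctx \<Theta>" using sc by (simp add: scoped_append)
  then have "subst \<sigma> T = T" by (intro subst_id Suc(4)) blast
  then have x: "derivable TT (\<Theta> \<turnstile> HasType (\<sigma> x) T)"
    using ctx_substD[OF Suc(5), of x T] by (simp add: \<Gamma>)
  have \<sigma>x: "subst \<sigma> (\<sigma> x) = \<sigma> x"
    using derivable_fv[OF x, of "\<sigma> x"] by (intro subst_id Suc(4)) auto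
  have *: "subst \<sigma> (subst1 (\<sigma> x) x e) = subst \<sigma> e" for e
    unfolding subst_subst1 \<sigma>x by simp
  have "derivable TT (\<Theta> \<turnstile> map_stmt (subst \<sigma>) (map_stmt (subst1 (\<sigma> x) x) K))"
  proof (rule Suc.hyps(1)[of "subst1_ctx (\<sigma> x) x \<Gamma>1"])
    show "n = length (subst1_ctx (\<sigma> x) x \<Gamma>1)" using Suc(2) by (simp add: \<Gamma> subst1_ctx_simps)
    show "derivable TT (\<Theta> @ subst1_ctx (\<sigma> x) x \<Gamma>1 \<turnstile> map_stmt (subst1 (\<sigma> x) x) K)"
      using substitution[OF x, of x \<Gamma>1 K] Suc(3) by (simp add: \<Gamma>)
    show "ctx_subst TT \<Theta> (subst1_ctx (\<sigma> x) x \<Gamma>1) \<sigma>"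
      using Suc(5) * by (auto simp: ctx_subst_def \<Gamma> subst1_ctx_def)
  qed (rule Suc(4))
  then show ?case by (simp add: stmt.map_comp comp_def *)
qed

lemma subst_disjoint:
  assumes \<Theta>: "wf_ctx TT \<Theta>" and K: "derivable TT (\<Gamma> \<turnstile> K)" and \<Gamma>: "wf_ctx TT \<Gamma>"
    and disj: "fv_ctx \<Theta> \<inter> fv_ctx \<Gamma> = {}" and \<sigma>: "ctx_subst TT \<Theta> \<Gamma> \<sigma>"
  shows "derivable TT (\<Theta> \<turnstile> map_stmt (subst \<sigma>) K)"
proof -
  define \<tau> where "\<tau> y = (if y \<in> fv_ctx \<Gamma> then \<sigma> y else Var y)" for y
  have "ctx_subst TT \<Theta> \<Gamma> \<tau>" by (rule ctx_subst_cong[OF \<Gamma> _ \<sigma>]) (simp add: \<tau>_def)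
  then have "derivable TT (\<Theta> \<turnstile> map_stmt (subst \<tau>) K)"
    by (intro subst_telescope[OF weaken_left[OF \<Theta> K disj]]) (use disj in \<open>auto simp: \<tau>_def\<close>)
  moreover have "map_stmt (subst \<tau>) K = map_stmt (subst \<sigma>) K"
    by (rule map_stmt_cong, rule subst_cong) (use derivable_fv[OF K] in \<open>auto simp: \<tau>_def\<close>)
  ultimately show ?thesis by simp
qed

text \<open>The renaming lemma is stated relative to the instances of the substitution lemma that it needs:
  for fresh names these are available at once, and for arbitrary names afterwards.\<close>

lemma wf_ctx_rename_step:
  assumes sub: "\<And>\<Gamma>' K. fv_ctx \<Gamma>' \<subseteq> fv_ctx \<Gamma> \<Longrightarrow> wf_ctx TT \<Gamma>' \<Longrightarrow> wf_ctx TT (rename_ctx \<pi> \<Gamma>') \<Longrightarrow>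
      ctx_subst TT (rename_ctx \<pi> \<Gamma>') \<Gamma>' (\<lambda>y. Var (\<pi> y)) \<Longrightarrow> derivable TT (\<Gamma>' \<turnstile> K) \<Longrightarrow>
      derivable TT (rename_ctx \<pi> \<Gamma>' \<turnstile> map_stmt (subst (\<lambda>y. Var (\<pi> y))) K)"
    and \<Gamma>: "wf_ctx TT \<Gamma>" and inj: "inj_on \<pi> (fv_ctx \<Gamma>)"
  shows "wf_ctx TT (rename_ctx \<pi> \<Gamma>) \<and> ctx_subst TT (rename_ctx \<pi> \<Gamma>) \<Gamma> (\<lambda>y. Var (\<pi> y))"
  using \<Gamma> inj sub
proof (induction rule: wf_ctx.induct)
  case wf_Nil
  then show ?case by (simp add: rename_ctx_simps ctx_subst_def wf_ctx.wf_Nil)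
next
  case (wf_snoc \<Gamma> T x)
  let ?\<sigma> = "\<lambda>y. Var (\<pi> y)"
  have IH: "wf_ctx TT (rename_ctx \<pi> \<Gamma>)" "ctx_subst TT (rename_ctx \<pi> \<Gamma>) \<Gamma> ?\<sigma>"
    using wf_snoc.IH wf_snoc.prems(1) wf_snoc.prems(2) by (simp_all add: inj_on_def subset_insertI2)
  have T: "derivable TT (rename_ctx \<pi> \<Gamma> \<turnstile> IsType (subst ?\<sigma> T))"
    using wf_snoc.prems(2)[OF _ wf_snoc(1) IH wf_snoc(2)] by auto
  have "\<pi> x \<notin> fv_ctx (rename_ctx \<pi> \<Gamma>)"
    using wf_snoc.prems(1) wf_snoc(3) unfolding set_map fv_ctx_rename by (auto simp: inj_on_def)
  then have wf: "wf_ctx TT (rename_ctx \<pi> (\<Gamma> @ [(x, T)]))"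
    using IH(1) T by (simp add: rename_ctx_simps wf_ctx_snoc_iff rename_eq_subst)
  have "ctx_subst TT (rename_ctx \<pi> (\<Gamma> @ [(x, T)])) \<Gamma> ?\<sigma>"
    using ctx_subst_weaken[OF _ IH(2), of "rename_ctx \<pi> [(x, T)]"] wf by (simp add: rename_ctx_simps)
  moreover have "derivable TT (rename_ctx \<pi> (\<Gamma> @ [(x, T)]) \<turnstile> HasType (Var (\<pi> x)) (subst ?\<sigma> T))"
    by (rule wf_ctx_var[OF wf]) (simp add: rename_ctx_simps rename_eq_subst)
  ultimately show ?case using wf by (simp add: ctx_subst_def)
qed

lemma fresh_renaming:
  fixes X W :: "'v set"
  assumes "infinite (UNIV :: 'v set)" "finite X" "finite W"
  obtains \<pi> :: "'v \<Rightarrow> 'v" where "inj_on \<pi> X" "\<pi> ` X \<inter> W = {}"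
proof -
  have "infinite (UNIV - W)" using assms(1,3) by (simp add: Diff_infinite_finite)
  then obtain Y where Y: "Y \<subseteq> UNIV - W" "finite Y" "card Y = card X"
    by (metis infinite_arbitrarily_large)
  then obtain \<pi> where "bij_betw \<pi> X Y" using assms(2) finite_same_card_bij by metis
  then show ?thesis using that[of \<pi>] Y(1) by (auto simp: bij_betw_def)
qed

text \<open>Fresh variables are chosen throughout, so there have to be infinitely many variables.\<close>

locale infinite_variables =
  fixes TT :: "('v, 'a, 'f) theory_data"
  assumes inf: "infinite (UNIV :: 'v set)"
begin

text \<open>Simultaneous substitution is derived from the single-variable rules by first renaming \<open>\<Gamma>\<close> apart from
  \<open>\<Theta>\<close>. The renaming is itself a substitution, of the disjoint kind, so there is no circularity.\<close>

lemma subst_lemma: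
  assumes \<Theta>: "wf_ctx TT \<Theta>" and \<Gamma>: "wf_ctx TT \<Gamma>" and K: "derivable TT (\<Gamma> \<turnstile> K)"
    and \<sigma>: "ctx_subst TT \<Theta> \<Gamma> \<sigma>"
  shows "derivable TT (\<Theta> \<turnstile> map_stmt (subst \<sigma>) K)"
proof -
  obtain \<pi> where inj: "inj_on \<pi> (fv_ctx \<Gamma>)" and fresh: "\<pi> ` fv_ctx \<Gamma> \<inter> (fv_ctx \<Gamma> \<union> fv_ctx \<Theta>) = {}"
    using fresh_renaming[OF inf, of "fv_ctx \<Gamma>" "fv_ctx \<Gamma> \<union> fv_ctx \<Theta>"] by auto
  let ?\<rho> = "\<lambda>y. Var (\<pi> y)"
  have r: "wf_ctx TT (rename_ctx \<pi> \<Gamma>)" "ctx_subst TT (rename_ctx \<pi> \<Gamma>) \<Gamma> ?\<rho>"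
  proof -
    have "wf_ctx TT (rename_ctx \<pi> \<Gamma>) \<and> ctx_subst TT (rename_ctx \<pi> \<Gamma>) \<Gamma> ?\<rho>"
    proof (rule wf_ctx_rename_step[OF _ \<Gamma> inj])
      fix \<Gamma>' :: "('v, 'a, 'f) precontext" and K' :: "('v, 'a, 'f) expr stmt"
      assume "fv_ctx \<Gamma>' \<subseteq> fv_ctx \<Gamma>" and *: "wf_ctx TT \<Gamma>'" "wf_ctx TT (rename_ctx \<pi> \<Gamma>')"
        "ctx_subst TT (rename_ctx \<pi> \<Gamma>') \<Gamma>' ?\<rho>" "derivable TT (\<Gamma>' \<turnstile> K')"
      then have "fv_ctx (rename_ctx \<pi> \<Gamma>') \<inter> fv_ctx \<Gamma>' = {}"
        using fresh unfolding set_map fv_ctx_rename by blast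
      then show "derivable TT (rename_ctx \<pi> \<Gamma>' \<turnstile> map_stmt (subst ?\<rho>) K')"
        by (rule subst_disjoint[OF *(2,4,1) _ *(3)])
    qed
    then show "wf_ctx TT (rename_ctx \<pi> \<Gamma>)" "ctx_subst TT (rename_ctx \<pi> \<Gamma>) \<Gamma> ?\<rho>" by simp_all
  qed
  have "fv_ctx (rename_ctx \<pi> \<Gamma>) \<inter> fv_ctx \<Gamma> = {}" using fresh unfolding set_map fv_ctx_rename by blast
  then have K': "derivable TT (rename_ctx \<pi> \<Gamma> \<turnstile> map_stmt (subst ?\<rho>) K)"
    by (rule subst_disjoint[OF r(1) K \<Gamma> _ r(2)])
  define \<tau> where "\<tau> z = \<sigma> (inv_into (fv_ctx \<Gamma>) \<pi> z)" for z
  have \<tau>: "\<tau> (\<pi> y) = \<sigma> y" if "y \<in> fv_ctx \<Gamma>" for y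
    unfolding \<tau>_def using inv_into_f_f[OF inj that] by simp
  have \<tau>\<rho>: "subst \<tau> (subst ?\<rho> e) = subst \<sigma> e" if "fv e \<subseteq> fv_ctx \<Gamma>" for e
    unfolding subst_subst by (rule subst_cong) (use that \<tau> in auto)
  have "ctx_subst TT \<Theta> (rename_ctx \<pi> \<Gamma>) \<tau>"
    unfolding ctx_subst_def
  proof (clarify)
    fix z S' assume "(z, S') \<in> set (rename_ctx \<pi> \<Gamma>)"
    then obtain y S where yS: "(y, S) \<in> set \<Gamma>" "z = \<pi> y" "S' = subst ?\<rho> S"
      by (auto simp: rename_ctx_def rename_eq_subst)
    have "y \<in> fv_ctx \<Gamma>" using yS(1) by force
    then show "derivable TT (\<Theta> \<turnstile> HasType (\<tau> z) (subst \<tau> S'))"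
      using ctx_substD[OF \<sigma> yS(1)] \<tau> \<tau>\<rho>[OF wf_ctx_fv[OF \<Gamma> yS(1)]] yS(2,3) by simp
  qed
  moreover have "fv_ctx \<Theta> \<inter> fv_ctx (rename_ctx \<pi> \<Gamma>) = {}" using fresh unfolding set_map fv_ctx_rename by blast
  ultimately have "derivable TT (\<Theta> \<turnstile> map_stmt (subst \<tau>) (map_stmt (subst ?\<rho>) K))"
    using subst_disjoint[OF \<Theta> K' r(1)] by blast
  moreover have "map_stmt (subst \<tau>) (map_stmt (subst ?\<rho>) K) = map_stmt (subst \<sigma>) K"
    unfolding stmt.map_comp by (rule map_stmt_cong) (use \<tau>\<rho> derivable_fv[OF K] in auto)
  ultimately show ?thesis by simp
qed

lemma wf_ctx_rename:
  assumes "wf_ctx TT \<Gamma>" "inj_on \<pi> (fv_ctx \<Gamma>)"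
  shows "wf_ctx TT (rename_ctx \<pi> \<Gamma>)" "ctx_subst TT (rename_ctx \<pi> \<Gamma>) \<Gamma> (\<lambda>y. Var (\<pi> y))"
  using wf_ctx_rename_step[OF _ assms] subst_lemma by blast+

subsection \<open>Presuppositions\<close>

primrec presup_stmt where
  "presup_stmt \<Gamma> (IsType T) = True"
| "presup_stmt \<Gamma> (HasType t T) = derivable TT (\<Gamma> \<turnstile> IsType T)"
| "presup_stmt \<Gamma> (TypeEq T T') = (derivable TT (\<Gamma> \<turnstile> IsType T) \<and> derivable TT (\<Gamma> \<turnstile> IsType T'))"
| "presup_stmt \<Gamma> (TermEq t t' T) = (derivable TT (\<Gamma> \<turnstile> IsType T) \<and>
     derivable TT (\<Gamma> \<turnstile> HasType t T) \<and> derivable TT (\<Gamma> \<turnstile> HasType t' T))"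

primrec presup where
  "presup (Ctx \<Gamma>) = wf_ctx TT \<Gamma>"
| "presup (\<Gamma> \<turnstile> K) = (wf_ctx TT \<Gamma> \<and> presup_stmt \<Gamma> K)"

text \<open>The contexts obtained from \<open>\<Delta>\<close> by substituting \<open>t\<close> and \<open>u\<close> have equal types, by the congruence rule for
  types applied to each entry. Converting the variables along these equations turns the substitution of
  \<open>u\<close> into a substitution over the context built with \<open>t\<close>.\<close>

lemma subst1_second:
  assumes wf: "wf_ctx TT (\<Gamma> @ (x, T) # \<Delta>)" and eq: "derivable TT (\<Gamma> \<turnstile> TermEq t u T)"
    and t: "derivable TT (\<Gamma> \<turnstile> HasType t T)" and u: "derivable TT (\<Gamma> \<turnstile> HasType u T)"
    and K: "derivable TT (\<Gamma> @ (x, T) # \<Delta> \<turnstile> K)"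
  shows "derivable TT (\<Gamma> @ subst1_ctx t x \<Delta> \<turnstile> map_stmt (subst1 u x) K)"
proof -
  let ?\<Theta> = "\<Gamma> @ subst1_ctx t x \<Delta>"
  have \<Theta>: "wf_ctx TT ?\<Theta>" by (rule wf_ctx_subst1[OF t wf])
  have sc: "scoped {} (\<Gamma> @ (x, T) # \<Delta>)" by (rule wf_ctx_scoped[OF wf])
  then have x: "x \<notin> fv_ctx \<Gamma>" "x \<notin> fv_ctx \<Delta>" "x \<notin> fv T"
    using scoped_distinct[of "insert x (fv_ctx \<Gamma>)" \<Delta>] by (auto simp: scoped_append)
  have "ctx_subst TT ?\<Theta> (\<Gamma> @ (x, T) # \<Delta>) (Var(x := u))"
    unfolding ctx_subst_def
  proof (clarify)
    fix y S assume "(y, S) \<in> set (\<Gamma> @ (x, T) # \<Delta>)"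
    then consider "(y, S) \<in> set \<Gamma>" | "y = x" "S = T" | "(y, S) \<in> set \<Delta>" by auto
    then show "derivable TT (?\<Theta> \<turnstile> HasType ((Var(x := u)) y) (subst (Var(x := u)) S))"
    proof cases
      case 1
      then have "x \<notin> fv S" "y \<noteq> x" using wf_ctx_fv[OF wf_ctx_mid(1)[OF wf] 1] x(1) by force+
      then show ?thesis
        using wf_ctx_var[OF \<Theta>, of y S] 1 subst1_id[of x S u] by (simp add: subst1_def)
    next
      case 2
      then show ?thesis using weaken_right[OF \<Theta> u] subst1_id[OF x(3), of u] by (simp add: subst1_def)
    next
      case 3
      then obtain \<Delta>1 \<Delta>2 where \<Delta>: "\<Delta> = \<Delta>1 @ (y, S) # \<Delta>2" by (metis in_set_conv_decomp)
      have "derivable TT (\<Gamma> @ [(x, T)] @ \<Delta>1 \<turnstile> IsType S)"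
        using wf_ctx_mid(2)[of TT "\<Gamma> @ (x, T) # \<Delta>1" y S \<Delta>2] wf by (simp add: \<Delta>)
      then have "derivable TT (\<Gamma> @ subst1_ctx t x \<Delta>1 \<turnstile> TypeEq (subst1 t x S) (subst1 u x S))"
        by (rule type_cong[OF eq])
      then have "derivable TT (?\<Theta> \<turnstile> TypeEq (subst1 t x S) (subst1 u x S))"
        using weaken_right[of TT "\<Gamma> @ subst1_ctx t x \<Delta>1" "subst1_ctx t x ((y, S) # \<Delta>2)"] \<Theta>
        by (simp add: \<Delta> subst1_ctx_simps)
      moreover have "derivable TT (?\<Theta> \<turnstile> HasType (Var y) (subst1 t x S))"
        by (rule wf_ctx_var[OF \<Theta>]) (simp add: \<Delta> subst1_ctx_simps)
      moreover have "y \<noteq> x" using x(2) 3 by force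
      ultimately show ?thesis using conv_term by (simp add: subst1_def)
    qed
  qed
  from subst_lemma[OF \<Theta> wf K this] show ?thesis by (simp add: subst1_def[abs_def])
qed

text \<open>The parts of a judgment are derivable along with it. The congruence rules are the cases that need an
  argument: their conclusions mention \<open>u\<close> over a context in which \<open>t\<close> has been substituted.\<close>

lemma derivable_presup: "derivable TT J \<Longrightarrow> presup J"
proof (induction rule: derivable.induct)
  case (ctx_rename \<Gamma> \<pi>)
  then show ?case using wf_ctx_rename(1)[of \<Gamma> \<pi>] permutes_inj_on[of \<pi>] by simp
next
  case (stmt_rename \<Gamma> K \<pi>)
  have "wf_ctx TT (rename_ctx \<pi> \<Gamma>)"
    using stmt_rename wf_ctx_rename(1)[of \<Gamma> \<pi>] permutes_inj_on[of \<pi>] by simp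
  moreover have "derivable TT (rename_ctx \<pi> \<Gamma> \<turnstile> map_stmt (rename \<pi>) K')" if "derivable TT (\<Gamma> \<turnstile> K')" for K'
    using derivable.stmt_rename[OF that stmt_rename(2)] .
  note this[of "IsType _", simplified] this[of "HasType _ _", simplified]
  ultimately show ?case using stmt_rename by (cases K) simp_all
next
  case (var_intro \<Gamma> T x)
  then show ?case using weakening[of TT \<Gamma> T "[]" "IsType T" x] by (simp add: wf_ctx_snoc_iff)
next
  case (weakening \<Gamma> T \<Delta> K x)
  have "wf_ctx TT (\<Gamma> @ [(x, T)] @ \<Delta>)" using wf_ctx_weaken[of TT \<Gamma> T \<Delta> x] weakening by simp
  moreover note derivable.weakening[OF weakening(1) _ weakening(3), of "IsType _"]
    derivable.weakening[OF weakening(1) _ weakening(3), of "HasType _ _"]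
  ultimately show ?case using weakening by (cases K) simp_all
next
  case (substitution \<Gamma> t T x \<Delta> K)
  have "wf_ctx TT (\<Gamma> @ subst1_ctx t x \<Delta>)" using wf_ctx_subst1[of TT \<Gamma> t T x \<Delta>] substitution by simp
  moreover note derivable.substitution[OF substitution(1), of x \<Delta> "IsType _", simplified]
    derivable.substitution[OF substitution(1), of x \<Delta> "HasType _ _", simplified]
  ultimately show ?case using substitution by (cases K) simp_all
next
  case (type_cong \<Gamma> t u T x \<Delta> T')
  have wf: "wf_ctx TT (\<Gamma> @ (x, T) # \<Delta>)" and t: "derivable TT (\<Gamma> \<turnstile> HasType t T)"
    and u: "derivable TT (\<Gamma> \<turnstile> HasType u T)"
    and T': "derivable TT (\<Gamma> @ (x, T) # \<Delta> \<turnstile> IsType T')" using type_cong by simp_all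
  show ?case
    using wf_ctx_subst1[OF t wf] derivable.substitution[OF t type_cong(2)]
      subst1_second[OF wf type_cong(1) t u T'] by simp
next
  case (term_cong \<Gamma> t u T x \<Delta> t' T')
  have wf: "wf_ctx TT (\<Gamma> @ (x, T) # \<Delta>)" and t: "derivable TT (\<Gamma> \<turnstile> HasType t T)"
    and u: "derivable TT (\<Gamma> \<turnstile> HasType u T)"
    and T': "derivable TT (\<Gamma> @ [(x, T)] @ \<Delta> \<turnstile> IsType T')"
    and t': "derivable TT (\<Gamma> @ (x, T) # \<Delta> \<turnstile> HasType t' T')" using term_cong by simp_all
  have "derivable TT (\<Gamma> @ subst1_ctx t x \<Delta> \<turnstile> TypeEq (subst1 t x T') (subst1 u x T'))"
    by (rule type_cong[OF term_cong(1) T'])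
  then have "derivable TT (\<Gamma> @ subst1_ctx t x \<Delta> \<turnstile> HasType (subst1 u x t') (subst1 t x T'))"
    using conv_term[OF type_sym] subst1_second[OF wf term_cong(1) t u t'] by simp
  then show ?case
    using wf_ctx_subst1[OF t wf] derivable.substitution[OF t T'] derivable.substitution[OF t term_cong(2)]
    by simp
qed (auto simp: sort_judgment_def op_judgment_def wf_ctx_snoc_iff wf_Nil intro: conv_term)

lemma derivable_wf: "derivable TT (\<Gamma> \<turnstile> K) \<Longrightarrow> wf_ctx TT \<Gamma>"
  using derivable_presup by fastforce

lemma ctx_iff_wf: "derivable TT (Ctx \<Gamma>) \<longleftrightarrow> wf_ctx TT \<Gamma>"
  using derivable_presup wf_ctx_derivable by fastforce

lemma HasType_presup: "derivable TT (\<Gamma> \<turnstile> HasType t T) \<Longrightarrow> derivable TT (\<Gamma> \<turnstile> IsType T)"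
  using derivable_presup by fastforce

lemma TermEq_presup:
  assumes "derivable TT (\<Gamma> \<turnstile> TermEq t u T)"
  shows "derivable TT (\<Gamma> \<turnstile> HasType t T)" "derivable TT (\<Gamma> \<turnstile> HasType u T)"
  using derivable_presup[OF assms] by simp_all

end

subsection \<open>Congruence\<close>

definition ctx_subst_eq ::
  "('v, 'a, 'f) theory_data \<Rightarrow> ('v, 'a, 'f) precontext \<Rightarrow> ('v, 'a, 'f) precontext \<Rightarrow>
     ('v \<Rightarrow> ('v, 'a, 'f) expr) \<Rightarrow> ('v \<Rightarrow> ('v, 'a, 'f) expr) \<Rightarrow> bool" where
  "ctx_subst_eq TT \<Theta> \<Gamma> \<sigma> \<tau> \<longleftrightarrow>
     (\<forall>(y, S) \<in> set \<Gamma>. derivable TT (\<Theta> \<turnstile> TermEq (\<sigma> y) (\<tau> y) (subst \<sigma> S)))"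

lemma ctx_subst_eqD: "ctx_subst_eq TT \<Theta> \<Gamma> \<sigma> \<tau> \<Longrightarrow> (y, S) \<in> set \<Gamma> \<Longrightarrow>
    derivable TT (\<Theta> \<turnstile> TermEq (\<sigma> y) (\<tau> y) (subst \<sigma> S))"
  unfolding ctx_subst_eq_def by blast

lemma ctx_subst_eq_cong:
  assumes "wf_ctx TT \<Gamma>" "\<And>y. y \<in> fv_ctx \<Gamma> \<Longrightarrow> \<sigma> y = \<sigma>' y" "\<And>y. y \<in> fv_ctx \<Gamma> \<Longrightarrow> \<tau> y = \<tau>' y"
    "ctx_subst_eq TT \<Theta> \<Gamma> \<sigma> \<tau>"
  shows "ctx_subst_eq TT \<Theta> \<Gamma> \<sigma>' \<tau>'"
  unfolding ctx_subst_eq_def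
proof (clarify)
  fix y S assume yS: "(y, S) \<in> set \<Gamma>"
  have "subst \<sigma> S = subst \<sigma>' S" by (rule subst_cong) (use wf_ctx_fv[OF assms(1) yS] assms(2) in blast)
  moreover have "\<sigma> y = \<sigma>' y" "\<tau> y = \<tau>' y" using assms(2,3) yS by force+
  ultimately show "derivable TT (\<Theta> \<turnstile> TermEq (\<sigma>' y) (\<tau>' y) (subst \<sigma>' S))"
    using ctx_subst_eqD[OF assms(4) yS] by simp
qed

lemma wf_ctx_weaken_left:
  assumes "wf_ctx TT \<Theta>" "wf_ctx TT \<Gamma>" "fv_ctx \<Theta> \<inter> fv_ctx \<Gamma> = {}"
  shows "wf_ctx TT (\<Theta> @ \<Gamma>)"
  using assms(2,3)
proof (induction rule: wf_ctx.induct)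
  case wf_Nil then show ?case using assms(1) by simp
next
  case (wf_snoc \<Gamma> T x)
  then have "wf_ctx TT ((\<Theta> @ \<Gamma>) @ [(x, T)])"
    unfolding wf_ctx_snoc_iff using weaken_left[OF assms(1) wf_snoc(2)] by auto
  then show ?case by simp
qed

context infinite_variables
begin

lemma ctx_subst_eq_left:
  assumes "ctx_subst_eq TT \<Theta> \<Gamma> \<sigma> \<tau>" shows "ctx_subst TT \<Theta> \<Gamma> \<sigma>"
  unfolding ctx_subst_def using TermEq_presup(1)[OF ctx_subst_eqD[OF assms]] by blast

text \<open>As for substitution, variables are replaced one after the other. After the first variable
  \<open>x\<close>, the types of the remaining telescope change from their \<open>\<sigma> x\<close>- to their \<open>\<tau> x\<close>-instances; the
  equation between the two that is needed for the conversion is the first step again, applied to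
  an initial segment.\<close>

lemma cong_telescope:
  assumes "wf_ctx TT (\<Theta> @ \<Gamma>)"
    and "\<And>y. y \<in> fv_ctx \<Theta> \<Longrightarrow> \<sigma> y = Var y" "\<And>y. y \<in> fv_ctx \<Theta> \<Longrightarrow> \<tau> y = Var y"
    and "ctx_subst_eq TT \<Theta> \<Gamma> \<sigma> \<tau>"
  shows "(\<forall>T. derivable TT (\<Theta> @ \<Gamma> \<turnstile> IsType T) \<longrightarrow> derivable TT (\<Theta> \<turnstile> TypeEq (subst \<sigma> T) (subst \<tau> T))) \<and>
    (\<forall>e T. derivable TT (\<Theta> @ \<Gamma> \<turnstile> HasType e T) \<longrightarrow>
      derivable TT (\<Theta> \<turnstile> TermEq (subst \<sigma> e) (subst \<tau> e) (subst \<sigma> T)))"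
  using assms
proof (induction "length \<Gamma>" arbitrary: \<Gamma>)
  case 0
  have id: "subst \<sigma> e' = e'" "subst \<tau> e' = e'" if "fv e' \<subseteq> fv_ctx \<Theta>" for e'
    using that 0(3,4) by (blast intro: subst_id)+
  have "derivable TT (\<Theta> \<turnstile> TypeEq (subst \<sigma> T) (subst \<tau> T))" if "derivable TT (\<Theta> \<turnstile> IsType T)" for T
    using id[of T] derivable_fv[OF that, of T] type_refl[OF that] by simp
  moreover have "derivable TT (\<Theta> \<turnstile> TermEq (subst \<sigma> e) (subst \<tau> e) (subst \<sigma> T))"
    if "derivable TT (\<Theta> \<turnstile> HasType e T)" for e T
    using id[of e] id[of T] derivable_fv[OF that, of e] derivable_fv[OF that, of T] term_refl[OF that]
    by simp
  ultimately show ?case using 0(1) by simp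
next
  case (Suc n)
  obtain x T0 \<Gamma>1 where \<Gamma>: "\<Gamma> = (x, T0) # \<Gamma>1" using Suc(2) by (metis length_Suc_conv surj_pair)
  define t u where "t = \<sigma> x" and "u = \<tau> x"
  have sc: "scoped {} (\<Theta> @ (x, T0) # \<Gamma>1)"
    using wf_ctx_scoped Suc.prems(1) unfolding \<Gamma> by blast
  have "fv T0 \<subseteq> fv_ctx \<Theta>" using sc by (simp add: scoped_append)
  then have "subst \<sigma> T0 = T0" by (intro subst_id Suc.prems(2)) blast
  then have tu: "derivable TT (\<Theta> \<turnstile> TermEq t u T0)"
    using ctx_subst_eqD[OF Suc.prems(4), of x T0] by (simp add: \<Gamma> t_def u_def)
  note tT = TermEq_presup(1)[OF tu] and uT = TermEq_presup(2)[OF tu]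
  have t: "subst \<sigma> t = t"
    using derivable_fv[OF tT, of t] by (intro subst_id Suc.prems(2)) auto
  have u: "subst \<tau> u = u"
    using derivable_fv[OF uT, of u] by (intro subst_id Suc.prems(3)) auto
  have \<sigma>t: "subst \<sigma> (subst1 t x e') = subst \<sigma> e'" for e'
    unfolding subst_subst1 t by (simp add: t_def)
  have \<tau>u: "subst \<tau> (subst1 u x e') = subst \<tau> e'" for e'
    unfolding subst_subst1 u by (simp add: u_def)
  have sub: "ctx_subst TT \<Theta> (subst1_ctx t x \<Gamma>a) \<sigma>" if "set \<Gamma>a \<subseteq> set \<Gamma>1" for \<Gamma>a
    unfolding ctx_subst_def
  proof (clarify)
    fix y S' assume "(y, S') \<in> set (subst1_ctx t x \<Gamma>a)"
    then obtain S where S: "(y, S) \<in> set \<Gamma>a" "S' = subst1 t x S" by (auto simp: subst1_ctx_def)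
    then have "(y, S) \<in> set \<Gamma>" using that by (auto simp: \<Gamma>)
    from ctx_substD[OF ctx_subst_eq_left[OF Suc.prems(4)] this]
    show "derivable TT (\<Theta> \<turnstile> HasType (\<sigma> y) (subst \<sigma> S'))" by (simp add: S(2) \<sigma>t)
  qed
  have first: "derivable TT (\<Theta> \<turnstile> TypeEq (subst \<sigma> S) (subst \<sigma> (subst1 u x S)))"
    if S: "derivable TT (\<Theta> @ [(x, T0)] @ \<Gamma>a \<turnstile> IsType S)" and a: "set \<Gamma>a \<subseteq> set \<Gamma>1" for S \<Gamma>a
    using subst_telescope[OF type_cong[OF tu S] Suc.prems(2) sub[OF a]] \<sigma>t by simp
  have wf1: "wf_ctx TT (\<Theta> @ subst1_ctx u x \<Gamma>1)"
    by (rule wf_ctx_subst1[OF uT]) (use Suc.prems(1) in \<open>simp add: \<Gamma>\<close>)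
  have eq1: "ctx_subst_eq TT \<Theta> (subst1_ctx u x \<Gamma>1) \<sigma> \<tau>"
    unfolding ctx_subst_eq_def
  proof (clarify)
    fix y S' assume "(y, S') \<in> set (subst1_ctx u x \<Gamma>1)"
    then obtain S where S: "(y, S) \<in> set \<Gamma>1" "S' = subst1 u x S" by (auto simp: subst1_ctx_def)
    then obtain \<Gamma>a \<Gamma>b where ab: "\<Gamma>1 = \<Gamma>a @ (y, S) # \<Gamma>b" by (metis in_set_conv_decomp)
    have "derivable TT (\<Theta> @ [(x, T0)] @ \<Gamma>a \<turnstile> IsType S)"
      using wf_ctx_mid(2)[of TT "\<Theta> @ (x, T0) # \<Gamma>a" y S \<Gamma>b] Suc.prems(1) by (simp add: \<Gamma> ab)
    then have "derivable TT (\<Theta> \<turnstile> TypeEq (subst \<sigma> S) (subst \<sigma> S'))"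
      unfolding S(2) by (rule first) (auto simp: ab)
    then show "derivable TT (\<Theta> \<turnstile> TermEq (\<sigma> y) (\<tau> y) (subst \<sigma> S'))"
      by (rule conv_term_eq) (rule ctx_subst_eqD[OF Suc.prems(4)], use S in \<open>simp add: \<Gamma>\<close>)
  qed
  have n: "n = length (subst1_ctx u x \<Gamma>1)" using Suc(2) by (simp add: \<Gamma> subst1_ctx_simps)
  note IH = Suc.hyps(1)[OF n wf1 Suc.prems(2,3) eq1]
  have types: "derivable TT (\<Theta> \<turnstile> TypeEq (subst \<sigma> T) (subst \<tau> T))"
    if T: "derivable TT (\<Theta> @ [(x, T0)] @ \<Gamma>1 \<turnstile> IsType T)" for T
  proof -
    have "derivable TT (\<Theta> \<turnstile> TypeEq (subst \<sigma> (subst1 u x T)) (subst \<tau> T))"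
      using IH substitution[OF uT T] \<tau>u by (metis stmt.map(1))
    then show ?thesis using first[OF T] type_trans by blast
  qed
  have terms: "derivable TT (\<Theta> \<turnstile> TermEq (subst \<sigma> e) (subst \<tau> e) (subst \<sigma> T))"
    if e: "derivable TT (\<Theta> @ [(x, T0)] @ \<Gamma>1 \<turnstile> HasType e T)" for e T
  proof -
    have "derivable TT (\<Theta> \<turnstile> TermEq (subst \<sigma> (subst1 u x e)) (subst \<tau> e) (subst \<sigma> (subst1 u x T)))"
      using IH substitution[OF uT e] \<tau>u by (metis stmt.map(2))
    then have "derivable TT (\<Theta> \<turnstile> TermEq (subst \<sigma> (subst1 u x e)) (subst \<tau> e) (subst \<sigma> T))"
      by (rule conv_term_eq[OF type_sym[OF first[OF HasType_presup[OF e]]], rotated]) simp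
    moreover have "derivable TT (\<Theta> \<turnstile> TermEq (subst \<sigma> e) (subst \<sigma> (subst1 u x e)) (subst \<sigma> T))"
      using subst_telescope[OF term_cong[OF tu e] Suc.prems(2) sub[OF subset_refl]] \<sigma>t by simp
    ultimately show ?thesis using term_trans by blast
  qed
  show ?case using types terms by (simp add: \<Gamma>)
qed

text \<open>Reduced to the telescope version by renaming \<open>\<Gamma>\<close> apart from \<open>\<Theta>\<close>; \<open>pull\<close> undoes the renaming.\<close>

lemma cong_lemma:
  assumes \<Theta>: "wf_ctx TT \<Theta>" and \<Gamma>: "wf_ctx TT \<Gamma>" and eq: "ctx_subst_eq TT \<Theta> \<Gamma> \<sigma> \<tau>"
  shows "derivable TT (\<Gamma> \<turnstile> IsType T) \<Longrightarrow> derivable TT (\<Theta> \<turnstile> TypeEq (subst \<sigma> T) (subst \<tau> T))"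
    and "derivable TT (\<Gamma> \<turnstile> HasType e T) \<Longrightarrow>
      derivable TT (\<Theta> \<turnstile> TermEq (subst \<sigma> e) (subst \<tau> e) (subst \<sigma> T))"
proof -
  obtain \<pi> where inj: "inj_on \<pi> (fv_ctx \<Gamma>)" and fresh: "\<pi> ` fv_ctx \<Gamma> \<inter> fv_ctx \<Theta> = {}"
    using fresh_renaming[OF inf, of "fv_ctx \<Gamma>" "fv_ctx \<Theta>"] by auto
  let ?\<rho> = "\<lambda>y. Var (\<pi> y)" and ?\<Gamma> = "rename_ctx \<pi> \<Gamma>"
  note r = wf_ctx_rename[OF \<Gamma> inj]
  have disj: "fv_ctx \<Theta> \<inter> fv_ctx ?\<Gamma> = {}" using fresh unfolding set_map fv_ctx_rename by blast
  have wf: "wf_ctx TT (\<Theta> @ ?\<Gamma>)" by (rule wf_ctx_weaken_left[OF \<Theta> r(1) disj])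
  define pull where "pull \<sigma> z = (if z \<in> fv_ctx ?\<Gamma> then \<sigma> (inv_into (fv_ctx \<Gamma>) \<pi> z) else Var z)"
    for \<sigma> :: "'v \<Rightarrow> ('v, 'a, 'f) expr" and z
  have pull_id: "pull \<sigma> z = Var z" if "z \<in> fv_ctx \<Theta>" for \<sigma> z
    using that disj by (auto simp: pull_def)
  have pull: "pull \<sigma> (\<pi> y) = \<sigma> y" if "y \<in> fv_ctx \<Gamma>" for \<sigma> y
    using that inv_into_f_f[OF inj that] by (auto simp: pull_def fv_ctx_rename)
  have pull_subst: "subst (pull \<sigma>) (subst ?\<rho> e) = subst \<sigma> e" if "fv e \<subseteq> fv_ctx \<Gamma>" for e \<sigma>
    unfolding subst_subst by (rule subst_cong) (use that pull in auto)
  have eq': "ctx_subst_eq TT \<Theta> ?\<Gamma> (pull \<sigma>) (pull \<tau>)"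
    unfolding ctx_subst_eq_def
  proof (clarify)
    fix z S' assume "(z, S') \<in> set ?\<Gamma>"
    then obtain y S where yS: "(y, S) \<in> set \<Gamma>" "z = \<pi> y" "S' = subst ?\<rho> S"
      by (auto simp: rename_ctx_def rename_eq_subst)
    have "y \<in> fv_ctx \<Gamma>" using yS(1) by force
    then show "derivable TT (\<Theta> \<turnstile> TermEq (pull \<sigma> z) (pull \<tau> z) (subst (pull \<sigma>) S'))"
      using ctx_subst_eqD[OF eq yS(1)] pull pull_subst[OF wf_ctx_fv[OF \<Gamma> yS(1)]] yS(2,3) by simp
  qed
  note c = cong_telescope[OF wf pull_id pull_id eq']
  have sub: "ctx_subst TT (\<Theta> @ ?\<Gamma>) \<Gamma> ?\<rho>"
    using r(2) weaken_left[OF \<Theta> _ disj] unfolding ctx_subst_def by blast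
  show "derivable TT (\<Theta> \<turnstile> TypeEq (subst \<sigma> T) (subst \<tau> T))" if T: "derivable TT (\<Gamma> \<turnstile> IsType T)"
  proof -
    have "derivable TT (\<Theta> @ ?\<Gamma> \<turnstile> IsType (subst ?\<rho> T))"
      using subst_lemma[OF wf \<Gamma> T sub] by simp
    with conjunct1[OF c]
    have "derivable TT (\<Theta> \<turnstile> TypeEq (subst (pull \<sigma>) (subst ?\<rho> T)) (subst (pull \<tau>) (subst ?\<rho> T)))"
      by blast
    then show ?thesis using pull_subst[of T] derivable_fv[OF T, of T] by simp
  qed
  show "derivable TT (\<Theta> \<turnstile> TermEq (subst \<sigma> e) (subst \<tau> e) (subst \<sigma> T))"
    if e: "derivable TT (\<Gamma> \<turnstile> HasType e T)"
  proof -
    have "derivable TT (\<Theta> @ ?\<Gamma> \<turnstile> HasType (subst ?\<rho> e) (subst ?\<rho> T))"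
      using subst_lemma[OF wf \<Gamma> e sub] by simp
    with conjunct2[OF c] have "derivable TT (\<Theta> \<turnstile> TermEq (subst (pull \<sigma>) (subst ?\<rho> e))
        (subst (pull \<tau>) (subst ?\<rho> e)) (subst (pull \<sigma>) (subst ?\<rho> T)))" by blast
    then show ?thesis
      using pull_subst[of e] pull_subst[of T] derivable_fv[OF e, of e] derivable_fv[OF e, of T] by simp
  qed
qed

lemma ctx_subst_eq_conv:
  assumes "wf_ctx TT \<Theta>" "wf_ctx TT (\<Gamma> @ (y, S) # \<Delta>)" "ctx_subst_eq TT \<Theta> (\<Gamma> @ (y, S) # \<Delta>) \<sigma> \<tau>"
  shows "derivable TT (\<Theta> \<turnstile> TypeEq (subst \<sigma> S) (subst \<tau> S))"
proof (rule cong_lemma(1)[OF assms(1) wf_ctx_mid(1)[OF assms(2)] _ wf_ctx_mid(2)[OF assms(2)]])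
  show "ctx_subst_eq TT \<Theta> \<Gamma> \<sigma> \<tau>" using assms(3) by (simp add: ctx_subst_eq_def)
qed

lemma ctx_subst_eq_type:
  assumes "wf_ctx TT \<Theta>" "wf_ctx TT \<Gamma>" "ctx_subst_eq TT \<Theta> \<Gamma> \<sigma> \<tau>" "(y, S) \<in> set \<Gamma>"
  shows "derivable TT (\<Theta> \<turnstile> TypeEq (subst \<sigma> S) (subst \<tau> S))"
proof -
  obtain \<Gamma>1 \<Gamma>2 where "\<Gamma> = \<Gamma>1 @ (y, S) # \<Gamma>2" using assms(4) by (metis in_set_conv_decomp)
  then show ?thesis using ctx_subst_eq_conv assms by metis
qed

lemma ctx_subst_eq_right:
  assumes "wf_ctx TT \<Theta>" "wf_ctx TT \<Gamma>" "ctx_subst_eq TT \<Theta> \<Gamma> \<sigma> \<tau>"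
  shows "ctx_subst TT \<Theta> \<Gamma> \<tau>"
  unfolding ctx_subst_def
  using conv_term[OF ctx_subst_eq_type[OF assms] TermEq_presup(2)[OF ctx_subst_eqD[OF assms(3)]]] by blast

lemma ctx_subst_eq_refl: "ctx_subst TT \<Theta> \<Gamma> \<sigma> \<Longrightarrow> ctx_subst_eq TT \<Theta> \<Gamma> \<sigma> \<sigma>"
  unfolding ctx_subst_eq_def ctx_subst_def using term_refl by blast

lemma ctx_subst_eq_sym:
  assumes "wf_ctx TT \<Theta>" "wf_ctx TT \<Gamma>" "ctx_subst_eq TT \<Theta> \<Gamma> \<sigma> \<tau>"
  shows "ctx_subst_eq TT \<Theta> \<Gamma> \<tau> \<sigma>"
  using conv_term_eq[OF ctx_subst_eq_type[OF assms] term_sym[OF ctx_subst_eqD[OF assms(3)]]]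
  unfolding ctx_subst_eq_def[of TT \<Theta> \<Gamma> \<tau> \<sigma>] by blast

lemma ctx_subst_eq_trans:
  assumes \<Theta>: "wf_ctx TT \<Theta>" "wf_ctx TT \<Gamma>" and 1: "ctx_subst_eq TT \<Theta> \<Gamma> \<sigma> \<tau>"
    and 2: "ctx_subst_eq TT \<Theta> \<Gamma> \<tau> \<rho>"
  shows "ctx_subst_eq TT \<Theta> \<Gamma> \<sigma> \<rho>"
  unfolding ctx_subst_eq_def
proof (clarify)
  fix y S assume yS: "(y, S) \<in> set \<Gamma>"
  show "derivable TT (\<Theta> \<turnstile> TermEq (\<sigma> y) (\<rho> y) (subst \<sigma> S))"
    by (rule term_trans[OF ctx_subst_eqD[OF 1 yS]
          conv_term_eq[OF type_sym[OF ctx_subst_eq_type[OF \<Theta> 1 yS]] ctx_subst_eqD[OF 2 yS]]])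
qed

lemma ctx_subst_comp:
  assumes "wf_ctx TT \<Gamma>" "wf_ctx TT \<Delta>" "ctx_subst TT \<Gamma> \<Delta> \<sigma>" "ctx_subst TT \<Delta> \<Xi> \<tau>"
  shows "ctx_subst TT \<Gamma> \<Xi> (\<lambda>y. subst \<sigma> (\<tau> y))"
  unfolding ctx_subst_def
proof (clarify)
  fix y S assume "(y, S) \<in> set \<Xi>"
  from subst_lemma[OF assms(1,2) ctx_substD[OF assms(4) this] assms(3)]
  show "derivable TT (\<Gamma> \<turnstile> HasType (subst \<sigma> (\<tau> y)) (subst (\<lambda>y. subst \<sigma> (\<tau> y)) S))"
    by (simp add: subst_subst)
qed

lemma ctx_subst_eq_comp:
  assumes wf: "wf_ctx TT \<Gamma>" "wf_ctx TT \<Delta>" "wf_ctx TT \<Xi>"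
    and \<sigma>: "ctx_subst_eq TT \<Gamma> \<Delta> \<sigma> \<sigma>'" and \<tau>: "ctx_subst_eq TT \<Delta> \<Xi> \<tau> \<tau>'"
  shows "ctx_subst_eq TT \<Gamma> \<Xi> (\<lambda>y. subst \<sigma> (\<tau> y)) (\<lambda>y. subst \<sigma>' (\<tau>' y))"
proof (rule ctx_subst_eq_trans[OF wf(1,3)])
  show "ctx_subst_eq TT \<Gamma> \<Xi> (\<lambda>y. subst \<sigma> (\<tau> y)) (\<lambda>y. subst \<sigma> (\<tau>' y))"
    unfolding ctx_subst_eq_def
  proof (clarify)
    fix y S assume "(y, S) \<in> set \<Xi>"
    from subst_lemma[OF wf(1,2) ctx_subst_eqD[OF \<tau> this] ctx_subst_eq_left[OF \<sigma>]]
    show "derivable TT (\<Gamma> \<turnstile> TermEq (subst \<sigma> (\<tau> y)) (subst \<sigma> (\<tau>' y)) (subst (\<lambda>y. subst \<sigma> (\<tau> y)) S))"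
      by (simp add: subst_subst)
  qed
  show "ctx_subst_eq TT \<Gamma> \<Xi> (\<lambda>y. subst \<sigma> (\<tau>' y)) (\<lambda>y. subst \<sigma>' (\<tau>' y))"
    unfolding ctx_subst_eq_def
  proof (clarify)
    fix y S assume "(y, S) \<in> set \<Xi>"
    from cong_lemma(2)[OF wf(1,2) \<sigma> ctx_substD[OF ctx_subst_eq_right[OF wf(2,3) \<tau>] this]]
    show "derivable TT (\<Gamma> \<turnstile> TermEq (subst \<sigma> (\<tau>' y)) (subst \<sigma>' (\<tau>' y)) (subst (\<lambda>y. subst \<sigma> (\<tau>' y)) S))"
      by (simp add: subst_subst)
  qed
qed

lemma ctx_subst_Var:
  assumes "wf_ctx TT (\<Gamma> @ \<Delta>)" shows "ctx_subst TT (\<Gamma> @ \<Delta>) \<Gamma> Var"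
  unfolding ctx_subst_def using wf_ctx_var[OF assms] by (auto simp: subst_Var)

end

subsection \<open>Generation\<close>

locale gat_syntax = infinite_variables TT + set_universe elts
  for TT :: "('v, 'a, 'f) theory_data" and elts :: "'u \<Rightarrow> 'u set" +
  assumes gat: "gat elts TT"
begin

definition sort_app where
  "sort_app A \<sigma> = App (Inl A) (map \<sigma> (vars (sort_ctx TT A)))"

definition op_app where
  "op_app f \<sigma> = App (Inr f) (map \<sigma> (vars (op_ctx TT f)))"

lemma sort_judgment: "A \<in> sorts TT \<Longrightarrow> derivable TT (sort_ctx TT A \<turnstile> IsType (sort_app A Var))"
  using gat by (simp add: gat_def sort_judgment_def sort_app_def)

lemma op_judgment: "f \<in> ops TT \<Longrightarrow> derivable TT (op_ctx TT f \<turnstile> HasType (op_app f Var) (op_type TT f))"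
  using gat by (simp add: gat_def op_judgment_def op_app_def)

lemma wf_sort_ctx: "A \<in> sorts TT \<Longrightarrow> wf_ctx TT (sort_ctx TT A)"
  using derivable_wf[OF sort_judgment] .

lemma wf_op_ctx: "f \<in> ops TT \<Longrightarrow> wf_ctx TT (op_ctx TT f)"
  using derivable_wf[OF op_judgment] .

lemma subst_sort_app: "subst \<rho> (sort_app A \<sigma>) = sort_app A (\<lambda>y. subst \<rho> (\<sigma> y))"
  by (simp add: sort_app_def)

lemma subst_op_app: "subst \<rho> (op_app f \<sigma>) = op_app f (\<lambda>y. subst \<rho> (\<sigma> y))"
  by (simp add: op_app_def)

lemma sort_app_inject:
  "sort_app A \<sigma> = sort_app B \<tau> \<longleftrightarrow> A = B \<and> (\<forall>y \<in> fv_ctx (sort_ctx TT A). \<sigma> y = \<tau> y)"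
proof (cases "A = B")
  case True
  then show ?thesis by (simp only: sort_app_def expr.inject map_eq_conv simp_thms)
qed (simp add: sort_app_def)

text \<open>What a derivation reveals about the outermost symbol of a type, of a term and of both sides of a type
  equation. As there are no type equality axioms, equal types have the same sort symbol.\<close>

primrec generated_stmt where
  "generated_stmt \<Gamma> (IsType T) \<longleftrightarrow>
     (\<exists>A \<sigma>. A \<in> sorts TT \<and> T = sort_app A \<sigma> \<and> ctx_subst TT \<Gamma> (sort_ctx TT A) \<sigma>)"
| "generated_stmt \<Gamma> (HasType t T) \<longleftrightarrow>
     (\<exists>y S. t = Var y \<and> (y, S) \<in> set \<Gamma> \<and> derivable TT (\<Gamma> \<turnstile> TypeEq S T)) \<or>
     (\<exists>f \<sigma>. f \<in> ops TT \<and> t = op_app f \<sigma> \<and> ctx_subst TT \<Gamma> (op_ctx TT f) \<sigma> \<and>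
        derivable TT (\<Gamma> \<turnstile> TypeEq (subst \<sigma> (op_type TT f)) T))"
| "generated_stmt \<Gamma> (TypeEq T T') \<longleftrightarrow>
     (\<exists>A \<sigma> \<tau>. A \<in> sorts TT \<and> T = sort_app A \<sigma> \<and> T' = sort_app A \<tau> \<and>
        ctx_subst_eq TT \<Gamma> (sort_ctx TT A) \<sigma> \<tau>)"
| "generated_stmt \<Gamma> (TermEq t t' T) \<longleftrightarrow> True"

primrec generated_judgment where
  "generated_judgment (Ctx \<Gamma>) \<longleftrightarrow> True"
| "generated_judgment (\<Gamma> \<turnstile> K) \<longleftrightarrow> generated_stmt \<Gamma> K"

lemma generated_conv:
  "generated_stmt \<Gamma> (HasType t T) \<Longrightarrow> derivable TT (\<Gamma> \<turnstile> TypeEq T T') \<Longrightarrow> generated_stmt \<Gamma> (HasType t T')"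
  unfolding generated_stmt.simps using type_trans by blast

lemma ctx_subst_transport:
  assumes D: "\<And>K. derivable TT (\<Gamma> \<turnstile> K) \<Longrightarrow> derivable TT (\<Theta> \<turnstile> map_stmt (subst \<rho>) K)"
    and \<sigma>: "ctx_subst TT \<Gamma> \<Xi> \<sigma>"
  shows "ctx_subst TT \<Theta> \<Xi> (\<lambda>y. subst \<rho> (\<sigma> y))"
  unfolding ctx_subst_def using D[OF ctx_substD[OF \<sigma>]] by (auto simp: subst_subst)

lemma ctx_subst_eq_transport:
  assumes D: "\<And>K. derivable TT (\<Gamma> \<turnstile> K) \<Longrightarrow> derivable TT (\<Theta> \<turnstile> map_stmt (subst \<rho>) K)"
    and \<sigma>: "ctx_subst_eq TT \<Gamma> \<Xi> \<sigma> \<tau>"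
  shows "ctx_subst_eq TT \<Theta> \<Xi> (\<lambda>y. subst \<rho> (\<sigma> y)) (\<lambda>y. subst \<rho> (\<tau> y))"
  unfolding ctx_subst_eq_def using D[OF ctx_subst_eqD[OF \<sigma>]] by (auto simp: subst_subst)

text \<open>The rules that move a judgment to another context, namely renaming, weakening and substitution, all act
  by a substitution \<open>\<rho>\<close> that preserves derivability. A variable is replaced by a term whose own generation
  has to be known, which is the assumption \<open>V\<close>.\<close>

lemma generated_transport:
  assumes D: "\<And>K. derivable TT (\<Gamma> \<turnstile> K) \<Longrightarrow> derivable TT (\<Theta> \<turnstile> map_stmt (subst \<rho>) K)"
    and V: "\<And>y S. (y, S) \<in> set \<Gamma> \<Longrightarrow> generated_stmt \<Theta> (HasType (\<rho> y) (subst \<rho> S))"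
    and K: "generated_stmt \<Gamma> K"
  shows "generated_stmt \<Theta> (map_stmt (subst \<rho>) K)"
proof (cases K)
  case (IsType T)
  then obtain A \<sigma> where A: "A \<in> sorts TT" "T = sort_app A \<sigma>" "ctx_subst TT \<Gamma> (sort_ctx TT A) \<sigma>"
    using K by auto
  then show ?thesis using ctx_subst_transport[OF D A(3)] IsType by (auto simp: subst_sort_app)
next
  case (TypeEq T T')
  then obtain A \<sigma> \<tau> where A: "A \<in> sorts TT" "T = sort_app A \<sigma>" "T' = sort_app A \<tau>"
    "ctx_subst_eq TT \<Gamma> (sort_ctx TT A) \<sigma> \<tau>" using K by auto
  then show ?thesis using ctx_subst_eq_transport[OF D A(4)] TypeEq by (auto simp: subst_sort_app)
next
  case (HasType t T)
  then consider y S where "t = Var y" "(y, S) \<in> set \<Gamma>" "derivable TT (\<Gamma> \<turnstile> TypeEq S T)"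
    | f \<sigma> where "f \<in> ops TT" "t = op_app f \<sigma>" "ctx_subst TT \<Gamma> (op_ctx TT f) \<sigma>"
        "derivable TT (\<Gamma> \<turnstile> TypeEq (subst \<sigma> (op_type TT f)) T)" using K by auto
  then have "generated_stmt \<Theta> (HasType (subst \<rho> t) (subst \<rho> T))"
  proof cases
    case 1
    have "derivable TT (\<Theta> \<turnstile> TypeEq (subst \<rho> S) (subst \<rho> T))" using D[OF 1(3)] by simp
    from generated_conv[OF V[OF 1(2)] this] show ?thesis using 1(1) by simp
  next
    case 2
    then show ?thesis
      using ctx_subst_transport[OF D 2(3)] D[OF 2(4)] by (auto simp: subst_op_app subst_subst)
  qed
  then show ?thesis using HasType by simp
qed simp

lemma generated_var:
  assumes "wf_ctx TT \<Gamma>" "(y, S) \<in> set \<Gamma>" shows "generated_stmt \<Gamma> (HasType (Var y) S)"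
  using type_refl[OF HasType_presup[OF wf_ctx_var[OF assms]]] assms(2) by auto

lemma map_stmt_subst_Var: "map_stmt (subst Var) K = K"
  by (simp add: subst_Var[abs_def] stmt.map_ident)

lemma generated_weaken_right:
  assumes "wf_ctx TT (\<Gamma> @ \<Delta>)" "generated_stmt \<Gamma> K"
  shows "generated_stmt (\<Gamma> @ \<Delta>) K"
  using generated_transport[of \<Gamma> "\<Gamma> @ \<Delta>" Var K] weaken_right[OF assms(1)] assms
    generated_var[OF assms(1)] by (simp add: map_stmt_subst_Var subst_Var)

lemma derivable_generated: "derivable TT J \<Longrightarrow> generated_judgment J"
proof (induction rule: derivable.induct)
  case (type_refl \<Gamma> T)
  then obtain A \<sigma> where "A \<in> sorts TT" "T = sort_app A \<sigma>" "ctx_subst TT \<Gamma> (sort_ctx TT A) \<sigma>" by auto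
  then show ?case using ctx_subst_eq_refl[of \<Gamma> "sort_ctx TT A" \<sigma>] by auto
next
  case (type_sym \<Gamma> T T')
  then obtain A \<sigma> \<tau> where A: "A \<in> sorts TT" "T = sort_app A \<sigma>" "T' = sort_app A \<tau>"
    "ctx_subst_eq TT \<Gamma> (sort_ctx TT A) \<sigma> \<tau>" by auto
  then show ?case using ctx_subst_eq_sym[OF derivable_wf[OF type_sym(1)] wf_sort_ctx A(4)] by auto
next
  case (type_trans \<Gamma> T T' T'')
  then obtain A \<sigma> \<tau> B \<tau>' \<rho> where A: "A \<in> sorts TT" "T = sort_app A \<sigma>" "T' = sort_app A \<tau>"
    "ctx_subst_eq TT \<Gamma> (sort_ctx TT A) \<sigma> \<tau>" and B: "T' = sort_app B \<tau>'" "T'' = sort_app B \<rho>"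
    "ctx_subst_eq TT \<Gamma> (sort_ctx TT B) \<tau>' \<rho>" by auto
  have BA: "B = A" "\<And>y. y \<in> fv_ctx (sort_ctx TT A) \<Longrightarrow> \<tau>' y = \<tau> y"
    using A(3) B(1) sort_app_inject[of A \<tau> B \<tau>'] by auto
  have "ctx_subst_eq TT \<Gamma> (sort_ctx TT A) \<tau> \<rho>"
    by (rule ctx_subst_eq_cong[OF wf_sort_ctx[OF A(1)] BA(2) refl]) (use B(3) BA(1) in auto)
  then have "ctx_subst_eq TT \<Gamma> (sort_ctx TT A) \<sigma> \<rho>"
    using ctx_subst_eq_trans[OF derivable_wf[OF type_trans(1)] wf_sort_ctx A(4)] A(1) by blast
  then show ?case using A B BA by auto
next
  case (conv_term \<Gamma> T T' t)
  then show ?case using generated_conv[of \<Gamma> t T T'] by simp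
next
  case (stmt_rename \<Gamma> K \<pi>)
  let ?\<rho> = "\<lambda>y. Var (\<pi> y)"
  have ren: "map_stmt (rename \<pi>) K = map_stmt (subst ?\<rho>) K" for K :: "('v, 'a, 'f) expr stmt"
    by (rule map_stmt_cong) (simp add: rename_eq_subst)
  have wf: "wf_ctx TT (rename_ctx \<pi> \<Gamma>)"
    using derivable_wf[OF derivable.stmt_rename[OF stmt_rename(1,2)]] .
  have "generated_stmt (rename_ctx \<pi> \<Gamma>) (map_stmt (subst ?\<rho>) K)"
  proof (rule generated_transport)
    show "derivable TT (rename_ctx \<pi> \<Gamma> \<turnstile> map_stmt (subst ?\<rho>) K)" if "derivable TT (\<Gamma> \<turnstile> K)" for K
      using derivable.stmt_rename[OF that stmt_rename(2)] unfolding ren .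
    show "generated_stmt (rename_ctx \<pi> \<Gamma>) (HasType (Var (\<pi> y)) (subst ?\<rho> S))"
      if "(y, S) \<in> set \<Gamma>" for y S
      by (rule generated_var[OF wf]) (use that in \<open>force simp: rename_ctx_def rename_eq_subst\<close>)
  qed (use stmt_rename in simp)
  then show ?case unfolding ren by simp
next
  case (var_intro \<Gamma> T x)
  then show ?case using generated_var[OF derivable_wf[OF derivable.var_intro[OF var_intro(1,2)]], of x T]
    by simp
next
  case (weakening \<Gamma> T \<Delta> K x)
  have wf: "wf_ctx TT (\<Gamma> @ [(x, T)] @ \<Delta>)"
    using derivable_wf[OF derivable.weakening[OF weakening(1,2,3)]] .
  have "generated_stmt (\<Gamma> @ [(x, T)] @ \<Delta>) (map_stmt (subst Var) K)"
  proof (rule generated_transport)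
    show "derivable TT (\<Gamma> @ [(x, T)] @ \<Delta> \<turnstile> map_stmt (subst Var) K)" if "derivable TT (\<Gamma> @ \<Delta> \<turnstile> K)" for K
      using derivable.weakening[OF weakening(1) that weakening(3)] by (simp add: map_stmt_subst_Var)
    show "generated_stmt (\<Gamma> @ [(x, T)] @ \<Delta>) (HasType (Var y) (subst Var S))"
      if "(y, S) \<in> set (\<Gamma> @ \<Delta>)" for y S
      using generated_var[OF wf, of y S] that by (auto simp: subst_Var)
  qed (use weakening in simp)
  then show ?case by (simp add: map_stmt_subst_Var)
next
  case (substitution \<Gamma> t T x \<Delta> K)
  let ?\<rho> = "Var(x := t)" and ?\<Theta> = "\<Gamma> @ subst1_ctx t x \<Delta>"
  have wf: "wf_ctx TT (\<Gamma> @ (x, T) # \<Delta>)" using derivable_wf[OF substitution(2)] by simp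
  have wf': "wf_ctx TT ?\<Theta>" using wf_ctx_subst1[OF substitution(1) wf] .
  have x: "x \<notin> fv_ctx \<Gamma>" "x \<notin> fv_ctx \<Delta>" using wf_ctx_distinct[OF wf] by auto
  have "generated_stmt ?\<Theta> (map_stmt (subst ?\<rho>) K)"
  proof (rule generated_transport)
    show "derivable TT (?\<Theta> \<turnstile> map_stmt (subst ?\<rho>) K)" if "derivable TT (\<Gamma> @ [(x, T)] @ \<Delta> \<turnstile> K)" for K
      using derivable.substitution[OF substitution(1) that] by (simp add: subst1_def)
    fix y S assume "(y, S) \<in> set (\<Gamma> @ [(x, T)] @ \<Delta>)"
    then consider "(y, S) \<in> set \<Gamma>" | "y = x" "S = T" | "(y, S) \<in> set \<Delta>" by auto
    then show "generated_stmt ?\<Theta> (HasType (?\<rho> y) (subst ?\<rho> S))"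
    proof cases
      case 1
      then have "x \<notin> fv S" "y \<noteq> x" using wf_ctx_fv[OF wf_ctx_mid(1)[OF wf] 1] x(1) by force+
      then show ?thesis
        using generated_var[OF wf', of y S] 1 subst1_id[of x S t] unfolding subst1_def by auto
    next
      case 2
      have "x \<notin> fv T" using derivable_fv[OF substitution(1), of T] x(1) by auto
      then show ?thesis
        using 2 generated_weaken_right[OF wf', of "HasType t T"] substitution.IH(1)
          subst1_id[of x T t] unfolding subst1_def by simp
    next
      case 3
      then have "y \<noteq> x" using x(2) by force
      moreover have "(y, subst1 t x S) \<in> set ?\<Theta>" using 3 by (force simp: subst1_ctx_def)
      ultimately show ?thesis using generated_var[OF wf', of y "subst1 t x S"]
        unfolding subst1_def by simp
    qed
  qed (use substitution in simp)
  then show ?case by (simp add: subst1_def)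
next
  case (type_cong \<Gamma> t u T x \<Delta> T')
  then obtain A \<sigma> where A: "A \<in> sorts TT" "T' = sort_app A \<sigma>"
    "ctx_subst TT (\<Gamma> @ [(x, T)] @ \<Delta>) (sort_ctx TT A) \<sigma>" by auto
  have "ctx_subst_eq TT (\<Gamma> @ subst1_ctx t x \<Delta>) (sort_ctx TT A)
      (\<lambda>y. subst1 t x (\<sigma> y)) (\<lambda>y. subst1 u x (\<sigma> y))"
    unfolding ctx_subst_eq_def
    using term_cong[OF type_cong(1) ctx_substD[OF A(3)]] by (auto simp: subst1_def subst_subst)
  then show ?case using A unfolding A(2) subst1_def subst_sort_app by auto
next
  case (sort_intro A)
  have "ctx_subst TT (sort_ctx TT A) (sort_ctx TT A) Var"
    using ctx_subst_Var[of "sort_ctx TT A" "[]"] wf_sort_ctx[OF sort_intro(1)] by simp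
  then show ?case using sort_intro(1) by (auto simp: sort_judgment_def sort_app_def)
next
  case (op_intro f)
  have "ctx_subst TT (op_ctx TT f) (op_ctx TT f) Var"
    using ctx_subst_Var[of "op_ctx TT f" "[]"] wf_op_ctx[OF op_intro(1)] by simp
  moreover have "derivable TT (op_ctx TT f \<turnstile> TypeEq (subst Var (op_type TT f)) (op_type TT f))"
    using type_refl[OF op_intro(2)] by (simp add: subst_Var)
  ultimately show ?case using op_intro(1) by (auto simp: op_judgment_def op_app_def)
qed simp_all

lemma IsType_cases:
  assumes "derivable TT (\<Gamma> \<turnstile> IsType T)"
  obtains A \<sigma> where "A \<in> sorts TT" "T = sort_app A \<sigma>" "ctx_subst TT \<Gamma> (sort_ctx TT A) \<sigma>"
  using derivable_generated[OF assms] by auto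

lemma TypeEq_cases:
  assumes "derivable TT (\<Gamma> \<turnstile> TypeEq (sort_app A \<sigma>) (sort_app B \<tau>))"
  shows "A = B" "ctx_subst_eq TT \<Gamma> (sort_ctx TT A) \<sigma> \<tau>"
proof -
  obtain A' \<sigma>' \<tau>' where A': "A' \<in> sorts TT" "sort_app A \<sigma> = sort_app A' \<sigma>'"
    "sort_app B \<tau> = sort_app A' \<tau>'" "ctx_subst_eq TT \<Gamma> (sort_ctx TT A') \<sigma>' \<tau>'"
    using derivable_generated[OF assms] by auto
  note i = A'(2,3)[unfolded sort_app_inject]
  show "A = B" using i by simp
  show "ctx_subst_eq TT \<Gamma> (sort_ctx TT A) \<sigma> \<tau>"
    by (rule ctx_subst_eq_cong[OF _ _ _ A'(4)[folded conjunct1[OF i(1)]]])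
      (use i A'(1) wf_sort_ctx in auto)
qed

lemma HasType_cases:
  assumes "derivable TT (\<Gamma> \<turnstile> HasType t T)"
  obtains (var) y S where "t = Var y" "(y, S) \<in> set \<Gamma>" "derivable TT (\<Gamma> \<turnstile> TypeEq S T)"
  | (op) f \<sigma> where "f \<in> ops TT" "t = op_app f \<sigma>" "ctx_subst TT \<Gamma> (op_ctx TT f) \<sigma>"
      "derivable TT (\<Gamma> \<turnstile> TypeEq (subst \<sigma> (op_type TT f)) T)"
  using derivable_generated[OF assms] by auto

end

section \<open>The syntactic clan\<close>

context gat_syntax
begin

abbreviation CL where "CL \<equiv> Cl TT"

definition arr where
  "arr \<Gamma> \<Delta> \<sigma> = cl_arrow TT \<Gamma> \<Delta> (map \<sigma> (vars \<Delta>))"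

lemma arr_cong: "(\<And>y. y \<in> fv_ctx \<Delta> \<Longrightarrow> \<sigma> y = \<tau> y) \<Longrightarrow> arr \<Gamma> \<Delta> \<sigma> = arr \<Gamma> \<Delta> \<tau>"
  unfolding arr_def by (rule arg_cong[of _ _ "cl_arrow TT \<Gamma> \<Delta>"], rule map_cong) auto

lemma comp_type_map:
  assumes "wf_ctx TT \<Delta>" "i < length \<Delta>"
  shows "comp_type \<Delta> (map \<sigma> (vars \<Delta>)) i = subst \<sigma> (snd (\<Delta> ! i))"
proof -
  have "fv (snd (\<Delta> ! i)) \<subseteq> set (take i (vars \<Delta>))"
    using scoped_nth[OF wf_ctx_scoped[OF assms(1)] assms(2)] by simp
  then show ?thesis
    unfolding comp_type_def subst_list_assign take_map[of _ \<sigma>]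
    by (intro subst_cong assign_map) auto
qed

lemma ctx_mor_map:
  assumes "wf_ctx TT \<Delta>"
  shows "ctx_mor TT \<Gamma> \<Delta> (map \<sigma> (vars \<Delta>)) \<longleftrightarrow> ctx_subst TT \<Gamma> \<Delta> \<sigma>"
  unfolding ctx_mor_def ctx_subst_def all_set_conv_all_nth
  using comp_type_map[OF assms] by (simp add: case_prod_unfold)

lemma ctx_mor_eq_map:
  assumes "wf_ctx TT \<Gamma>" "wf_ctx TT \<Delta>"
  shows "ctx_mor_eq TT \<Gamma> \<Delta> (map \<sigma> (vars \<Delta>)) (map \<tau> (vars \<Delta>)) \<longleftrightarrow> ctx_subst_eq TT \<Gamma> \<Delta> \<sigma> \<tau>"
proof -
  have "(\<forall>i < length \<Delta>. derivable TT (\<Gamma> \<turnstile> TermEq (map \<sigma> (vars \<Delta>) ! i) (map \<tau> (vars \<Delta>) ! i)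
      (comp_type \<Delta> (map \<sigma> (vars \<Delta>)) i))) \<longleftrightarrow> ctx_subst_eq TT \<Gamma> \<Delta> \<sigma> \<tau>"
    unfolding ctx_subst_eq_def all_set_conv_all_nth
    using comp_type_map[OF assms(2)] by (simp add: case_prod_unfold)
  then show ?thesis
    unfolding ctx_mor_eq_def ctx_mor_map[OF assms(2)]
    using ctx_subst_eq_left ctx_subst_eq_right[OF assms] by blast
qed

lemma list_as_map:
  fixes ts :: "('v, 'a, 'f) expr list"
  assumes "wf_ctx TT \<Delta>" "length ts = length \<Delta>"
  obtains \<sigma> where "ts = map \<sigma> (vars \<Delta>)"
proof (rule that)
  show "ts = map (assign (vars \<Delta>) ts) (vars \<Delta>)"
    using assign_nth[OF wf_ctx_distinct[OF assms(1)], of ts] assms(2) by (auto intro: nth_equalityI)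
qed

lemma arr_class:
  assumes "wf_ctx TT \<Gamma>" "wf_ctx TT \<Delta>"
  shows "{us. ctx_mor_eq TT \<Gamma> \<Delta> (map \<sigma> (vars \<Delta>)) us} =
    {map \<tau> (vars \<Delta>) | \<tau>. ctx_subst_eq TT \<Gamma> \<Delta> \<sigma> \<tau>}"
proof (intro equalityI subsetI)
  fix us assume us: "us \<in> {us. ctx_mor_eq TT \<Gamma> \<Delta> (map \<sigma> (vars \<Delta>)) us}"
  then have "length us = length \<Delta>" by (simp add: ctx_mor_eq_def ctx_mor_def)
  then obtain \<tau> where "us = map \<tau> (vars \<Delta>)" using list_as_map[OF assms(2)] by blast
  then show "us \<in> {map \<tau> (vars \<Delta>) | \<tau>. ctx_subst_eq TT \<Gamma> \<Delta> \<sigma> \<tau>}"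
    using us ctx_mor_eq_map[OF assms] by blast
qed (use ctx_mor_eq_map[OF assms] in blast)

lemma arr_eq_iff:
  assumes wf: "wf_ctx TT \<Gamma>" "wf_ctx TT \<Delta>" and \<sigma>: "ctx_subst TT \<Gamma> \<Delta> \<sigma>" and \<tau>: "ctx_subst TT \<Gamma> \<Delta> \<tau>"
  shows "arr \<Gamma> \<Delta> \<sigma> = arr \<Gamma> \<Delta> \<tau> \<longleftrightarrow> ctx_subst_eq TT \<Gamma> \<Delta> \<sigma> \<tau>"
proof
  assume "arr \<Gamma> \<Delta> \<sigma> = arr \<Gamma> \<Delta> \<tau>"
  then have "{us. ctx_mor_eq TT \<Gamma> \<Delta> (map \<sigma> (vars \<Delta>)) us} = {us. ctx_mor_eq TT \<Gamma> \<Delta> (map \<tau> (vars \<Delta>)) us}"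
    by (simp add: arr_def cl_arrow_def)
  moreover have "ctx_mor_eq TT \<Gamma> \<Delta> (map \<tau> (vars \<Delta>)) (map \<tau> (vars \<Delta>))"
    unfolding ctx_mor_eq_map[OF wf] by (rule ctx_subst_eq_refl[OF \<tau>])
  ultimately have "ctx_mor_eq TT \<Gamma> \<Delta> (map \<sigma> (vars \<Delta>)) (map \<tau> (vars \<Delta>))" by blast
  then show "ctx_subst_eq TT \<Gamma> \<Delta> \<sigma> \<tau>" unfolding ctx_mor_eq_map[OF wf] .
next
  assume st: "ctx_subst_eq TT \<Gamma> \<Delta> \<sigma> \<tau>"
  have "ctx_subst_eq TT \<Gamma> \<Delta> \<sigma> \<rho> \<longleftrightarrow> ctx_subst_eq TT \<Gamma> \<Delta> \<tau> \<rho>" for \<rho>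
    using ctx_subst_eq_trans[OF wf] ctx_subst_eq_sym[OF wf] st by blast
  then show "arr \<Gamma> \<Delta> \<sigma> = arr \<Gamma> \<Delta> \<tau>" unfolding arr_def cl_arrow_def arr_class[OF wf] by simp
qed

lemma Ob_Cl: "Ob CL = {\<Gamma>. wf_ctx TT \<Gamma>}"
  by (simp add: Cl_def ctx_iff_wf)

lemma Hom_Cl:
  assumes "wf_ctx TT \<Gamma>" "wf_ctx TT \<Delta>"
  shows "Hom CL \<Gamma> \<Delta> = {arr \<Gamma> \<Delta> \<sigma> | \<sigma>. ctx_subst TT \<Gamma> \<Delta> \<sigma>}"
proof (intro equalityI subsetI)
  fix m assume "m \<in> Hom CL \<Gamma> \<Delta>"
  then obtain ts where ts: "m = cl_arrow TT \<Gamma> \<Delta> ts" "ctx_mor TT \<Gamma> \<Delta> ts"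
    by (auto simp: Hom_def Cl_def cl_arrow_def)
  then have "length ts = length \<Delta>" by (simp add: ctx_mor_def)
  then obtain \<sigma> where "ts = map \<sigma> (vars \<Delta>)" using list_as_map[OF assms(2)] by blast
  then show "m \<in> {arr \<Gamma> \<Delta> \<sigma> | \<sigma>. ctx_subst TT \<Gamma> \<Delta> \<sigma>}"
    using ts ctx_mor_map[OF assms(2)] unfolding arr_def by blast
next
  fix m assume "m \<in> {arr \<Gamma> \<Delta> \<sigma> | \<sigma>. ctx_subst TT \<Gamma> \<Delta> \<sigma>}"
  then obtain \<sigma> where \<sigma>: "m = cl_arrow TT \<Gamma> \<Delta> (map \<sigma> (vars \<Delta>))" "ctx_subst TT \<Gamma> \<Delta> \<sigma>"
    unfolding arr_def by blast
  then have "ctx_mor TT \<Gamma> \<Delta> (map \<sigma> (vars \<Delta>))" using ctx_mor_map[OF assms(2)] by blast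
  then have "m \<in> Ar CL" using \<sigma>(1) assms unfolding Cl_def by (auto simp: ctx_iff_wf)
  moreover have "Dom CL m = \<Gamma>" "Cod CL m = \<Delta>" unfolding \<sigma>(1) by (simp_all add: Cl_def cl_arrow_def)
  ultimately show "m \<in> Hom CL \<Gamma> \<Delta>" using assms by (simp add: Hom_def Ob_Cl)
qed

lemma Hom_ClE:
  assumes "m \<in> Hom CL \<Gamma> \<Delta>"
  obtains \<sigma> where "wf_ctx TT \<Gamma>" "wf_ctx TT \<Delta>" "m = arr \<Gamma> \<Delta> \<sigma>" "ctx_subst TT \<Gamma> \<Delta> \<sigma>"
proof -
  have "wf_ctx TT \<Gamma>" "wf_ctx TT \<Delta>" using HomD(2,3)[OF assms] by (simp_all add: Ob_Cl)
  then show ?thesis using that Hom_Cl assms by blast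
qed

lemma arr_Hom: "wf_ctx TT \<Gamma> \<Longrightarrow> wf_ctx TT \<Delta> \<Longrightarrow> ctx_subst TT \<Gamma> \<Delta> \<sigma> \<Longrightarrow> arr \<Gamma> \<Delta> \<sigma> \<in> Hom CL \<Gamma> \<Delta>"
  using Hom_Cl by blast

lemma subst_list_map:
  assumes "fv e \<subseteq> fv_ctx \<Delta>"
  shows "subst_list (vars \<Delta>) (map \<sigma> (vars \<Delta>)) e = subst \<sigma> e"
  unfolding subst_list_assign by (intro subst_cong assign_map) (use assms in auto)

text \<open>Composition in the clan is a union over all representatives; the congruence and substitution lemmas
  make every representative give the same class.\<close>

lemma Comp_arr:
  assumes wf: "wf_ctx TT \<Gamma>" "wf_ctx TT \<Delta>" "wf_ctx TT \<Theta>"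
    and \<sigma>: "ctx_subst TT \<Gamma> \<Delta> \<sigma>" and \<tau>: "ctx_subst TT \<Delta> \<Theta> \<tau>"
  shows "Comp CL (arr \<Delta> \<Theta> \<tau>) (arr \<Gamma> \<Delta> \<sigma>) = arr \<Gamma> \<Theta> (\<lambda>y. subst \<sigma> (\<tau> y))"
proof -
  have map: "map (subst_list (vars \<Delta>) (map \<sigma>' (vars \<Delta>))) (map \<tau>' (vars \<Theta>)) =
      map (\<lambda>y. subst \<sigma>' (\<tau>' y)) (vars \<Theta>)" if "ctx_subst TT \<Delta> \<Theta> \<tau>'" for \<sigma>' \<tau>'
  proof -
    have "subst_list (vars \<Delta>) (map \<sigma>' (vars \<Delta>)) (\<tau>' y) = subst \<sigma>' (\<tau>' y)" if "(y, S) \<in> set \<Theta>" for y S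
      by (rule subst_list_map) (use derivable_fv[OF ctx_substD[OF \<open>ctx_subst TT \<Delta> \<Theta> \<tau>'\<close> that]] in simp)
    then show ?thesis by auto
  qed
  let ?c = "\<lambda>\<sigma>' \<tau>'. {ws. ctx_mor_eq TT \<Gamma> \<Theta> (map (subst_list (vars \<Delta>) \<sigma>') \<tau>') ws}"
  have "(\<Union>us \<in> {us. ctx_mor_eq TT \<Delta> \<Theta> (map \<tau> (vars \<Theta>)) us}.
      \<Union>ts \<in> {ts. ctx_mor_eq TT \<Gamma> \<Delta> (map \<sigma> (vars \<Delta>)) ts}. ?c ts us) =
      {ws. ctx_mor_eq TT \<Gamma> \<Theta> (map (\<lambda>y. subst \<sigma> (\<tau> y)) (vars \<Theta>)) ws}" (is "?L = ?R")
  proof (intro equalityI subsetI)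
    fix ws assume "ws \<in> ?L"
    then obtain \<tau>' \<sigma>' where \<tau>': "ctx_subst_eq TT \<Delta> \<Theta> \<tau> \<tau>'" and \<sigma>': "ctx_subst_eq TT \<Gamma> \<Delta> \<sigma> \<sigma>'"
      and ws: "ws \<in> ?c (map \<sigma>' (vars \<Delta>)) (map \<tau>' (vars \<Theta>))"
      unfolding arr_class[OF wf(2,3)] arr_class[OF wf(1,2)] by blast
    have "ws \<in> {ws. ctx_mor_eq TT \<Gamma> \<Theta> (map (\<lambda>y. subst \<sigma>' (\<tau>' y)) (vars \<Theta>)) ws}"
      using ws unfolding map[OF ctx_subst_eq_right[OF wf(2,3) \<tau>']] .
    then obtain \<rho> where "ws = map \<rho> (vars \<Theta>)" "ctx_subst_eq TT \<Gamma> \<Theta> (\<lambda>y. subst \<sigma>' (\<tau>' y)) \<rho>"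
      unfolding arr_class[OF wf(1,3)] by blast
    then show "ws \<in> ?R"
      unfolding arr_class[OF wf(1,3)]
      using ctx_subst_eq_trans[OF wf(1,3) ctx_subst_eq_comp[OF wf \<sigma>' \<tau>']] by blast
  next
    fix ws assume "ws \<in> ?R"
    then have "ws \<in> ?c (map \<sigma> (vars \<Delta>)) (map \<tau> (vars \<Theta>))" unfolding map[OF \<tau>] .
    moreover have "ctx_mor_eq TT \<Delta> \<Theta> (map \<tau> (vars \<Theta>)) (map \<tau> (vars \<Theta>))"
      "ctx_mor_eq TT \<Gamma> \<Delta> (map \<sigma> (vars \<Delta>)) (map \<sigma> (vars \<Delta>))"
      unfolding ctx_mor_eq_map[OF wf(2,3)] ctx_mor_eq_map[OF wf(1,2)]
      using ctx_subst_eq_refl \<sigma> \<tau> by blast+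
    ultimately show "ws \<in> ?L" by blast
  qed
  then show ?thesis by (simp add: Cl_def arr_def cl_arrow_def)
qed

lemma ctx_subst_self: "wf_ctx TT \<Gamma> \<Longrightarrow> ctx_subst TT \<Gamma> \<Gamma> Var"
  using ctx_subst_Var[of \<Gamma> "[]"] by simp

lemma Ident_Cl: "Ident CL \<Gamma> = arr \<Gamma> \<Gamma> Var"
  by (simp add: Cl_def arr_def)

lemma is_category_Cl: "is_category CL"
  unfolding is_category_def
proof (intro conjI ballI allI)
  fix m assume "m \<in> Ar CL"
  then show "Dom CL m \<in> Ob CL" "Cod CL m \<in> Ob CL" by (auto simp: Cl_def cl_arrow_def)
next
  fix \<Gamma> assume "\<Gamma> \<in> Ob CL"
  then show "Ident CL \<Gamma> \<in> Hom CL \<Gamma> \<Gamma>"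
    unfolding Ident_Cl Ob_Cl using arr_Hom ctx_subst_self by simp
next
  fix \<Gamma> \<Delta> \<Theta> f g assume f: "f \<in> Hom CL \<Gamma> \<Delta>" and g: "g \<in> Hom CL \<Delta> \<Theta>"
  obtain \<sigma> where \<sigma>: "wf_ctx TT \<Gamma>" "wf_ctx TT \<Delta>" "f = arr \<Gamma> \<Delta> \<sigma>" "ctx_subst TT \<Gamma> \<Delta> \<sigma>"
    using f by (rule Hom_ClE)
  obtain \<tau> where \<tau>: "wf_ctx TT \<Theta>" "g = arr \<Delta> \<Theta> \<tau>" "ctx_subst TT \<Delta> \<Theta> \<tau>" using g by (rule Hom_ClE)
  show "Comp CL g f \<in> Hom CL \<Gamma> \<Theta>"
    unfolding \<sigma>(3) \<tau>(2) Comp_arr[OF \<sigma>(1,2) \<tau>(1) \<sigma>(4) \<tau>(3)]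
    by (rule arr_Hom[OF \<sigma>(1) \<tau>(1) ctx_subst_comp[OF \<sigma>(1,2,4) \<tau>(3)]])
next
  fix \<Gamma> \<Delta> f assume f: "f \<in> Hom CL \<Gamma> \<Delta>"
  obtain \<sigma> where \<sigma>: "wf_ctx TT \<Gamma>" "wf_ctx TT \<Delta>" "f = arr \<Gamma> \<Delta> \<sigma>" "ctx_subst TT \<Gamma> \<Delta> \<sigma>"
    using f by (rule Hom_ClE)
  show "Comp CL f (Ident CL \<Gamma>) = f" "Comp CL (Ident CL \<Delta>) f = f"
    unfolding Ident_Cl \<sigma>(3) Comp_arr[OF \<sigma>(1,1,2) ctx_subst_self[OF \<sigma>(1)] \<sigma>(4)]
      Comp_arr[OF \<sigma>(1,2,2) \<sigma>(4) ctx_subst_self[OF \<sigma>(2)]] by (simp_all add: subst_Var)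
next
  fix \<Gamma> \<Delta> \<Theta> \<Xi> f g h
  assume f: "f \<in> Hom CL \<Gamma> \<Delta>" and g: "g \<in> Hom CL \<Delta> \<Theta>" and h: "h \<in> Hom CL \<Theta> \<Xi>"
  obtain \<sigma> where \<sigma>: "wf_ctx TT \<Gamma>" "wf_ctx TT \<Delta>" "f = arr \<Gamma> \<Delta> \<sigma>" "ctx_subst TT \<Gamma> \<Delta> \<sigma>"
    using f by (rule Hom_ClE)
  obtain \<tau> where \<tau>: "wf_ctx TT \<Theta>" "g = arr \<Delta> \<Theta> \<tau>" "ctx_subst TT \<Delta> \<Theta> \<tau>" using g by (rule Hom_ClE)
  obtain \<rho> where \<rho>: "wf_ctx TT \<Xi>" "h = arr \<Theta> \<Xi> \<rho>" "ctx_subst TT \<Theta> \<Xi> \<rho>" using h by (rule Hom_ClE)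
  show "Comp CL h (Comp CL g f) = Comp CL (Comp CL h g) f"
    unfolding \<sigma>(3) \<tau>(2) \<rho>(2) Comp_arr[OF \<sigma>(1,2) \<tau>(1) \<sigma>(4) \<tau>(3)]
      Comp_arr[OF \<sigma>(2) \<tau>(1) \<rho>(1) \<tau>(3) \<rho>(3)]
      Comp_arr[OF \<sigma>(1) \<tau>(1) \<rho>(1) ctx_subst_comp[OF \<sigma>(1,2,4) \<tau>(3)] \<rho>(3)]
      Comp_arr[OF \<sigma>(1,2) \<rho>(1) \<sigma>(4) ctx_subst_comp[OF \<sigma>(2) \<tau>(1,3) \<rho>(3)]]
    by (simp add: subst_subst)
qed

lemma Nil_terminal: "is_terminal CL []"
  unfolding is_terminal_def
proof (intro conjI ballI)
  show "[] \<in> Ob CL" by (simp add: Ob_Cl wf_Nil)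
  fix \<Gamma> assume "\<Gamma> \<in> Ob CL"
  then have wf: "wf_ctx TT \<Gamma>" by (simp add: Ob_Cl)
  have "Hom CL \<Gamma> [] = {arr \<Gamma> [] Var}"
    unfolding Hom_Cl[OF wf wf_Nil] by (auto simp: arr_def ctx_subst_def)
  then show "\<exists>!f. f \<in> Hom CL \<Gamma> []" by simp
qed

subsection \<open>Smallness\<close>

definition over :: "('v, 'a, 'f) expr \<Rightarrow> bool" where
  "over e \<longleftrightarrow> sorts_of e \<subseteq> sorts TT \<and> ops_of e \<subseteq> ops TT"

primrec terms_upto :: "nat \<Rightarrow> ('v, 'a, 'f) expr set" where
  "terms_upto 0 = range Var"
| "terms_upto (Suc n) = terms_upto n \<union>
     (\<lambda>(s, es). App s es) ` ((Inl ` sorts TT \<union> Inr ` ops TT) \<times> lists (terms_upto n))"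

lemma terms_upto_mono: "m \<le> n \<Longrightarrow> terms_upto m \<subseteq> terms_upto n"
  by (rule lift_Suc_mono_le[of terms_upto]) auto

lemma over_terms_upto: "over e \<Longrightarrow> \<exists>n. e \<in> terms_upto n"
proof (induction e)
  case (Var x)
  have "Var x \<in> terms_upto 0" by simp
  then show ?case by blast
next
  case (App s es)
  have s: "s \<in> Inl ` sorts TT \<union> Inr ` ops TT" using App.prems by (cases s) (auto simp: over_def)
  have each: "\<exists>n. e \<in> terms_upto n" if "e \<in> set es" for e
    by (rule App.IH[OF that]) (use App.prems that in \<open>auto simp: over_def\<close>)
  have "\<exists>n. set es' \<subseteq> terms_upto n" if "set es' \<subseteq> set es" for es'
    using that
  proof (induction es')
    case (Cons e es')
    obtain n m where nm: "set es' \<subseteq> terms_upto n" "e \<in> terms_upto m" using Cons each[of e] by auto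
    have "set (e # es') \<subseteq> terms_upto (max n m)"
      using terms_upto_mono[of n "max n m"] terms_upto_mono[of m "max n m"] nm by auto
    then show ?case by blast
  qed simp
  then obtain n where "es \<in> lists (terms_upto n)" by (metis in_listsI subset_iff order_refl)
  then have "App s es \<in> terms_upto (Suc n)" using s by force
  then show ?case by blast
qed

lemma ops_of_subst1:
  fixes e :: "('v, 'a, 'f) expr"
  shows "ops_of (subst1 t x e) \<subseteq> ops_of e \<union> ops_of t"
proof -
  have "ops_of (subst \<sigma> e) \<subseteq> ops_of e \<union> (\<Union>y \<in> fv e. ops_of (\<sigma> y))" for \<sigma> :: "'v \<Rightarrow> ('v, 'a, 'f) expr"
  proof (induction e)
    case (App s es)
    have "ops_of (subst \<sigma> e) \<subseteq> ops_of (App s es) \<union> (\<Union>y \<in> fv (App s es). ops_of (\<sigma> y))"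
      if "e \<in> set es" for e
      using App.IH[OF that] that by (auto dest!: subsetD)
    then show ?case by (simp add: UN_subset_iff Un_assoc)
  qed simp
  from this[of "Var(x := t)"] show ?thesis unfolding subst1_def by (auto split: if_splits)
qed

primrec judgment_ops :: "('v, 'a, 'f) prejudgment \<Rightarrow> 'f set" where
  "judgment_ops (Ctx \<Gamma>) = (\<Union>b \<in> set \<Gamma>. ops_of (snd b))"
| "judgment_ops (\<Gamma> \<turnstile> K) = (\<Union>b \<in> set \<Gamma>. ops_of (snd b)) \<union> (\<Union>e \<in> set_stmt K. ops_of e)"

lemma ctx_ops_subst1:
  fixes \<Delta> :: "('v, 'a, 'f) precontext"
  shows "(\<Union>b \<in> set (subst1_ctx t x \<Delta>). ops_of (snd b)) \<subseteq> (\<Union>b \<in> set \<Delta>. ops_of (snd b)) \<union> ops_of t"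
proof
  fix f assume "f \<in> (\<Union>b \<in> set (subst1_ctx t x \<Delta>). ops_of (snd b))"
  then obtain y S where "(y, S) \<in> set \<Delta>" "f \<in> ops_of (subst1 t x S)" by (auto simp: subst1_ctx_def)
  then show "f \<in> (\<Union>b \<in> set \<Delta>. ops_of (snd b)) \<union> ops_of t" using ops_of_subst1[of t x S] by force
qed

lemma ctx_ops_rename: "(\<Union>b \<in> set (rename_ctx \<pi> \<Gamma>). ops_of (snd b)) = (\<Union>b \<in> set \<Gamma>. ops_of (snd b))"
  by (simp add: rename_ctx_def expr.set_map)

lemma derivable_ops: "derivable TT J \<Longrightarrow> judgment_ops J \<subseteq> ops TT"
proof (induction rule: derivable.induct)
  case (substitution \<Gamma> t T x \<Delta> K)
  have c: "(\<Union>b \<in> set \<Gamma>. ops_of (snd b)) \<subseteq> ops TT" "(\<Union>b \<in> set \<Delta>. ops_of (snd b)) \<subseteq> ops TT"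
    "ops_of t \<subseteq> ops TT" using substitution.IH by auto
  have K: "ops_of (subst1 t x e) \<subseteq> ops TT" if "e \<in> set_stmt K" for e
  proof -
    have "ops_of e \<subseteq> ops TT" using substitution.IH(2) that by auto
    then show ?thesis using ops_of_subst1[of t x e] c(3) by (meson Un_least subset_trans)
  qed
  have "(\<Union>b \<in> set (subst1_ctx t x \<Delta>). ops_of (snd b)) \<subseteq> ops TT"
    using ctx_ops_subst1[of t x \<Delta>] c(2,3) by (meson Un_least subset_trans)
  then show ?case using c(1) K by (simp add: stmt.set_map UN_subset_iff)
next
  case (type_cong \<Gamma> t u T x \<Delta> T')
  have c: "(\<Union>b \<in> set \<Gamma>. ops_of (snd b)) \<subseteq> ops TT" "(\<Union>b \<in> set \<Delta>. ops_of (snd b)) \<subseteq> ops TT"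
    "ops_of t \<subseteq> ops TT" "ops_of u \<subseteq> ops TT" "ops_of T' \<subseteq> ops TT" using type_cong.IH by auto
  have "(\<Union>b \<in> set (subst1_ctx t x \<Delta>). ops_of (snd b)) \<subseteq> ops TT"
    using ctx_ops_subst1[of t x \<Delta>] c(2,3) by (meson Un_least subset_trans)
  moreover have "ops_of (subst1 t x T') \<subseteq> ops TT" "ops_of (subst1 u x T') \<subseteq> ops TT"
    using ops_of_subst1[of t x T'] ops_of_subst1[of u x T'] c by (meson Un_least subset_trans)+
  ultimately show ?case using c(1) by (simp add: UN_subset_iff)
next
  case (term_cong \<Gamma> t u T x \<Delta> t' T')
  have c: "(\<Union>b \<in> set \<Gamma>. ops_of (snd b)) \<subseteq> ops TT" "(\<Union>b \<in> set \<Delta>. ops_of (snd b)) \<subseteq> ops TT"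
    "ops_of t \<subseteq> ops TT" "ops_of u \<subseteq> ops TT" "ops_of T' \<subseteq> ops TT" "ops_of t' \<subseteq> ops TT"
    using term_cong.IH by auto
  have "(\<Union>b \<in> set (subst1_ctx t x \<Delta>). ops_of (snd b)) \<subseteq> ops TT"
    using ctx_ops_subst1[of t x \<Delta>] c(2,3) by (meson Un_least subset_trans)
  moreover have "ops_of (subst1 t x T') \<subseteq> ops TT" "ops_of (subst1 t x t') \<subseteq> ops TT"
    "ops_of (subst1 u x t') \<subseteq> ops TT"
    using ops_of_subst1[of t x T'] ops_of_subst1[of t x t'] ops_of_subst1[of u x t'] c
    by (meson Un_least subset_trans)+
  ultimately show ?case using c(1) by (simp add: UN_subset_iff)
next
  case (sort_intro A)
  then show ?case by (auto simp: sort_judgment_def)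
next
  case (op_intro f)
  then show ?case by (auto simp: op_judgment_def)
qed (simp_all add: ctx_ops_rename stmt.set_map expr.set_map)

lemma derivable_over:
  "derivable TT (Ctx \<Gamma>) \<Longrightarrow> b \<in> set \<Gamma> \<Longrightarrow> over (snd b)"
  "derivable TT (\<Gamma> \<turnstile> K) \<Longrightarrow> e \<in> set_stmt K \<Longrightarrow> over e"
proof -
  have "judgment_sorts J \<subseteq> sorts TT" if "derivable TT J" for J
    using derivable_sorts_induct[OF that, of "sorts TT"] by blast
  note s = this
  show "over (snd b)" if "derivable TT (Ctx \<Gamma>)" "b \<in> set \<Gamma>"
    using s[OF that(1)] derivable_ops[OF that(1)] that(2) by (force simp: over_def ctx_sorts_def)
  show "over e" if "derivable TT (\<Gamma> \<turnstile> K)" "e \<in> set_stmt K"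
    using s[OF that(1)] derivable_ops[OF that(1)] that(2) by (auto simp: over_def)
qed

lemma small_terms:
  assumes "small elts (UNIV :: 'v set)"
  shows "small elts {e. over e}"
proof (rule small_subset)
  have "small elts (sorts TT)" "small elts (ops TT)" using gat by (simp_all add: gat_def pretheory_def)
  then have "small elts (terms_upto n)" for n
    by (induction n) (auto intro!: small_Un small_image small_Times small_lists assms)
  then show "small elts (\<Union>n. terms_upto n)" by (intro small_UN small_nat)
  show "{e. over e} \<subseteq> (\<Union>n. terms_upto n)" using over_terms_upto by auto
qed

lemma small_Ob_Cl:
  assumes "small elts (UNIV :: 'v set)" shows "small elts (Ob CL)"
proof (rule small_subset)
  show "small elts (lists ((UNIV :: 'v set) \<times> {e. over e}))"
    by (intro small_lists small_Times small_terms assms)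
  show "Ob CL \<subseteq> lists ((UNIV :: 'v set) \<times> {e. over e})"
    using derivable_over(1) by (force simp: Cl_def)
qed

lemma small_Ar_Cl:
  assumes "small elts (UNIV :: 'v set)" shows "small elts (Ar CL)"
proof (rule small_subset)
  show "small elts ((\<lambda>(\<Gamma>, \<Delta>, ts). cl_arrow TT \<Gamma> \<Delta> ts) ` (Ob CL \<times> Ob CL \<times> lists {e. over e}))"
    by (intro small_image small_Times small_lists small_terms small_Ob_Cl assms)
  show "Ar CL \<subseteq> (\<lambda>(\<Gamma>, \<Delta>, ts). cl_arrow TT \<Gamma> \<Delta> ts) ` (Ob CL \<times> Ob CL \<times> lists {e. over e})"
  proof
    fix m assume "m \<in> Ar CL"
    then obtain \<Gamma> \<Delta> ts where m: "m = cl_arrow TT \<Gamma> \<Delta> ts" "\<Gamma> \<in> Ob CL" "\<Delta> \<in> Ob CL" "ctx_mor TT \<Gamma> \<Delta> ts"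
      by (auto simp: Cl_def)
    have "over t" if t: "t \<in> set ts" for t
    proof -
      obtain i where "i < length \<Delta>" "t = ts ! i"
        using t[unfolded in_set_conv_nth] m(4) unfolding ctx_mor_def by auto
      then have "derivable TT (\<Gamma> \<turnstile> HasType t (comp_type \<Delta> ts i))" using m(4) by (simp add: ctx_mor_def)
      then show ?thesis by (rule derivable_over(2)) simp
    qed
    then have "ts \<in> lists {e. over e}" by auto
    then show "m \<in> (\<lambda>(\<Gamma>, \<Delta>, ts). cl_arrow TT \<Gamma> \<Delta> ts) ` (Ob CL \<times> Ob CL \<times> lists {e. over e})"
      using m by (intro image_eqI[of _ _ "(\<Gamma>, \<Delta>, ts)"]) auto
  qed
qed

end

subsection \<open>Pullbacks of display maps\<close>

context gat_syntax
begin

lemma cl_projection_arr: "cl_projection TT \<Gamma> k = arr \<Gamma> (take k \<Gamma>) Var"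
  by (simp add: cl_projection_def arr_def)

lemma projection_display:
  assumes "wf_ctx TT (\<Gamma> @ \<Delta>)"
  shows "is_display TT (arr (\<Gamma> @ \<Delta>) \<Gamma> Var)"
proof -
  let ?\<Gamma> = "\<Gamma> @ \<Delta>"
  have o: "?\<Gamma> \<in> Ob CL" using assms by (simp add: Ob_Cl)
  note i = cat_Ident[OF is_category_Cl o]
  have "is_iso CL (Ident CL ?\<Gamma>)"
    unfolding is_iso_def HomD(4,5)[OF i]
    using i HomD(1)[OF i] cat_Ident_Comp[OF is_category_Cl i] by blast
  moreover have p: "cl_projection TT ?\<Gamma> (length \<Gamma>) = arr ?\<Gamma> \<Gamma> Var" by (simp add: cl_projection_arr)
  moreover have "arr ?\<Gamma> \<Gamma> Var \<in> Hom CL ?\<Gamma> \<Gamma>"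
    by (intro arr_Hom assms wf_ctx_append[OF assms] ctx_subst_Var)
  ultimately show ?thesis
    unfolding is_display_def
    using o HomD(5)[OF i] cat_Comp_Ident[OF is_category_Cl]
    by (intro exI[of _ ?\<Gamma>] exI[of _ "length \<Gamma>"] exI[of _ "Ident CL ?\<Gamma>"]) simp
qed

text \<open>The projection from \<open>sort_total A\<close> to the context of \<open>A\<close> is the universal family of type \<open>A\<close>: every
  context extension by a type \<open>A(\<sigma>)\<close> is a pullback of it.\<close>

definition sort_var where
  "sort_var A = (SOME x. x \<notin> fv_ctx (sort_ctx TT A))"

definition sort_total where
  "sort_total A = sort_ctx TT A @ [(sort_var A, sort_app A Var)]"

lemma sort_var_fresh: "sort_var A \<notin> fv_ctx (sort_ctx TT A)"
  unfolding sort_var_def by (rule someI_ex) (use ex_new_if_finite[OF inf] in blast)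

lemma sort_var_notin [simp]: "(sort_var A, S) \<notin> set (sort_ctx TT A)"
  using sort_var_fresh[of A] by force

lemma wf_sort_total: "A \<in> sorts TT \<Longrightarrow> wf_ctx TT (sort_total A)"
  unfolding sort_total_def wf_ctx_snoc_iff
  using wf_sort_ctx sort_judgment sort_var_fresh by simp

lemma subst_generic_type: "subst \<sigma> (sort_app A Var) = sort_app A \<sigma>"
  by (simp add: subst_sort_app)

lemma sort_app_cong: "(\<And>y. y \<in> fv_ctx (sort_ctx TT A) \<Longrightarrow> \<sigma> y = \<tau> y) \<Longrightarrow> sort_app A \<sigma> = sort_app A \<tau>"
  by (simp add: sort_app_inject)

lemma ctx_subst_total:
  assumes "A \<in> sorts TT"
  shows "ctx_subst TT \<Gamma> (sort_total A) \<sigma> \<longleftrightarrow>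
    ctx_subst TT \<Gamma> (sort_ctx TT A) \<sigma> \<and> derivable TT (\<Gamma> \<turnstile> HasType (\<sigma> (sort_var A)) (sort_app A \<sigma>))"
  by (auto simp: ctx_subst_def sort_total_def subst_generic_type)

lemma ctx_subst_upd:
  assumes "wf_ctx TT \<Delta>" "x \<notin> fv_ctx \<Delta>"
  shows "ctx_subst TT \<Gamma> \<Delta> (\<sigma>(x := t)) \<longleftrightarrow> ctx_subst TT \<Gamma> \<Delta> \<sigma>"
proof -
  have "\<And>y. y \<in> fv_ctx \<Delta> \<Longrightarrow> \<sigma> y = (\<sigma>(x := t)) y" using assms(2) by auto
  then show ?thesis
    using ctx_subst_cong[OF assms(1), of \<sigma> "\<sigma>(x := t)"] ctx_subst_cong[OF assms(1), of "\<sigma>(x := t)" \<sigma>]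
    by metis
qed

lemma sort_app_upd: "sort_app A (\<sigma>(sort_var A := t)) = sort_app A \<sigma>"
  by (rule sort_app_cong) (use sort_var_fresh in auto)

lemma ctx_subst_total_upd:
  assumes "A \<in> sorts TT"
  shows "ctx_subst TT \<Gamma> (sort_total A) (\<sigma>(sort_var A := t)) \<longleftrightarrow>
    ctx_subst TT \<Gamma> (sort_ctx TT A) \<sigma> \<and> derivable TT (\<Gamma> \<turnstile> HasType t (sort_app A \<sigma>))"
  unfolding ctx_subst_total[OF assms] ctx_subst_upd[OF wf_sort_ctx[OF assms] sort_var_fresh] sort_app_upd
  by simp

text \<open>A term \<open>t\<close> over \<open>\<Gamma>\<close> of type \<open>A(\<sigma>)\<close>, seen as an arrow. All arrows into \<open>sort_total A\<close> arise in this way, so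
  the rank argument can speak of arrows in place of terms.\<close>

definition term_arr where
  "term_arr \<Gamma> A \<sigma> t = arr \<Gamma> (sort_total A) (\<sigma>(sort_var A := t))"

lemma HasType_sort_ctx:
  assumes "derivable TT (\<Gamma> \<turnstile> HasType t (sort_app A \<sigma>))"
  shows "A \<in> sorts TT" "ctx_subst TT \<Gamma> (sort_ctx TT A) \<sigma>" "wf_ctx TT \<Gamma>"
proof -
  obtain B \<tau> where B: "B \<in> sorts TT" "sort_app A \<sigma> = sort_app B \<tau>" "ctx_subst TT \<Gamma> (sort_ctx TT B) \<tau>"
    using HasType_presup[OF assms] by (rule IsType_cases)
  note i = B(2)[unfolded sort_app_inject]
  show "A \<in> sorts TT" using i B(1) by simp
  show "ctx_subst TT \<Gamma> (sort_ctx TT A) \<sigma>"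
    by (rule ctx_subst_cong[OF _ _ B(3)[folded conjunct1[OF i]]]) (use i B(1) wf_sort_ctx in auto)
  show "wf_ctx TT \<Gamma>" by (rule derivable_wf[OF assms])
qed

lemma term_arr_Hom:
  assumes "derivable TT (\<Gamma> \<turnstile> HasType t (sort_app A \<sigma>))"
  shows "term_arr \<Gamma> A \<sigma> t \<in> Hom CL \<Gamma> (sort_total A)"
  unfolding term_arr_def
  using HasType_sort_ctx[OF assms] assms by (intro arr_Hom wf_sort_total) (simp_all add: ctx_subst_total_upd)

lemma Hom_sort_totalE:
  assumes "m \<in> Hom CL \<Gamma> (sort_total A)" "A \<in> sorts TT"
  obtains \<sigma> t where "m = term_arr \<Gamma> A \<sigma> t" "derivable TT (\<Gamma> \<turnstile> HasType t (sort_app A \<sigma>))"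
proof -
  obtain \<sigma> where \<sigma>: "m = arr \<Gamma> (sort_total A) \<sigma>" "ctx_subst TT \<Gamma> (sort_total A) \<sigma>"
    using assms(1) by (rule Hom_ClE)
  have "derivable TT (\<Gamma> \<turnstile> HasType (\<sigma> (sort_var A)) (sort_app A \<sigma>))"
    using \<sigma>(2) by (simp add: ctx_subst_total[OF assms(2)])
  then show ?thesis using that[of \<sigma> "\<sigma> (sort_var A)"] \<sigma>(1) by (simp add: term_arr_def)
qed

lemma term_arr_Comp:
  assumes t: "derivable TT (\<Gamma> \<turnstile> HasType t (sort_app A \<sigma>))"
    and \<rho>: "ctx_subst TT \<Theta> \<Gamma> \<rho>" and \<Theta>: "wf_ctx TT \<Theta>"
  shows "Comp CL (term_arr \<Gamma> A \<sigma> t) (arr \<Theta> \<Gamma> \<rho>) = term_arr \<Theta> A (\<lambda>y. subst \<rho> (\<sigma> y)) (subst \<rho> t)"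
proof -
  note A = HasType_sort_ctx[OF t]
  have "ctx_subst TT \<Gamma> (sort_total A) (\<sigma>(sort_var A := t))"
    using A t by (simp add: ctx_subst_total_upd)
  then show ?thesis
    unfolding term_arr_def
    by (subst Comp_arr[OF \<Theta> A(3) wf_sort_total[OF A(1)] \<rho>]) (auto intro: arr_cong)
qed

lemma term_arr_eq:
  assumes t: "derivable TT (\<Gamma> \<turnstile> HasType t (sort_app A \<sigma>))"
    and eq: "derivable TT (\<Gamma> \<turnstile> TypeEq (sort_app A \<sigma>) (sort_app B \<tau>))"
  shows "B = A" "term_arr \<Gamma> A \<sigma> t = term_arr \<Gamma> B \<tau> t"
proof -
  note A = HasType_sort_ctx[OF t]
  note e = TypeEq_cases[OF eq]
  show "B = A" using e(1) by simp
  have t': "derivable TT (\<Gamma> \<turnstile> HasType t (sort_app A \<tau>))" using conv_term[OF eq t] e(1) by simp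
  have "ctx_subst_eq TT \<Gamma> (sort_ctx TT A) (\<sigma>(sort_var A := t)) (\<tau>(sort_var A := t))"
    by (rule ctx_subst_eq_cong[OF wf_sort_ctx[OF A(1)] _ _ e(2)]) (use sort_var_fresh in auto)
  then have "ctx_subst_eq TT \<Gamma> (sort_total A) (\<sigma>(sort_var A := t)) (\<tau>(sort_var A := t))"
    using term_refl[OF t] by (auto simp: ctx_subst_eq_def sort_total_def subst_generic_type sort_app_upd)
  then show "term_arr \<Gamma> A \<sigma> t = term_arr \<Gamma> B \<tau> t"
    unfolding term_arr_def e(1)[symmetric]
    using arr_eq_iff[OF A(3) wf_sort_total[OF A(1)]] t t' HasType_sort_ctx(2)[OF t'] A
    by (simp add: ctx_subst_total_upd)
qed

text \<open>A map from \<open>Q\<close> to the extended context is a map \<open>u\<close> to \<open>\<Gamma>\<close> with a term of type \<open>A(\<sigma>)[u]\<close>. A map to the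
  generic \<open>A\<close> that agrees with \<open>\<sigma> \<circ> u\<close> on the context of \<open>A\<close> provides such a term, by conversion along
  the congruence lemma.\<close>

lemma extension_pullback:
  assumes wf: "wf_ctx TT (\<Gamma> @ [(x, sort_app A \<sigma>)])" and A: "A \<in> sorts TT"
    and \<sigma>: "ctx_subst TT \<Gamma> (sort_ctx TT A) \<sigma>"
  shows "is_pullback CL (arr (\<Gamma> @ [(x, sort_app A \<sigma>)]) \<Gamma> Var)
    (term_arr (\<Gamma> @ [(x, sort_app A \<sigma>)]) A \<sigma> (Var x))
    (arr \<Gamma> (sort_ctx TT A) \<sigma>) (arr (sort_total A) (sort_ctx TT A) Var)"
proof -
  let ?T = "sort_app A \<sigma>" and ?\<Gamma>A = "sort_ctx TT A" and ?e = "sort_var A"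
  let ?\<Gamma>x = "\<Gamma> @ [(x, ?T)]"
  have \<Gamma>: "wf_ctx TT \<Gamma>" "x \<notin> fv_ctx \<Gamma>" "derivable TT (\<Gamma> \<turnstile> IsType ?T)"
    using wf by (simp_all add: wf_ctx_snoc_iff)
  note wA = wf_sort_ctx[OF A] and wE = wf_sort_total[OF A]
  have fvT: "x \<notin> fv ?T" using derivable_fv[OF \<Gamma>(3), of ?T] \<Gamma>(2) by auto
  have fv\<sigma>: "x \<notin> fv (\<sigma> y)" if "y \<in> fv_ctx ?\<Gamma>A" for y
    using that fvT by (auto simp: sort_app_def)
  have pV: "ctx_subst TT ?\<Gamma>x \<Gamma> Var" by (rule ctx_subst_Var[OF wf])
  have dV: "ctx_subst TT (sort_total A) ?\<Gamma>A Var"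
    using ctx_subst_Var wE unfolding sort_total_def by blast
  have \<sigma>x: "ctx_subst TT ?\<Gamma>x ?\<Gamma>A \<sigma>" by (rule ctx_subst_weaken[OF wf \<sigma>])
  have x: "derivable TT (?\<Gamma>x \<turnstile> HasType (Var x) ?T)" by (rule wf_ctx_var[OF wf]) simp
  have q: "ctx_subst TT ?\<Gamma>x (sort_total A) (\<sigma>(?e := Var x))"
    using \<sigma>x x by (simp add: ctx_subst_total_upd[OF A])
  have H: "arr ?\<Gamma>x \<Gamma> Var \<in> Hom CL ?\<Gamma>x \<Gamma>" "term_arr ?\<Gamma>x A \<sigma> (Var x) \<in> Hom CL ?\<Gamma>x (sort_total A)"
    "arr \<Gamma> ?\<Gamma>A \<sigma> \<in> Hom CL \<Gamma> ?\<Gamma>A" "arr (sort_total A) ?\<Gamma>A Var \<in> Hom CL (sort_total A) ?\<Gamma>A"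
    by (rule arr_Hom[OF wf \<Gamma>(1) pV] term_arr_Hom[OF x] arr_Hom[OF \<Gamma>(1) wA \<sigma>] arr_Hom[OF wE wA dV])+
  show ?thesis
    unfolding is_pullback_iff[OF H]
  proof (intro conjI ballI impI)
    have "arr ?\<Gamma>x ?\<Gamma>A (\<lambda>y. subst Var (\<sigma> y)) = arr ?\<Gamma>x ?\<Gamma>A (\<lambda>y. subst (\<sigma>(?e := Var x)) (Var y))"
      by (rule arr_cong) (use sort_var_fresh in \<open>auto simp: subst_Var\<close>)
    then show "Comp CL (arr \<Gamma> ?\<Gamma>A \<sigma>) (arr ?\<Gamma>x \<Gamma> Var) =
        Comp CL (arr (sort_total A) ?\<Gamma>A Var) (term_arr ?\<Gamma>x A \<sigma> (Var x))"
      unfolding term_arr_def Comp_arr[OF wf \<Gamma>(1) wA pV \<sigma>] Comp_arr[OF wf wE wA q dV] .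
  next
    fix Q u v assume "Q \<in> Ob CL" and u: "u \<in> Hom CL Q \<Gamma>" and v: "v \<in> Hom CL Q (sort_total A)"
      and uv: "Comp CL (arr \<Gamma> ?\<Gamma>A \<sigma>) u = Comp CL (arr (sort_total A) ?\<Gamma>A Var) v"
    obtain \<mu> where \<mu>: "wf_ctx TT Q" "u = arr Q \<Gamma> \<mu>" "ctx_subst TT Q \<Gamma> \<mu>" using u by (rule Hom_ClE)
    obtain \<nu> where \<nu>: "v = arr Q (sort_total A) \<nu>" "ctx_subst TT Q (sort_total A) \<nu>"
      using v by (rule Hom_ClE)
    note \<nu>' = \<nu>(2)[unfolded ctx_subst_total[OF A]]
    have "arr Q ?\<Gamma>A (\<lambda>y. subst \<mu> (\<sigma> y)) = arr Q ?\<Gamma>A \<nu>"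
      using uv unfolding \<mu>(2) \<nu>(1) Comp_arr[OF \<mu>(1) \<Gamma>(1) wA \<mu>(3) \<sigma>] Comp_arr[OF \<mu>(1) wE wA \<nu>(2) dV]
      by simp
    then have eq: "ctx_subst_eq TT Q ?\<Gamma>A (\<lambda>y. subst \<mu> (\<sigma> y)) \<nu>"
      using arr_eq_iff[OF \<mu>(1) wA ctx_subst_comp[OF \<mu>(1) \<Gamma>(1) \<mu>(3) \<sigma>] conjunct1[OF \<nu>']] by simp
    have teq: "derivable TT (Q \<turnstile> TypeEq (sort_app A (\<lambda>y. subst \<mu> (\<sigma> y))) (sort_app A \<nu>))"
      using cong_lemma(1)[OF \<mu>(1) wA eq sort_judgment[OF A]] by (simp add: subst_generic_type)
    have \<nu>e: "derivable TT (Q \<turnstile> HasType (\<nu> ?e) (sort_app A (\<lambda>y. subst \<mu> (\<sigma> y))))"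
      using conv_term[OF type_sym[OF teq]] \<nu>' by blast
    define \<mu>' where "\<mu>' = \<mu>(x := \<nu> ?e)"
    have \<mu>'\<mu>: "\<mu>' y = \<mu> y" if "y \<in> fv_ctx \<Gamma>" for y using that \<Gamma>(2) by (auto simp: \<mu>'_def)
    have \<mu>'\<sigma>: "subst \<mu>' (\<sigma> y) = subst \<mu> (\<sigma> y)" if "y \<in> fv_ctx ?\<Gamma>A" for y
      by (rule subst_cong) (use fv\<sigma>[OF that] in \<open>auto simp: \<mu>'_def\<close>)
    have \<mu>'T: "subst \<mu>' ?T = sort_app A (\<lambda>y. subst \<mu> (\<sigma> y))"
      unfolding subst_sort_app by (rule sort_app_cong) (rule \<mu>'\<sigma>)
    have \<mu>': "ctx_subst TT Q ?\<Gamma>x \<mu>'"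
      using \<nu>e \<mu>(3) ctx_subst_upd[OF \<Gamma>(1,2), of Q \<mu> "\<nu> ?e"] \<mu>'T
      unfolding \<mu>'_def[symmetric] by (simp add: ctx_subst_def \<mu>'_def)
    let ?h = "arr Q ?\<Gamma>x \<mu>'"
    show "\<exists>!h. h \<in> Hom CL Q ?\<Gamma>x \<and> Comp CL (arr ?\<Gamma>x \<Gamma> Var) h = u \<and>
        Comp CL (term_arr ?\<Gamma>x A \<sigma> (Var x)) h = v"
    proof (rule ex1I[of _ ?h], intro conjI)
      show "?h \<in> Hom CL Q ?\<Gamma>x" by (rule arr_Hom[OF \<mu>(1) wf \<mu>'])
      show "Comp CL (arr ?\<Gamma>x \<Gamma> Var) ?h = u"
        unfolding Comp_arr[OF \<mu>(1) wf \<Gamma>(1) \<mu>' pV] \<mu>(2) by (rule arr_cong) (simp add: \<mu>'\<mu>)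
      have "ctx_subst_eq TT Q ?\<Gamma>A (\<lambda>y. subst \<mu>' ((\<sigma>(?e := Var x)) y)) \<nu>"
        by (rule ctx_subst_eq_cong[OF wA _ refl eq]) (use sort_var_fresh \<mu>'\<sigma> in auto)
      moreover have "sort_app A (\<lambda>y. subst \<mu>' ((\<sigma>(?e := Var x)) y)) = sort_app A (\<lambda>y. subst \<mu> (\<sigma> y))"
        by (rule sort_app_cong) (use sort_var_fresh \<mu>'\<sigma> in auto)
      ultimately have "ctx_subst_eq TT Q (sort_total A) (\<lambda>y. subst \<mu>' ((\<sigma>(?e := Var x)) y)) \<nu>"
        using term_refl[OF \<nu>e] by (auto simp: ctx_subst_eq_def sort_total_def subst_generic_type \<mu>'_def)
      then show "Comp CL (term_arr ?\<Gamma>x A \<sigma> (Var x)) ?h = v"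
        unfolding term_arr_def Comp_arr[OF \<mu>(1) wf wE \<mu>' q] \<nu>(1)
        using arr_eq_iff[OF \<mu>(1) wE ctx_subst_comp[OF \<mu>(1) wf \<mu>' q] \<nu>(2)] by simp
    next
      fix h assume h: "h \<in> Hom CL Q ?\<Gamma>x \<and> Comp CL (arr ?\<Gamma>x \<Gamma> Var) h = u \<and>
        Comp CL (term_arr ?\<Gamma>x A \<sigma> (Var x)) h = v"
      obtain \<kappa> where \<kappa>: "h = arr Q ?\<Gamma>x \<kappa>" "ctx_subst TT Q ?\<Gamma>x \<kappa>"
        using conjunct1[OF h] by (rule Hom_ClE)
      have \<kappa>\<Gamma>: "ctx_subst TT Q \<Gamma> \<kappa>" using \<kappa>(2) by (simp add: ctx_subst_def)
      have "arr Q \<Gamma> \<kappa> = arr Q \<Gamma> \<mu>"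
        using h unfolding \<kappa>(1) Comp_arr[OF \<mu>(1) wf \<Gamma>(1) \<kappa>(2) pV] \<mu>(2) by simp
      then have k1: "ctx_subst_eq TT Q \<Gamma> \<kappa> \<mu>" using arr_eq_iff[OF \<mu>(1) \<Gamma>(1) \<kappa>\<Gamma> \<mu>(3)] by simp
      have "arr Q (sort_total A) (\<lambda>y. subst \<kappa> ((\<sigma>(?e := Var x)) y)) = arr Q (sort_total A) \<nu>"
        using h unfolding \<kappa>(1) term_arr_def Comp_arr[OF \<mu>(1) wf wE \<kappa>(2) q] \<nu>(1) by simp
      then have "ctx_subst_eq TT Q (sort_total A) (\<lambda>y. subst \<kappa> ((\<sigma>(?e := Var x)) y)) \<nu>"
        using arr_eq_iff[OF \<mu>(1) wE ctx_subst_comp[OF \<mu>(1) wf \<kappa>(2) q] \<nu>(2)] by simp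
      from ctx_subst_eqD[OF this, of ?e "sort_app A Var"]
      have "derivable TT (Q \<turnstile> TermEq (\<kappa> x) (\<nu> ?e) (sort_app A (\<lambda>y. subst \<kappa> ((\<sigma>(?e := Var x)) y))))"
        by (simp add: sort_total_def subst_generic_type)
      moreover have "sort_app A (\<lambda>y. subst \<kappa> ((\<sigma>(?e := Var x)) y)) = subst \<kappa> ?T"
        unfolding subst_sort_app by (rule sort_app_cong) (use sort_var_fresh in auto)
      ultimately have k2: "derivable TT (Q \<turnstile> TermEq (\<kappa> x) (\<nu> ?e) (subst \<kappa> ?T))" by simp
      have "ctx_subst_eq TT Q \<Gamma> \<kappa> \<mu>'"
        by (rule ctx_subst_eq_cong[OF \<Gamma>(1) refl _ k1]) (simp add: \<mu>'\<mu>)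
      then have "ctx_subst_eq TT Q ?\<Gamma>x \<kappa> \<mu>'" using k2 by (simp add: ctx_subst_eq_def \<mu>'_def)
      then show "h = ?h" unfolding \<kappa>(1) using arr_eq_iff[OF \<mu>(1) wf \<kappa>(2) \<mu>'] by simp
    qed
  qed
qed

text \<open>For a projection with several variables only a commutative square is constructed, with a map
  into its corner from every competing square; uniqueness is left to the given pullback that it
  will be compared with. Each new variable is the value of \<open>\<tau>\<close> at an old one.\<close>

lemma telescope_pullback:
  assumes "wf_ctx TT (X @ \<Xi>)" and \<Gamma>: "wf_ctx TT \<Gamma>" and \<sigma>: "ctx_subst TT \<Gamma> X \<sigma>"
  shows "\<exists>\<Xi>' \<tau>. wf_ctx TT (\<Gamma> @ \<Xi>') \<and> ctx_subst TT (\<Gamma> @ \<Xi>') (X @ \<Xi>) \<tau> \<and>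
    (\<forall>y \<in> fv_ctx X. \<tau> y = \<sigma> y) \<and>
    (\<forall>(z, S') \<in> set \<Xi>'. \<exists>y S. (y, S) \<in> set \<Xi> \<and> \<tau> y = Var z \<and> S' = subst \<tau> S) \<and>
    (\<forall>Q u v. wf_ctx TT Q \<longrightarrow> ctx_subst TT Q \<Gamma> u \<longrightarrow> ctx_subst TT Q (X @ \<Xi>) v \<longrightarrow>
      ctx_subst_eq TT Q X (\<lambda>y. subst u (\<sigma> y)) v \<longrightarrow>
      (\<exists>w. ctx_subst TT Q (\<Gamma> @ \<Xi>') w \<and> (\<forall>y \<in> fv_ctx \<Gamma>. w y = u y) \<and>
        ctx_subst_eq TT Q (X @ \<Xi>) (\<lambda>y. subst w (\<tau> y)) v))"
  using assms(1)
proof (induction \<Xi> rule: rev_induct)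
  case Nil
  show ?case by (rule exI[of _ "[]"], rule exI[of _ \<sigma>]) (use \<Gamma> \<sigma> in auto)
next
  case (snoc b \<Xi>)
  obtain y S where b: "b = (y, S)" by (cases b)
  have wfb: "wf_ctx TT (X @ \<Xi>)" "derivable TT (X @ \<Xi> \<turnstile> IsType S)" "y \<notin> fv_ctx (X @ \<Xi>)"
    using snoc.prems wf_ctx_snoc_iff[of TT "X @ \<Xi>" y S] unfolding b by simp_all
  obtain \<Xi>' \<tau> where IH: "wf_ctx TT (\<Gamma> @ \<Xi>')" "ctx_subst TT (\<Gamma> @ \<Xi>') (X @ \<Xi>) \<tau>"
    "\<forall>y \<in> fv_ctx X. \<tau> y = \<sigma> y"
    "\<forall>(z, S') \<in> set \<Xi>'. \<exists>y S. (y, S) \<in> set \<Xi> \<and> \<tau> y = Var z \<and> S' = subst \<tau> S"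
    and univ: "\<forall>Q u v. wf_ctx TT Q \<longrightarrow> ctx_subst TT Q \<Gamma> u \<longrightarrow> ctx_subst TT Q (X @ \<Xi>) v \<longrightarrow>
      ctx_subst_eq TT Q X (\<lambda>y. subst u (\<sigma> y)) v \<longrightarrow>
      (\<exists>w. ctx_subst TT Q (\<Gamma> @ \<Xi>') w \<and> (\<forall>y \<in> fv_ctx \<Gamma>. w y = u y) \<and>
        ctx_subst_eq TT Q (X @ \<Xi>) (\<lambda>y. subst w (\<tau> y)) v)"
    using snoc.IH[OF wfb(1)] by blast
  obtain z where z: "z \<notin> fv_ctx (\<Gamma> @ \<Xi>')"
    using ex_new_if_finite[OF inf, of "fv_ctx (\<Gamma> @ \<Xi>')"] by blast
  define \<tau>' where "\<tau>' = \<tau>(y := Var z)"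
  define \<Xi>'' where "\<Xi>'' = \<Xi>' @ [(z, subst \<tau> S)]"
  have \<tau>S: "derivable TT (\<Gamma> @ \<Xi>' \<turnstile> IsType (subst \<tau> S))"
    using subst_lemma[OF IH(1) wfb(1,2) IH(2)] by simp
  have wf: "wf_ctx TT ((\<Gamma> @ \<Xi>') @ [(z, subst \<tau> S)])"
    unfolding wf_ctx_snoc_iff using IH(1) \<tau>S z by blast
  have fvS: "fv S \<subseteq> fv_ctx (X @ \<Xi>)" using derivable_fv[OF wfb(2)] by simp
  have \<tau>\<tau>': "\<tau> x = \<tau>' x" if "x \<in> fv_ctx (X @ \<Xi>)" for x using that wfb(3) by (auto simp: \<tau>'_def)
  have subst': "subst \<tau>' R = subst \<tau> R" if "fv R \<subseteq> fv_ctx (X @ \<Xi>)" for R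
    by (rule subst_cong) (rule \<tau>\<tau>'[OF subsetD[OF that], symmetric])
  have c1: "wf_ctx TT (\<Gamma> @ \<Xi>'')" using wf by (simp add: \<Xi>''_def)
  have "ctx_subst TT ((\<Gamma> @ \<Xi>') @ [(z, subst \<tau> S)]) (X @ \<Xi>) \<tau>'"
    by (rule ctx_subst_cong[OF wfb(1) \<tau>\<tau>' ctx_subst_weaken[OF wf IH(2)]])
  moreover have "derivable TT ((\<Gamma> @ \<Xi>') @ [(z, subst \<tau> S)] \<turnstile> HasType (\<tau>' y) (subst \<tau>' S))"
    unfolding subst'[OF fvS] using wf_ctx_var[OF wf, of z "subst \<tau> S"] by (simp add: \<tau>'_def)
  ultimately have c2: "ctx_subst TT (\<Gamma> @ \<Xi>'') (X @ \<Xi> @ [b]) \<tau>'"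
    by (simp add: ctx_subst_def \<Xi>''_def b)
  have c3: "\<forall>x \<in> fv_ctx X. \<tau>' x = \<sigma> x" using IH(3) \<tau>\<tau>' by auto
  have c4: "\<exists>y S. (y, S) \<in> set (\<Xi> @ [b]) \<and> \<tau>' y = Var z' \<and> S' = subst \<tau>' S"
    if zS': "(z', S') \<in> set \<Xi>''" for z' S'
  proof (cases "(z', S') \<in> set \<Xi>'")
    case True
    then obtain y0 S0 where y0: "(y0, S0) \<in> set \<Xi>" "\<tau> y0 = Var z'" "S' = subst \<tau> S0" using IH(4) by blast
    have "y0 \<in> fv_ctx (X @ \<Xi>)" using y0(1) by force
    moreover have "fv S0 \<subseteq> fv_ctx (X @ \<Xi>)" using wf_ctx_fv[OF wfb(1), of y0 S0] y0(1) by simp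
    ultimately have "\<tau>' y0 = Var z'" "S' = subst \<tau>' S0" using y0 \<tau>\<tau>' subst' by simp_all
    then show ?thesis using y0(1) by auto
  next
    case False
    then have "z' = z" "S' = subst \<tau> S" using zS' by (auto simp: \<Xi>''_def)
    then show ?thesis using subst'[OF fvS] by (intro exI[of _ y] exI[of _ S]) (simp add: b \<tau>'_def)
  qed
  have c5: "\<exists>w. ctx_subst TT Q (\<Gamma> @ \<Xi>'') w \<and> (\<forall>y \<in> fv_ctx \<Gamma>. w y = u y) \<and>
      ctx_subst_eq TT Q (X @ \<Xi> @ [b]) (\<lambda>y. subst w (\<tau>' y)) v"
    if Q: "wf_ctx TT Q" and u: "ctx_subst TT Q \<Gamma> u" and v: "ctx_subst TT Q (X @ \<Xi> @ [b]) v"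
      and uv: "ctx_subst_eq TT Q X (\<lambda>y. subst u (\<sigma> y)) v" for Q u v
  proof -
    have v1: "ctx_subst TT Q (X @ \<Xi>) v" and vy: "derivable TT (Q \<turnstile> HasType (v y) (subst v S))"
      using v by (simp_all add: ctx_subst_def b)
    obtain w where w: "ctx_subst TT Q (\<Gamma> @ \<Xi>') w" "\<forall>y \<in> fv_ctx \<Gamma>. w y = u y"
      "ctx_subst_eq TT Q (X @ \<Xi>) (\<lambda>y. subst w (\<tau> y)) v" using univ Q u v1 uv by blast
    define w' where "w' = w(z := v y)"
    have ww': "w x = w' x" if "x \<in> fv_ctx (\<Gamma> @ \<Xi>')" for x using that z by (auto simp: w'_def)
    have w'1: "ctx_subst TT Q (\<Gamma> @ \<Xi>') w'" by (rule ctx_subst_cong[OF IH(1) ww' w(1)])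
    have wsub: "subst w' e = subst w e" if "fv e \<subseteq> fv_ctx (\<Gamma> @ \<Xi>')" for e
      by (rule subst_cong) (rule ww'[OF subsetD[OF that], symmetric])
    have teq: "derivable TT (Q \<turnstile> TypeEq (subst w (subst \<tau> S)) (subst v S))"
      using cong_lemma(1)[OF Q wfb(1) w(3) wfb(2)] by (simp add: subst_subst)
    have vy': "derivable TT (Q \<turnstile> HasType (v y) (subst w (subst \<tau> S)))"
      by (rule conv_term[OF type_sym[OF teq] vy])
    have "subst w' (subst \<tau> S) = subst w (subst \<tau> S)"
      by (rule wsub) (use derivable_fv[OF \<tau>S] in simp)
    then have "ctx_subst TT Q (\<Gamma> @ \<Xi>'') w'"
      using w'1 vy' by (simp add: ctx_subst_def \<Xi>''_def w'_def)
    moreover have "\<forall>x \<in> fv_ctx \<Gamma>. w' x = u x" using w(2) ww' by auto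
    moreover have w\<tau>: "subst w (\<tau> x) = subst w' (\<tau>' x)" if x: "x \<in> fv_ctx (X @ \<Xi>)" for x
    proof -
      have "\<exists>R. (x, R) \<in> set (X @ \<Xi>)" using x by auto
      then obtain R where "(x, R) \<in> set (X @ \<Xi>)" by blast
      then have "fv (\<tau> x) \<subseteq> fv_ctx (\<Gamma> @ \<Xi>')" using derivable_fv[OF ctx_substD[OF IH(2)]] by simp
      then show ?thesis using wsub \<tau>\<tau>'[OF x] by simp
    qed
    have "ctx_subst_eq TT Q (X @ \<Xi>) (\<lambda>y. subst w' (\<tau>' y)) v"
      by (rule ctx_subst_eq_cong[OF wfb(1) w\<tau> refl w(3)])
    moreover have "subst (\<lambda>y. subst w' (\<tau>' y)) S = subst (\<lambda>y. subst w (\<tau> y)) S"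
      by (rule subst_cong) (rule w\<tau>[OF subsetD[OF fvS], symmetric])
    moreover have "derivable TT (Q \<turnstile> TermEq (subst w' (\<tau>' y)) (v y) (subst (\<lambda>y. subst w (\<tau> y)) S))"
      using term_refl[OF vy'] by (simp add: \<tau>'_def w'_def subst_subst)
    ultimately show ?thesis by (intro exI[of _ w']) (simp add: ctx_subst_eq_def b)
  qed
  show ?case
    by (rule exI[of _ \<Xi>''], rule exI[of _ \<tau>']) (use c1 c2 c3 c4 c5 in auto)
qed

end

section \<open>Models of a non-descending theory\<close>

lemma finite_sorts_of: "finite (sorts_of e)"
proof (induction e)
  case (App s es)
  have "finite (Basic_BNFs.setl s)" by (cases s) auto
  then show ?case using App by simp
qed simp

lemma dr_le_dr_ctx: "A \<in> ctx_sorts \<Gamma> \<Longrightarrow> dr TT A \<le> dr_ctx TT \<Gamma>"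
proof -
  have "finite (ctx_sorts \<Gamma>)" by (auto simp: ctx_sorts_def finite_sorts_of)
  then show "A \<in> ctx_sorts \<Gamma> \<Longrightarrow> dr TT A \<le> dr_ctx TT \<Gamma>"
    unfolding dr_ctx_def max_rank_def by (intro Max_ge) auto
qed

lemma max_rank_ge: "finite R \<Longrightarrow> -1 \<le> max_rank R"
  unfolding max_rank_def by (intro Max_ge) auto

locale gat_models = gat_syntax TT elts
  for TT :: "('v, 'a, 'f) theory_data" and elts :: "'u \<Rightarrow> 'u set" +
  assumes small_vars: "small elts (UNIV :: 'v set)" and non_desc: "non_descending TT"
begin

sublocale small_clan elts "Cl TT" "is_display TT"
  by unfold_locales (rule is_category_Cl small_Ob_Cl[OF small_vars] small_Ar_Cl[OF small_vars])+

lemma MOD_eq: "MOD = Mod_Cl elts TT"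
proof -
  have "is_model elts TT = model" by (rule ext) (simp add: is_model_def model_def)
  then show ?thesis by (simp add: MOD_def Mod_Cl_def)
qed

text \<open>\<open>low k \<Gamma>\<close> bounds only the sort symbols heading the types of \<open>\<Gamma>\<close>; these are the ones that can be
  read off from a derivation.\<close>

definition low :: "int \<Rightarrow> ('v, 'a, 'f) precontext \<Rightarrow> bool" where
  "low k \<Gamma> \<longleftrightarrow> (\<forall>y A \<sigma>. (y, sort_app A \<sigma>) \<in> set \<Gamma> \<longrightarrow> dr TT A \<le> k)"

lemma low_dr_ctx: "dr_ctx TT \<Gamma> \<le> k \<Longrightarrow> low k \<Gamma>"
proof -
  assume k: "dr_ctx TT \<Gamma> \<le> k"
  have "dr TT A \<le> k" if "(y, sort_app A \<sigma>) \<in> set \<Gamma>" for y A \<sigma>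
  proof -
    have "A \<in> ctx_sorts \<Gamma>" using that by (force simp: ctx_sorts_def sort_app_def)
    from dr_le_dr_ctx[OF this, of TT] show ?thesis using k by simp
  qed
  then show "low k \<Gamma>" unfolding low_def by blast
qed

lemma low_sort_ctx: "A \<in> sorts TT \<Longrightarrow> dr TT A \<le> k \<Longrightarrow> low (k - 1) (sort_ctx TT A)"
  using dr_eq[OF gat, of A] by (intro low_dr_ctx) simp

lemma low_op_ctx: "f \<in> ops TT \<Longrightarrow> op_type TT f = sort_app A \<sigma> \<Longrightarrow> dr TT A \<le> k \<Longrightarrow> low k (op_ctx TT f)"
  using non_desc by (intro low_dr_ctx) (force simp: non_descending_def dr_type_def sort_app_def)

lemma dr_nonneg: "A \<in> sorts TT \<Longrightarrow> 0 \<le> dr TT A"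
proof -
  have "finite (ctx_sorts (sort_ctx TT A))" by (auto simp: ctx_sorts_def finite_sorts_of)
  then show "A \<in> sorts TT \<Longrightarrow> 0 \<le> dr TT A"
    using dr_eq[OF gat, of A] max_rank_ge[of "dr TT ` ctx_sorts (sort_ctx TT A)"] by (simp add: dr_ctx_def)
qed

lemma ctx_entry_sort:
  assumes "wf_ctx TT \<Gamma>" "(y, S) \<in> set \<Gamma>"
  obtains A \<sigma> where "A \<in> sorts TT" "S = sort_app A \<sigma>"
  using IsType_cases[OF HasType_presup[OF wf_ctx_var[OF assms]]] by metis

end

subsection \<open>One step of the decomposition\<close>

text \<open>Here \<open>q\<close> stands for the coequalizer of the kernel pair of \<open>\<phi> = g \<circ> q\<close>; the two properties of it that
  matter are \<open>q_eq\<close> and \<open>no_submodel\<close>. The aim is to pass from injectivity below rank \<open>k\<close>, for \<open>\<phi>\<close>, to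
  injectivity up to rank \<open>k\<close>, for \<open>g\<close>.\<close>

locale quotient_step = gat_models TT elts
  for TT :: "('v, 'a, 'f) theory_data" and elts :: "'u \<Rightarrow> 'u set" +
  fixes M B X \<phi> q g and k :: int
  assumes q: "q \<in> Hom MOD M B" and g: "g \<in> Hom MOD B X" and gq: "Comp MOD g q = \<phi>"
    and q_eq: "\<forall>\<Gamma> \<in> Ob (Cl TT). \<forall>x \<in> elts (fob M \<Gamma>). \<forall>y \<in> elts (fob M \<Gamma>).
      cmp \<phi> \<Gamma> x = cmp \<phi> \<Gamma> y \<longrightarrow> cmp q \<Gamma> x = cmp q \<Gamma> y"
    and no_submodel: "\<forall>S. closed_family B S \<longrightarrow>
      (\<forall>\<Gamma> \<in> Ob (Cl TT). \<forall>x \<in> elts (fob M \<Gamma>). cmp q \<Gamma> x \<in> S \<Gamma>) \<longrightarrow>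
      (\<forall>\<Gamma> \<in> Ob (Cl TT). elts (fob B \<Gamma>) \<subseteq> S \<Gamma>)"
    and inj_below: "\<And>\<Gamma>. wf_ctx TT \<Gamma> \<Longrightarrow> low (k - 1) \<Gamma> \<Longrightarrow> inj_on (cmp \<phi> \<Gamma>) (elts (fob M \<Gamma>))"
begin

lemma M: "model M" and B: "model B"
  using q by (simp_all add: Hom_MOD_iff)

definition Im where "Im \<Gamma> = cmp q \<Gamma> ` elts (fob M \<Gamma>)"

lemma cmp_\<phi>: "wf_ctx TT \<Gamma> \<Longrightarrow> x \<in> elts (fob M \<Gamma>) \<Longrightarrow> cmp \<phi> \<Gamma> x = cmp g \<Gamma> (cmp q \<Gamma> x)"
  using cmp_Comp[OF q g] unfolding gq Ob_Cl by blast

lemma Im_act: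
  assumes m: "m \<in> Hom CL \<Gamma> \<Delta>" and b: "b \<in> Im \<Gamma>" shows "act B m b \<in> Im \<Delta>"
proof -
  obtain a where a: "a \<in> elts (fob M \<Gamma>)" "b = cmp q \<Gamma> a" using b unfolding Im_def by blast
  then show ?thesis unfolding Im_def using cmp_natural[OF q m a(1)] m_act_in[OF M m a(1)] by (metis imageI)
qed

text \<open>A coordinate of type \<open>A(\<sigma>)\<close> is lifted along \<open>q\<close> separately from the preceding coordinates. The two lifts
  lie over the same element of the context of \<open>A\<close>, because that context has rank below \<open>k\<close>, where
  equality in \<open>M\<close> can be tested in \<open>X\<close>. So they are the two halves of a lift of both.\<close>

lemma in_image_if_coordinates:
  assumes "wf_ctx TT \<Delta>" "low k \<Delta>" "c \<in> elts (fob B \<Delta>)"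
    and "\<And>y A \<sigma>. (y, sort_app A \<sigma>) \<in> set \<Delta> \<Longrightarrow> act B (term_arr \<Delta> A \<sigma> (Var y)) c \<in> Im (sort_total A)"
  shows "c \<in> Im \<Delta>"
  using assms
proof (induction \<Delta> arbitrary: c rule: wf_ctx.induct)
  case wf_Nil
  obtain a where a: "a \<in> elts (fob M [])" using model_terminal[OF M Nil_terminal] by blast
  have "cmp q [] a \<in> elts (fob B [])" by (rule cmp_in[OF q _ a]) (simp add: Ob_Cl wf_ctx.wf_Nil)
  then have "c = cmp q [] a" using model_terminal[OF B Nil_terminal] wf_Nil(2) by blast
  then show ?case using a unfolding Im_def by blast
next
  case (wf_snoc \<Gamma> T x)
  obtain A \<sigma> where A: "A \<in> sorts TT" and T: "T = sort_app A \<sigma>" and \<sigma>: "ctx_subst TT \<Gamma> (sort_ctx TT A) \<sigma>"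
    using wf_snoc(2) by (rule IsType_cases)
  let ?\<Gamma>x = "\<Gamma> @ [(x, sort_app A \<sigma>)]" and ?\<Gamma>A = "sort_ctx TT A"
  have wf: "wf_ctx TT ?\<Gamma>x" using wf_snoc(1,2,3) by (simp add: wf_ctx_snoc_iff T)
  note wA = wf_sort_ctx[OF A] and wE = wf_sort_total[OF A]
  have pV: "ctx_subst TT ?\<Gamma>x \<Gamma> Var" by (rule ctx_subst_Var[OF wf])
  have dV: "ctx_subst TT (sort_total A) ?\<Gamma>A Var" using ctx_subst_Var wE unfolding sort_total_def by blast
  have x: "derivable TT (?\<Gamma>x \<turnstile> HasType (Var x) (sort_app A \<sigma>))" by (rule wf_ctx_var[OF wf]) simp
  define p r f d where "p = arr ?\<Gamma>x \<Gamma> Var" and "r = term_arr ?\<Gamma>x A \<sigma> (Var x)"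
    and "f = arr \<Gamma> ?\<Gamma>A \<sigma>" and "d = arr (sort_total A) ?\<Gamma>A Var"
  have H: "p \<in> Hom CL ?\<Gamma>x \<Gamma>" "r \<in> Hom CL ?\<Gamma>x (sort_total A)" "f \<in> Hom CL \<Gamma> ?\<Gamma>A"
    "d \<in> Hom CL (sort_total A) ?\<Gamma>A"
    unfolding p_def r_def f_def d_def
    by (rule arr_Hom[OF wf wf_snoc(1) pV] term_arr_Hom[OF x] arr_Hom[OF wf_snoc(1) wA \<sigma>]
        arr_Hom[OF wE wA dV])+
  have "is_display TT d" unfolding d_def sort_total_def
    by (rule projection_display[OF wE[unfolded sort_total_def]])
  then have sq: "disp_square ?\<Gamma>x \<Gamma> (sort_total A) ?\<Gamma>A p r f d"
    unfolding disp_square_def using H extension_pullback[OF wf A \<sigma>] by (simp add: p_def r_def f_def d_def)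
  have c: "c \<in> elts (fob B ?\<Gamma>x)" using wf_snoc.prems(2) by (simp add: T)
  have "act B p c \<in> Im \<Gamma>"
  proof (rule wf_snoc.IH)
    show "low k \<Gamma>" using wf_snoc.prems(1) by (auto simp: low_def)
    show "act B p c \<in> elts (fob B \<Gamma>)" by (rule m_act_in[OF B H(1) c])
    fix y A' \<tau> assume y: "(y, sort_app A' \<tau>) \<in> set \<Gamma>"
    have t: "derivable TT (\<Gamma> \<turnstile> HasType (Var y) (sort_app A' \<tau>))" by (rule wf_ctx_var[OF wf_snoc(1) y])
    have "act B (term_arr \<Gamma> A' \<tau> (Var y)) (act B p c) = act B (term_arr ?\<Gamma>x A' \<tau> (Var y)) c"
      using m_act_Comp[OF B H(1) term_arr_Hom[OF t] c] term_arr_Comp[OF t pV wf]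
      by (simp add: p_def subst_Var)
    also have "\<dots> \<in> Im (sort_total A')" using wf_snoc.prems(3)[of y A' \<tau>] y by (simp add: T)
    finally show "act B (term_arr \<Gamma> A' \<tau> (Var y)) (act B p c) \<in> Im (sort_total A')" .
  qed
  then obtain a' where a': "a' \<in> elts (fob M \<Gamma>)" "act B p c = cmp q \<Gamma> a'" unfolding Im_def by blast
  have "act B r c \<in> Im (sort_total A)" using wf_snoc.prems(3)[of x A \<sigma>] by (simp add: T r_def)
  then obtain a'' where a'': "a'' \<in> elts (fob M (sort_total A))" "act B r c = cmp q (sort_total A) a''"
    unfolding Im_def by blast
  have "cmp q ?\<Gamma>A (act M f a') = act B f (act B p c)" using cmp_natural[OF q H(3) a'(1)] a'(2) by simp
  also have "\<dots> = act B d (act B r c)"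
    using m_act_Comp[OF B H(1,3) c] m_act_Comp[OF B H(2,4) c] disp_square_comm[OF sq] by simp
  also have "\<dots> = cmp q ?\<Gamma>A (act M d a'')" using cmp_natural[OF q H(4) a''(1)] a''(2) by simp
  finally have "cmp \<phi> ?\<Gamma>A (act M f a') = cmp \<phi> ?\<Gamma>A (act M d a'')"
    using cmp_\<phi>[OF wA] m_act_in[OF M H(3) a'(1)] m_act_in[OF M H(4) a''(1)] by simp
  moreover have "low (k - 1) ?\<Gamma>A"
    using low_sort_ctx[OF A] wf_snoc.prems(1) unfolding T low_def by auto
  ultimately have "act M f a' = act M d a''"
    using inj_onD[OF inj_below[OF wA]] m_act_in[OF M H(3) a'(1)] m_act_in[OF M H(4) a''(1)] by blast
  then obtain a where a: "a \<in> elts (fob M ?\<Gamma>x)" "act M p a = a'" "act M r a = a''"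
    using model_pair[OF M sq a'(1) a''(1)] by blast
  have "cmp q ?\<Gamma>x a = c"
  proof (rule model_pair_unique[OF B sq cmp_in[OF q HomD(2)[OF H(1)] a(1)] c])
    show "act B p (cmp q ?\<Gamma>x a) = act B p c" using cmp_natural[OF q H(1) a(1)] a(2) a'(2) by simp
    show "act B r (cmp q ?\<Gamma>x a) = act B r c" using cmp_natural[OF q H(2) a(1)] a(3) a''(2) by simp
  qed
  then show ?case using a(1) unfolding Im_def T by blast
qed

text \<open>This is where the theory has to be non-descending: a term \<open>f(\<rho>)\<close> whose type has rank at most \<open>k\<close>
  has only arguments of rank at most \<open>k\<close>, so these lift together to the context of \<open>f\<close>.\<close>

lemma terms_in_image:
  assumes wf: "wf_ctx TT \<Gamma>" and b: "b \<in> elts (fob B \<Gamma>)"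
    and vars: "\<And>y A \<sigma>. (y, sort_app A \<sigma>) \<in> set \<Gamma> \<Longrightarrow> dr TT A \<le> k \<Longrightarrow>
      act B (term_arr \<Gamma> A \<sigma> (Var y)) b \<in> Im (sort_total A)"
  shows "derivable TT (\<Gamma> \<turnstile> HasType t (sort_app A \<sigma>)) \<Longrightarrow> dr TT A \<le> k \<Longrightarrow>
    act B (term_arr \<Gamma> A \<sigma> t) b \<in> Im (sort_total A)"
proof (induction t arbitrary: A \<sigma>)
  case (Var x)
  from Var.prems(1) show ?case
  proof (cases rule: HasType_cases)
    case (var y S)
    obtain A' \<tau> where S: "S = sort_app A' \<tau>" using ctx_entry_sort[OF wf var(2)] by blast
    have y: "derivable TT (\<Gamma> \<turnstile> HasType (Var y) (sort_app A' \<tau>))"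
      using wf_ctx_var[OF wf var(2)] by (simp add: S)
    note e = term_arr_eq[OF y var(3)[unfolded S]]
    show ?thesis using vars[of y A' \<tau>] var(1,2) Var.prems(2) e by (simp add: S)
  qed (simp add: op_app_def)
next
  case (App s es)
  from App.prems(1) show ?case
  proof (cases rule: HasType_cases)
    case (op f \<rho>)
    note wf_f = wf_op_ctx[OF op(1)]
    obtain A' \<tau> where A': "op_type TT f = sort_app A' \<tau>"
      using HasType_presup[OF op_judgment[OF op(1)]] by (metis IsType_cases)
    have f: "derivable TT (op_ctx TT f \<turnstile> HasType (op_app f Var) (sort_app A' \<tau>))"
      using op_judgment[OF op(1)] by (simp add: A')
    have \<rho>f: "derivable TT (\<Gamma> \<turnstile> HasType (op_app f \<rho>) (sort_app A' (\<lambda>y. subst \<rho> (\<tau> y))))"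
      using subst_lemma[OF wf wf_f f op(3)] by (simp add: subst_op_app subst_sort_app)
    note e = term_arr_eq[OF \<rho>f op(4)[unfolded A' subst_sort_app]]
    have r: "arr \<Gamma> (op_ctx TT f) \<rho> \<in> Hom CL \<Gamma> (op_ctx TT f)" by (rule arr_Hom[OF wf wf_f op(3)])
    have low: "low k (op_ctx TT f)" using low_op_ctx[OF op(1) A'] App.prems(2) e(1) by simp
    have "act B (arr \<Gamma> (op_ctx TT f) \<rho>) b \<in> Im (op_ctx TT f)"
    proof (rule in_image_if_coordinates[OF wf_f low m_act_in[OF B r b]])
      fix y D \<mu> assume y: "(y, sort_app D \<mu>) \<in> set (op_ctx TT f)"
      have vy: "derivable TT (op_ctx TT f \<turnstile> HasType (Var y) (sort_app D \<mu>))"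
        by (rule wf_ctx_var[OF wf_f y])
      have "derivable TT (\<Gamma> \<turnstile> HasType (\<rho> y) (sort_app D (\<lambda>z. subst \<rho> (\<mu> z))))"
        using ctx_substD[OF op(3) y] by (simp add: subst_sort_app)
      moreover have "\<rho> y \<in> set es" using op(2) y by (force simp: op_app_def)
      moreover have "dr TT D \<le> k" using low y unfolding low_def by blast
      ultimately have "act B (term_arr \<Gamma> D (\<lambda>z. subst \<rho> (\<mu> z)) (\<rho> y)) b \<in> Im (sort_total D)"
        using App.IH by blast
      then show "act B (term_arr (op_ctx TT f) D \<mu> (Var y)) (act B (arr \<Gamma> (op_ctx TT f) \<rho>) b) \<in>
          Im (sort_total D)"
        using m_act_Comp[OF B r term_arr_Hom[OF vy] b] term_arr_Comp[OF vy op(3) wf] by simp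
    qed
    from Im_act[OF term_arr_Hom[OF f] this]
    have "act B (term_arr \<Gamma> A' (\<lambda>y. subst \<rho> (\<tau> y)) (op_app f \<rho>)) b \<in> Im (sort_total A')"
      using m_act_Comp[OF B r term_arr_Hom[OF f] b] term_arr_Comp[OF f op(3) wf]
      by (simp add: subst_op_app)
    then show ?thesis using e op(2) by simp
  qed simp
qed

text \<open>The closed family to which the minimality of \<open>B\<close> is applied. Quantifying over all terms, and not only
  over the variables of \<open>\<Gamma>\<close>, makes it closed under the action of arrows by definition.\<close>

definition liftable where
  "liftable \<Gamma> = {b. \<forall>A m. A \<in> sorts TT \<longrightarrow> dr TT A \<le> k \<longrightarrow> m \<in> Hom CL \<Gamma> (sort_total A) \<longrightarrow>
     act B m b \<in> Im (sort_total A)}"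

lemma liftable_term:
  assumes "b \<in> liftable \<Gamma>" "derivable TT (\<Gamma> \<turnstile> HasType t (sort_app A \<sigma>))" "dr TT A \<le> k"
  shows "act B (term_arr \<Gamma> A \<sigma> t) b \<in> Im (sort_total A)"
  using assms term_arr_Hom[OF assms(2)] HasType_sort_ctx(1)[OF assms(2)] unfolding liftable_def by blast

lemma liftable_act:
  assumes m: "m \<in> Hom CL \<Gamma> \<Delta>" and b: "b \<in> elts (fob B \<Gamma>)" "b \<in> liftable \<Gamma>"
  shows "act B m b \<in> liftable \<Delta>"
  unfolding liftable_def
proof (clarify)
  fix A m' assume "A \<in> sorts TT" "dr TT A \<le> k" and m': "m' \<in> Hom CL \<Delta> (sort_total A)"
  then have "act B (Comp CL m' m) b \<in> Im (sort_total A)"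
    using b(2) cat_Comp[OF is_category_Cl m m'] unfolding liftable_def by blast
  then show "act B m' (act B m b) \<in> Im (sort_total A)"
    unfolding m_act_Comp[OF B m m' b(1)] .
qed

text \<open>A pullback \<open>P\<close> of a display map is compared with the square \<open>P\<^sub>0\<close> of \<open>telescope_pullback\<close>:
  every variable of the context \<open>P\<^sub>0\<close> comes from one of the two sides, so \<open>terms_in_image\<close> applies
  to it.\<close>

lemma liftable_pair:
  assumes sq: "disp_square P \<Gamma> Y X0 p r f d" and z: "z \<in> elts (fob B P)"
    and zp: "act B p z \<in> liftable \<Gamma>" and zr: "act B r z \<in> liftable Y"
  shows "z \<in> liftable P"
proof -
  have H: "p \<in> Hom CL P \<Gamma>" "r \<in> Hom CL P Y" "f \<in> Hom CL \<Gamma> X0" "d \<in> Hom CL Y X0"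
    and pb: "is_pullback CL p r f d" and disp: "is_display TT d"
    using sq by (simp_all add: disp_square_def)
  note C = is_category_Cl
  \<comment> \<open>Up to the isomorphism \<open>i\<close>, the display map is the projection from \<open>X1 @ \<Xi>\<close> to \<open>X1\<close>.\<close>
  obtain Y0 l i where Y0: "Y0 \<in> Ob CL" "l \<le> length Y0" and i: "is_iso CL i" "Cod CL i = Y0"
    and d: "d = Comp CL (cl_projection TT Y0 l) i"
    using disp unfolding is_display_def by blast
  define X1 \<Xi> where "X1 = take l Y0" and "\<Xi> = drop l Y0"
  have Y0_eq: "Y0 = X1 @ \<Xi>" by (simp add: X1_def \<Xi>_def)
  have wY: "wf_ctx TT (X1 @ \<Xi>)" using Y0 by (simp add: Ob_Cl Y0_eq)
  have wX: "wf_ctx TT X1" by (rule wf_ctx_append[OF wY])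
  have pr: "cl_projection TT Y0 l = arr (X1 @ \<Xi>) X1 Var"
    by (simp add: cl_projection_arr X1_def[symmetric] Y0_eq[symmetric])
  have prV: "ctx_subst TT (X1 @ \<Xi>) X1 Var" by (rule ctx_subst_Var[OF wY])
  have prH: "arr (X1 @ \<Xi>) X1 Var \<in> Hom CL (X1 @ \<Xi>) X1" by (rule arr_Hom[OF wY wX prV])
  have iAr: "i \<in> Ar CL" using i(1) by (simp add: is_iso_def)
  have iH': "i \<in> Hom CL (Dom CL i) (X1 @ \<Xi>)" using cat_Ar_Hom[OF C iAr] i(2) Y0_eq by simp
  have "d \<in> Hom CL (Dom CL i) X1" unfolding d pr by (rule cat_Comp[OF C iH' prH])
  then have "Dom CL i = Y" and X0: "X0 = X1" using H(4) by (auto simp: Hom_def)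
  then have iH: "i \<in> Hom CL Y (X1 @ \<Xi>)" using iH' by simp
  obtain j where j: "j \<in> Hom CL (X1 @ \<Xi>) Y" "Comp CL j i = Ident CL Y" "Comp CL i j = Ident CL (X1 @ \<Xi>)"
    using i(1) unfolding is_iso_def \<open>Dom CL i = Y\<close> i(2)[unfolded Y0_eq] by blast
  have d': "d = Comp CL (arr (X1 @ \<Xi>) X1 Var) i" using d pr by simp
  obtain \<sigma> where w\<Gamma>: "wf_ctx TT \<Gamma>" and \<sigma>: "f = arr \<Gamma> X1 \<sigma>" "ctx_subst TT \<Gamma> X1 \<sigma>"
    using H(3) unfolding X0 by (rule Hom_ClE)
  obtain \<Xi>' \<tau> where P0: "wf_ctx TT (\<Gamma> @ \<Xi>')" and \<tau>: "ctx_subst TT (\<Gamma> @ \<Xi>') (X1 @ \<Xi>) \<tau>"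
    and \<tau>X: "\<forall>y \<in> fv_ctx X1. \<tau> y = \<sigma> y"
    and new: "\<forall>(z, S') \<in> set \<Xi>'. \<exists>y S. (y, S) \<in> set \<Xi> \<and> \<tau> y = Var z \<and> S' = subst \<tau> S"
    and univ: "\<forall>Q u v. wf_ctx TT Q \<longrightarrow> ctx_subst TT Q \<Gamma> u \<longrightarrow> ctx_subst TT Q (X1 @ \<Xi>) v \<longrightarrow>
      ctx_subst_eq TT Q X1 (\<lambda>y. subst u (\<sigma> y)) v \<longrightarrow>
      (\<exists>w. ctx_subst TT Q (\<Gamma> @ \<Xi>') w \<and> (\<forall>y \<in> fv_ctx \<Gamma>. w y = u y) \<and>
        ctx_subst_eq TT Q (X1 @ \<Xi>) (\<lambda>y. subst w (\<tau> y)) v)"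
    using telescope_pullback[OF wY w\<Gamma> \<sigma>(2)] by blast
  let ?P0 = "\<Gamma> @ \<Xi>'"
  have p0V: "ctx_subst TT ?P0 \<Gamma> Var" by (rule ctx_subst_Var[OF P0])
  define p0 r1 r0 where "p0 = arr ?P0 \<Gamma> Var" and "r1 = arr ?P0 (X1 @ \<Xi>) \<tau>" and "r0 = Comp CL j r1"
  have p0: "p0 \<in> Hom CL ?P0 \<Gamma>" and r1: "r1 \<in> Hom CL ?P0 (X1 @ \<Xi>)"
    unfolding p0_def r1_def by (rule arr_Hom[OF P0 w\<Gamma> p0V] arr_Hom[OF P0 wY \<tau>])+
  have r0: "r0 \<in> Hom CL ?P0 Y" unfolding r0_def by (rule cat_Comp[OF C r1 j(1)])
  have ir0: "Comp CL i r0 = r1"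
    unfolding r0_def using cat_assoc[OF C r1 j(1) iH] j(3) cat_Ident_Comp[OF C r1] by simp
  have "Comp CL f p0 = arr ?P0 X1 (\<lambda>y. subst Var (\<sigma> y))"
    unfolding \<sigma>(1) p0_def by (rule Comp_arr[OF P0 w\<Gamma> wX p0V \<sigma>(2)])
  also have "\<dots> = arr ?P0 X1 (\<lambda>y. subst \<tau> (Var y))" by (rule arr_cong) (simp add: subst_Var \<tau>X)
  also have "\<dots> = Comp CL (arr (X1 @ \<Xi>) X1 Var) r1"
    unfolding r1_def by (rule Comp_arr[OF P0 wY wX \<tau> prV, symmetric])
  also have "\<dots> = Comp CL d r0"
    unfolding d' ir0[symmetric] by (rule cat_assoc[OF C r0 iH prH])
  finally have sq0: "Comp CL f p0 = Comp CL d r0" .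
  \<comment> \<open>The comparison maps \<open>h: P\<^sub>0 \<rightarrow> P\<close> and \<open>m: P \<rightarrow> P\<^sub>0\<close>. In the clan it is not checked that they are
    inverse; in the model \<open>B\<close> the equation \<open>h(m z) = z\<close> follows from uniqueness of pairs.\<close>
  obtain h where h: "h \<in> Hom CL ?P0 P" "Comp CL p h = p0" "Comp CL r h = r0"
    using pb[unfolded is_pullback_iff[OF H]] HomD(2)[OF p0] p0 r0 sq0 by blast
  obtain u where wP: "wf_ctx TT P" and u: "p = arr P \<Gamma> u" "ctx_subst TT P \<Gamma> u" using H(1) by (rule Hom_ClE)
  have ir: "Comp CL i r \<in> Hom CL P (X1 @ \<Xi>)" by (rule cat_Comp[OF C H(2) iH])
  obtain v where v: "Comp CL i r = arr P (X1 @ \<Xi>) v" "ctx_subst TT P (X1 @ \<Xi>) v" using ir by (rule Hom_ClE)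
  have vX: "ctx_subst TT P X1 v" using v(2) by (simp add: ctx_subst_def)
  have "arr P X1 (\<lambda>y. subst u (\<sigma> y)) = Comp CL f p"
    unfolding \<sigma>(1) u(1) by (rule Comp_arr[OF wP w\<Gamma> wX u(2) \<sigma>(2), symmetric])
  also have "\<dots> = Comp CL (arr (X1 @ \<Xi>) X1 Var) (Comp CL i r)"
    using disp_square_comm[OF sq] cat_assoc[OF C H(2) iH prH] d' by simp
  also have "\<dots> = arr P X1 v" unfolding v(1) Comp_arr[OF wP wY wX v(2) prV] by simp
  finally have "ctx_subst_eq TT P X1 (\<lambda>y. subst u (\<sigma> y)) v"
    using arr_eq_iff[OF wP wX ctx_subst_comp[OF wP w\<Gamma> u(2) \<sigma>(2)] vX] by simp
  then obtain w where w: "ctx_subst TT P ?P0 w" "\<forall>y \<in> fv_ctx \<Gamma>. w y = u y"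
    "ctx_subst_eq TT P (X1 @ \<Xi>) (\<lambda>y. subst w (\<tau> y)) v"
    using univ wP u(2) v(2) by blast
  define m where "m = arr P ?P0 w"
  have m: "m \<in> Hom CL P ?P0" unfolding m_def by (rule arr_Hom[OF wP P0 w(1)])
  have p0m: "Comp CL p0 m = p"
    unfolding p0_def m_def u(1) Comp_arr[OF wP P0 w\<Gamma> w(1) p0V] by (rule arr_cong) (use w(2) in force)
  have r1m: "Comp CL r1 m = Comp CL i r"
    unfolding r1_def m_def v(1) Comp_arr[OF wP P0 wY w(1) \<tau>]
    using arr_eq_iff[OF wP wY ctx_subst_comp[OF wP P0 w(1) \<tau>] v(2)] w(3) by simp
  have r0m: "Comp CL r0 m = r"
    unfolding r0_def using cat_assoc[OF C m r1 j(1)] cat_assoc[OF C H(2) iH j(1)] r1m j(2)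
      cat_Ident_Comp[OF C H(2)] by simp
  define z0 where "z0 = act B m z"
  have z0: "z0 \<in> elts (fob B ?P0)" unfolding z0_def by (rule m_act_in[OF B m z])
  have pz0: "act B p0 z0 = act B p z" and rz0: "act B r0 z0 = act B r z"
    unfolding z0_def using m_act_Comp[OF B m p0 z] m_act_Comp[OF B m r0 z] p0m r0m by simp_all
  have hz0: "act B h z0 = z"
  proof (rule model_pair_unique[OF B sq m_act_in[OF B h(1) z0] z])
    show "act B p (act B h z0) = act B p z" using m_act_Comp[OF B h(1) H(1) z0] h(2) pz0 by simp
    show "act B r (act B h z0) = act B r z" using m_act_Comp[OF B h(1) H(2) z0] h(3) rz0 by simp
  qed
  have vars: "act B (term_arr ?P0 A \<alpha> (Var y)) z0 \<in> Im (sort_total A)"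
    if y: "(y, sort_app A \<alpha>) \<in> set ?P0" and A: "dr TT A \<le> k" for y A \<alpha>
  proof (cases "(y, sort_app A \<alpha>) \<in> set \<Gamma>")
    case True
    have t: "derivable TT (\<Gamma> \<turnstile> HasType (Var y) (sort_app A \<alpha>))" by (rule wf_ctx_var[OF w\<Gamma> True])
    have "act B (term_arr ?P0 A \<alpha> (Var y)) z0 = act B (term_arr \<Gamma> A \<alpha> (Var y)) (act B p z)"
      using m_act_Comp[OF B p0 term_arr_Hom[OF t] z0] term_arr_Comp[OF t p0V P0] pz0
      by (simp add: p0_def subst_Var)
    then show ?thesis using liftable_term[OF zp t A] by simp
  next
    case False
    then obtain y' S where y': "(y', S) \<in> set \<Xi>" "\<tau> y' = Var y" "sort_app A \<alpha> = subst \<tau> S"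
      using new y by auto
    have "(y', S) \<in> set (X1 @ \<Xi>)" using y'(1) by simp
    then obtain D \<mu> where D: "S = sort_app D \<mu>" using ctx_entry_sort[OF wY] by blast
    have t: "derivable TT (X1 @ \<Xi> \<turnstile> HasType (Var y') (sort_app D \<mu>))"
      using wf_ctx_var[OF wY, of y' S] y'(1) by (simp add: D)
    have t0: "derivable TT (?P0 \<turnstile> HasType (Var y) (sort_app A \<alpha>))" by (rule wf_ctx_var[OF P0 y])
    have "sort_app A \<alpha> = sort_app D (\<lambda>x. subst \<tau> (\<mu> x))" using y'(3) by (simp add: D subst_sort_app)
    then have "derivable TT (?P0 \<turnstile> TypeEq (sort_app A \<alpha>) (sort_app D (\<lambda>x. subst \<tau> (\<mu> x))))"
      using type_refl[OF HasType_presup[OF t0]] by simp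
    note e = term_arr_eq[OF t0 this]
    have "term_arr ?P0 A \<alpha> (Var y) = Comp CL (term_arr (X1 @ \<Xi>) D \<mu> (Var y')) r1"
      unfolding e(2) r1_def term_arr_Comp[OF t \<tau> P0] by (simp add: y'(2))
    moreover have "act B r1 z0 = act B i (act B r z)"
      using m_act_Comp[OF B r0 iH z0] ir0 rz0 by simp
    moreover have "act B i (act B r z) \<in> liftable (X1 @ \<Xi>)"
      by (rule liftable_act[OF iH m_act_in[OF B H(2) z] zr])
    ultimately show ?thesis
      using m_act_Comp[OF B r1 term_arr_Hom[OF t] z0] liftable_term[OF _ t] A e(1) by simp
  qed
  show ?thesis
    unfolding liftable_def
  proof (clarify)
    fix A n assume A: "A \<in> sorts TT" "dr TT A \<le> k" and n: "n \<in> Hom CL P (sort_total A)"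
    obtain \<alpha> t where t: "Comp CL n h = term_arr ?P0 A \<alpha> t" "derivable TT (?P0 \<turnstile> HasType t (sort_app A \<alpha>))"
      using cat_Comp[OF C h(1) n] A(1) by (rule Hom_sort_totalE)
    have "act B n z = act B (term_arr ?P0 A \<alpha> t) z0"
      using m_act_Comp[OF B h(1) n z0] hz0 t(1) by simp
    then show "act B n z \<in> Im (sort_total A)" using terms_in_image[OF P0 z0 vars t(2) A(2)] by simp
  qed
qed

lemma all_liftable: "wf_ctx TT \<Gamma> \<Longrightarrow> elts (fob B \<Gamma>) \<subseteq> liftable \<Gamma>"
proof -
  have "closed_family B liftable"
    unfolding closed_family_def using liftable_act liftable_pair by blast
  moreover have "\<forall>\<Gamma> \<in> Ob CL. \<forall>x \<in> elts (fob M \<Gamma>). cmp q \<Gamma> x \<in> liftable \<Gamma>"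
    unfolding liftable_def using Im_act unfolding Im_def by blast
  ultimately show "wf_ctx TT \<Gamma> \<Longrightarrow> elts (fob B \<Gamma>) \<subseteq> liftable \<Gamma>" using no_submodel by (simp add: Ob_Cl)
qed

text \<open>Together with \<open>q_eq\<close> this gives injectivity of \<open>g\<close>: two elements with the same image under \<open>g\<close> lift to
  elements of \<open>M\<close> that are identified by \<open>\<phi>\<close>, hence by \<open>q\<close>.\<close>

lemma q_surj_low:
  assumes wf: "wf_ctx TT \<Gamma>" and low: "low k \<Gamma>" shows "elts (fob B \<Gamma>) \<subseteq> Im \<Gamma>"
proof
  fix b assume b: "b \<in> elts (fob B \<Gamma>)"
  show "b \<in> Im \<Gamma>"
  proof (rule in_image_if_coordinates[OF wf low b])
    fix y A \<sigma> assume y: "(y, sort_app A \<sigma>) \<in> set \<Gamma>"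
    then have "dr TT A \<le> k" using low unfolding low_def by blast
    then show "act B (term_arr \<Gamma> A \<sigma> (Var y)) b \<in> Im (sort_total A)"
      using liftable_term[OF _ wf_ctx_var[OF wf y]] all_liftable[OF wf] b by blast
  qed
qed

lemma g_inj_low:
  assumes wf: "wf_ctx TT \<Gamma>" and low: "low k \<Gamma>" shows "inj_on (cmp g \<Gamma>) (elts (fob B \<Gamma>))"
proof (rule inj_onI)
  fix b b' assume "b \<in> elts (fob B \<Gamma>)" "b' \<in> elts (fob B \<Gamma>)" and eq: "cmp g \<Gamma> b = cmp g \<Gamma> b'"
  then have "b \<in> Im \<Gamma>" "b' \<in> Im \<Gamma>" using q_surj_low[OF assms] by blast+
  then obtain a a' where a: "a \<in> elts (fob M \<Gamma>)" "b = cmp q \<Gamma> a" "a' \<in> elts (fob M \<Gamma>)" "b' = cmp q \<Gamma> a'"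
    unfolding Im_def by blast
  then have "cmp \<phi> \<Gamma> a = cmp \<phi> \<Gamma> a'"
    using cmp_\<phi>[OF wf a(1)] cmp_\<phi>[OF wf a(3)] eq by simp
  moreover have "\<Gamma> \<in> Ob CL" using wf by (simp add: Ob_Cl)
  ultimately show "b = b'" unfolding a(2,4) using q_eq[rule_format, OF _ a(1,3)] by blast
qed

end

subsection \<open>Conclusion\<close>

context gat_models
begin

lemma quotient_exists:
  assumes h: "h \<in> Hom MOD M X"
  shows "\<exists>q g. q \<in> Hom MOD M (Dom MOD g) \<and> g \<in> Hom MOD (Dom MOD g) X \<and> Comp MOD g q = h \<and>
    regular_epi MOD q \<and>
    (\<forall>k. (\<forall>\<Gamma>. wf_ctx TT \<Gamma> \<longrightarrow> low (k - 1) \<Gamma> \<longrightarrow> inj_on (cmp h \<Gamma>) (elts (fob M \<Gamma>))) \<longrightarrow>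
      (\<forall>\<Gamma>. wf_ctx TT \<Gamma> \<longrightarrow> low k \<Gamma> \<longrightarrow> inj_on (cmp g \<Gamma>) (elts (fob (Dom MOD g) \<Gamma>))))"
proof -
  obtain B q g where q: "q \<in> Hom MOD M B" and g: "g \<in> Hom MOD B X" and gq: "Comp MOD g q = h"
    and epi: "regular_epi MOD q"
    and q_eq: "\<forall>a \<in> Ob CL. \<forall>x \<in> elts (fob M a). \<forall>y \<in> elts (fob M a).
      cmp h a x = cmp h a y \<longrightarrow> cmp q a x = cmp q a y"
    and sub: "\<forall>S. closed_family B S \<longrightarrow> (\<forall>a \<in> Ob CL. \<forall>x \<in> elts (fob M a). cmp q a x \<in> S a) \<longrightarrow>
      (\<forall>a \<in> Ob CL. elts (fob B a) \<subseteq> S a)"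
    by (rule kernel_pair_coequalizer[OF h])
  have B: "Dom MOD g = B" by (rule Dom_MOD[OF g])
  have "inj_on (cmp g \<Gamma>) (elts (fob B \<Gamma>))"
    if inj: "\<forall>\<Gamma>. wf_ctx TT \<Gamma> \<longrightarrow> low (k - 1) \<Gamma> \<longrightarrow> inj_on (cmp h \<Gamma>) (elts (fob M \<Gamma>))"
      and "wf_ctx TT \<Gamma>" "low k \<Gamma>" for k \<Gamma>
  proof -
    interpret quotient_step TT elts M B X h q g k
      by unfold_locales ((rule q g gq q_eq sub)+, rule inj[rule_format])
    show ?thesis by (rule g_inj_low[OF that(2,3)])
  qed
  then have "\<forall>k. (\<forall>\<Gamma>. wf_ctx TT \<Gamma> \<longrightarrow> low (k - 1) \<Gamma> \<longrightarrow> inj_on (cmp h \<Gamma>) (elts (fob M \<Gamma>))) \<longrightarrow>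
      (\<forall>\<Gamma>. wf_ctx TT \<Gamma> \<longrightarrow> low k \<Gamma> \<longrightarrow> inj_on (cmp g \<Gamma>) (elts (fob (Dom MOD g) \<Gamma>)))"
    unfolding B by (intro allI impI)
  then show ?thesis
    using q g gq epi by (intro exI[of _ q] exI[of _ g]) (simp only: B simp_thms)
qed

text \<open>Starting from injectivity below rank 0, which concerns the empty context alone, \<open>n + 1\<close> quotients give
  a map that is injective on all contexts, hence a monomorphism, hence orthogonal to all regular
  epimorphisms.\<close>

theorem decomposition_of_length:
  assumes f: "f \<in> Ar MOD" and n: "is_max_dr TT n"
  shows "\<exists>F \<phi>. regular_decomposition elts MOD f F \<phi> \<and>
    stable_from elts MOD \<phi> (ord_of_nat elts (nat (n + 1)))"
proof -
  let ?N = "nat (n + 1)"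
  define X where "X = Cod MOD f"
  let ?inj = "\<lambda>k h. \<forall>\<Gamma>. wf_ctx TT \<Gamma> \<longrightarrow> low k \<Gamma> \<longrightarrow> inj_on (cmp h \<Gamma>) (elts (fob (Dom MOD h) \<Gamma>))"
  have fX: "f \<in> Hom MOD (Dom MOD f) X" unfolding X_def by (rule cat_Ar_Hom[OF is_category_MOD f])
  have "\<forall>h. \<exists>q g. h \<in> Hom MOD (Dom MOD h) X \<longrightarrow> q \<in> Hom MOD (Dom MOD h) (Dom MOD g) \<and>
      g \<in> Hom MOD (Dom MOD g) X \<and> Comp MOD g q = h \<and> regular_epi MOD q \<and>
      (\<forall>k. ?inj (k - 1) h \<longrightarrow> ?inj k g)"
    using quotient_exists by blast
  then obtain Q G where QG: "\<And>h. h \<in> Hom MOD (Dom MOD h) X \<Longrightarrow>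
      Q h \<in> Hom MOD (Dom MOD h) (Dom MOD (G h)) \<and> G h \<in> Hom MOD (Dom MOD (G h)) X \<and>
      Comp MOD (G h) (Q h) = h \<and> regular_epi MOD (Q h) \<and> (\<forall>k. ?inj (k - 1) h \<longrightarrow> ?inj k (G h))"
    by metis
  define g where "g j = (G ^^ j) f" for j
  have g0: "f = g 0" and gS: "\<And>j. g (Suc j) = G (g j)" by (simp_all add: g_def)
  have gH: "g j \<in> Hom MOD (Dom MOD (g j)) X" for j
  proof (induction j)
    case (Suc j) then show ?case using QG[OF Suc] gS by simp
  qed (use fX g0 in simp)
  have chain: "countable_chain MOD (\<lambda>j. Dom MOD (g j)) (\<lambda>j. Q (g j)) g X"
    by unfold_locales (use is_category_MOD QG[OF gH] gH gS in auto)
  have inj: "?inj (int j - 1) (g j)" for j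
  proof (induction j)
    case 0
    have "inj_on (cmp (g 0) \<Gamma>) (elts (fob (Dom MOD (g 0)) \<Gamma>))" if wf: "wf_ctx TT \<Gamma>" and low: "low (- 1) \<Gamma>" for \<Gamma>
    proof -
      have "\<Gamma> = []"
      proof (rule ccontr)
        assume "\<Gamma> \<noteq> []"
        then obtain y S where yS: "(y, S) \<in> set \<Gamma>" by (metis last_in_set surj_pair)
        then obtain A \<sigma> where A: "A \<in> sorts TT" "S = sort_app A \<sigma>" using ctx_entry_sort[OF wf] by blast
        then have "dr TT A \<le> -1" using low yS unfolding low_def by blast
        then show False using dr_nonneg[OF A(1)] by simp
      qed
      moreover have "model (Dom MOD (g 0))" using gH[of 0] by (simp add: Hom_MOD_iff)
      ultimately show ?thesis using model_terminal[OF _ Nil_terminal] unfolding inj_on_def by blast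
    qed
    then show ?case by simp
  next
    case (Suc j)
    then show ?case using QG[OF gH[of j]] gS by simp
  qed
  have "-1 \<le> n" using n max_rank_ge unfolding is_max_dr_def by blast
  then have N: "int ?N - 1 = n" by simp
  have low: "low n \<Gamma>" if wf: "wf_ctx TT \<Gamma>" for \<Gamma>
    unfolding low_def
  proof (intro allI impI)
    fix y A \<sigma> assume "(y, sort_app A \<sigma>) \<in> set \<Gamma>"
    then have "A \<in> sorts TT" using HasType_sort_ctx(1)[OF wf_ctx_var[OF wf]] by blast
    then show "dr TT A \<le> n" using n unfolding is_max_dr_def max_rank_def by (auto intro!: Max_ge)
  qed
  have orth: "orthogonal MOD e (g ?N)" if e: "regular_epi MOD e" for e
  proof (rule mono_orthogonal_regular_epi[OF is_category_MOD gH _ e])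
    fix Z s t assume s: "s \<in> Hom MOD Z (Dom MOD (g ?N))" and t: "t \<in> Hom MOD Z (Dom MOD (g ?N))"
      and st: "Comp MOD (g ?N) s = Comp MOD (g ?N) t"
    show "s = t"
    proof (rule MOD_ext[OF s t])
      fix \<Gamma> x assume \<Gamma>: "\<Gamma> \<in> Ob CL" and x: "x \<in> elts (fob Z \<Gamma>)"
      have "cmp (g ?N) \<Gamma> (cmp s \<Gamma> x) = cmp (g ?N) \<Gamma> (cmp t \<Gamma> x)"
        using cmp_Comp[OF s gH \<Gamma> x] cmp_Comp[OF t gH \<Gamma> x] st by simp
      moreover have "inj_on (cmp (g ?N) \<Gamma>) (elts (fob (Dom MOD (g ?N)) \<Gamma>))"
        using inj[of ?N] low \<Gamma> unfolding N by (simp add: Ob_Cl)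
      ultimately show "cmp s \<Gamma> x = cmp t \<Gamma> x"
        using cmp_in[OF s \<Gamma> x] cmp_in[OF t \<Gamma> x] by (auto dest: inj_onD)
    qed
  qed
  show ?thesis
    by (rule chain_regular_decomposition[OF chain _ g0 orth]) (use QG[OF gH] in blast)
qed

end

theorem theorem5p61:
  fixes elts :: "'u \<Rightarrow> 'u set"
    and TT :: "('v, 'a, 'f) theory_data"
    and n :: int
  assumes "universe elts"
    and "infinite (UNIV :: 'v set)" and "small elts (UNIV :: 'v set)"
    and "gat elts TT"
    and "non_descending TT"
    and "is_max_dr TT n"
  shows "\<exists>d. is_delta elts (Mod_Cl elts TT) d \<and> ole elts d (ord_of_nat elts (nat (n + 2)))"
proof -
  interpret gat_models TT elts
    by unfold_locales (use assms in auto)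
  have "-1 \<le> n" using assms(6) max_rank_ge unfolding is_max_dr_def by blast
  then have n: "nat (n + 2) = Suc (nat (n + 1))" by simp
  show ?thesis
    unfolding n MOD_eq[symmetric]
    using is_delta_bounded[of MOD "nat (n + 1)"] decomposition_of_length[OF _ assms(6)] by blast
qed

end
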